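(* There is a universal constant $C$ (independent of $p$ and $n$) such that the following holds for all integers $n\ge 4$ and all $0<p<1$. Let $G_n\sim G(n,p)$ be an Erdős–Rényi random graph on $n$ vertices with edge probability $p$, let $W=(W_1(p,G_n),W_2(p,G_n))$, and let $Z$ be a standard bivariate normal random vector. Then $$d_c\bigl(\mathscr{L}(W),\mathscr{L}(Z)\bigr)\le\frac{C}{p^9(1-p)^3\sqrt{n}}.$$
   Context: All graphs are simple and undirected. $G(n,p)$ is the random graph on $n$ vertices in which each pair of vertices is connected with probability $p$, independently of all other pairs. For a graph $G_n$ on $n$ vertices, $T_1(G_n)$ is the number of edges of $G_n$, and $T_2(G_n)$ is the number of $4$-cycles in $G_n$ (i.e. the number of injective graph homomorphisms from the cycle graph $C_4$ into $G_n$, divided by $8$). Define $$W_1(p,G_n)=\frac{T_1(G_n)-\binom n2 p}{\sigma_1},\qquad \sigma_1^2=\binom n2 p(1-p),$$ $$W_2(p,G_n)=\frac{T_2(G_n)-2\binom{n-2}{2}p^3T_1(G_n)+9\binom n4p^4}{\sigma_2},\qquad \sigma_2^2=3\binom n4p^4(1-p)^2\bigl(1+2p+(4n-11)p^2\bigr),$$ with $\sigma_1,\sigma_2>0$. $\mathscr{L}(X)$ denotes the law of $X$, and $d_c(\mathscr{L}(X),\mathscr{L}(Y))=\sup_{A}|\mathbb{P}(X\in A)-\mathbb{P}(Y\in A)|$, where the supremum is over all convex sets $A\subset\mathbb{R}^2$. *)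

theory Defs
  imports "HOL-Probability.Probability"
begin

text \<open>
  A simple graph on the vertex set \<open>{..<n}\<close> is represented by its edge set, a subset of
  \<open>vertex_pairs n\<close>.
\<close>

definition vertex_pairs :: "nat \<Rightarrow> nat set set" where
  "vertex_pairs n = {e. e \<subseteq> {..<n} \<and> card e = 2}"

definition erdos_renyi :: "nat \<Rightarrow> real \<Rightarrow> nat set set pmf" where
  "erdos_renyi n p =
     map_pmf (\<lambda>X. {e \<in> vertex_pairs n. X e}) (Pi_pmf (vertex_pairs n) False (\<lambda>_. bernoulli_pmf p))"

definition inj_graph_homs ::
    "'a set \<Rightarrow> 'a set set \<Rightarrow> 'b set \<Rightarrow> 'b set set \<Rightarrow> ('a \<Rightarrow> 'b) set" where
  "inj_graph_homs U F V E = {f \<in> U \<rightarrow>\<^sub>E V. inj_on f U \<and> (\<forall>e\<in>F. f ` e \<in> E)}"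

definition C4_edges :: "nat set set" where
  "C4_edges = {{0, 1}, {1, 2}, {2, 3}, {3, 0}}"

definition T1 :: "nat set set \<Rightarrow> real" where
  "T1 G = real (card G)"

definition T2 :: "nat \<Rightarrow> nat set set \<Rightarrow> real" where
  "T2 n G = real (card (inj_graph_homs {..<4} C4_edges {..<n} G)) / 8"

definition sigma1 :: "nat \<Rightarrow> real \<Rightarrow> real" where
  "sigma1 n p = sqrt (real (n choose 2) * p * (1 - p))"

definition sigma2 :: "nat \<Rightarrow> real \<Rightarrow> real" where
  "sigma2 n p =
     sqrt (3 * real (n choose 4) * p ^ 4 * (1 - p) ^ 2 * (1 + 2 * p + (4 * real n - 11) * p ^ 2))"

definition W1 :: "nat \<Rightarrow> real \<Rightarrow> nat set set \<Rightarrow> real" where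
  "W1 n p G = (T1 G - real (n choose 2) * p) / sigma1 n p"

definition W2 :: "nat \<Rightarrow> real \<Rightarrow> nat set set \<Rightarrow> real" where
  "W2 n p G =
     (T2 n G - 2 * real ((n - 2) choose 2) * p ^ 3 * T1 G + 9 * real (n choose 4) * p ^ 4)
       / sigma2 n p"

definition std_bivariate_normal :: "(real \<times> real) measure" where
  "std_bivariate_normal =
     density lborel (\<lambda>(x, y). ennreal (std_normal_density x * std_normal_density y))"

text \<open>
  The supremum is over all convex sets, and a convex set need not be Borel, in which case
  \<open>measure\<close> would return the junk value 0 for a Borel measure. Hence the completions; by
  \<open>sets_completion_std_bivariate_normal\<close> below every convex set is measurable for the
  completed normal law, and for the law of a discrete vector, given as a pmf, every set is
  measurable anyway.
\<close>

definition convex_dist :: "(real \<times> real) measure \<Rightarrow> (real \<times> real) measure \<Rightarrow> real" where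
  "convex_dist M N =
     (SUP A\<in>{A. convex A}. \<bar>measure (completion M) A - measure (completion N) A\<bar>)"

lemma std_bivariate_normal_eq_pair:
  "std_bivariate_normal =
     density lborel (\<lambda>x. ennreal (std_normal_density x)) \<Otimes>\<^sub>M
     density lborel (\<lambda>x. ennreal (std_normal_density x))"
proof -
  interpret N: prob_space "density lborel (\<lambda>x. ennreal (std_normal_density x))"
    by (rule prob_space_normal_density) simp
  show ?thesis
    unfolding std_bivariate_normal_def
    by (subst pair_measure_density)
       (auto simp: lborel_prod ennreal_mult N.sigma_finite_measure_axioms
         intro: sigma_finite_lborel)
qed

lemma prob_space_std_bivariate_normal: "prob_space std_bivariate_normal"
proof -
  interpret N: prob_space "density lborel (\<lambda>x. ennreal (std_normal_density x))"
    by (rule prob_space_normal_density) simp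
  interpret NN: pair_prob_space "density lborel (\<lambda>x. ennreal (std_normal_density x))"
    "density lborel (\<lambda>x. ennreal (std_normal_density x))" ..
  show ?thesis
    unfolding std_bivariate_normal_eq_pair by (rule NN.prob_space_axioms)
qed

lemma sets_completion_std_bivariate_normal:
  assumes "convex A"
  shows "A \<in> sets (completion std_bivariate_normal)"
proof -
  have "negligible (frontier A)"
    using assms by (rule negligible_convex_frontier)
  then have "frontier A \<in> null_sets lborel"
    by (simp add: negligible_iff_null_sets null_sets_completion_iff)
  moreover have "absolutely_continuous lborel std_bivariate_normal"
    unfolding std_bivariate_normal_def
    by (rule absolutely_continuousI_density) (simp add: lborel_prod[symmetric])
  ultimately have null: "frontier A \<in> null_sets std_bivariate_normal"
    by (auto simp: absolutely_continuous_def)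
  have "A = interior A \<union> (A - interior A)"
    using interior_subset by blast
  moreover have "A - interior A \<subseteq> frontier A"
    using closure_subset by (auto simp: frontier_def)
  moreover have "interior A \<in> sets std_bivariate_normal"
    by (simp add: std_bivariate_normal_def)
  ultimately show ?thesis
    using null by (intro sets_completionI)
qed

end

theory Submission
  imports Defs
begin

text \<open>
  Why the bound holds. Write \<open>Y\<^sub>e\<close> for the centred indicator of the pair \<open>e\<close>. Subtracting the multiple of
  \<open>T\<^sub>1\<close> removes from \<open>T\<^sub>2\<close> exactly its part that is linear in the \<open>Y\<^sub>e\<close>, so \<open>W\<^sub>1\<close> and \<open>W\<^sub>2\<close> are uncorrelated,
  and both can be written as \<open>\<Sum>\<^sub>e Y\<^sub>e U\<^sub>e\<close> with \<open>U\<^sub>e\<close> independent of \<open>Y\<^sub>e\<close> (\<open>W1_decoupled\<close>, \<open>W2_decoupled\<close>). Such a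
  representation is a Stein coupling: \<open>E (W\<^sub>i \<psi>(W)) = \<Sum>\<^sub>e E (Y\<^sub>e U\<^sub>e (\<psi>(W) - \<psi>(W - \<Delta>\<^sub>e)))\<close>, where \<open>W - \<Delta>\<^sub>e\<close> is \<open>W\<close> averaged
  over the coin of \<open>e\<close>. A Taylor expansion turns the right-hand side into \<open>\<Sum>\<^sub>j E (T\<^sub>i\<^sub>j \<partial>\<^sub>j\<psi>(W))\<close> up to a third-order
  remainder, and \<open>E T\<close> is the identity matrix because it is the covariance matrix of \<open>W\<close>.

  The argument has two independent halves.

  The analytic half (\<open>stein_coupling.convex_gap_le\<close>) bounds the distance \<open>\<kappa>\<close> over convex sets by a universal
  multiple of \<open>\<epsilon>\<close>, as soon as the entries of \<open>T\<close> are within \<open>\<epsilon>\<close> of those of the identity in mean square and the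
  remainder is at most \<open>\<epsilon>\<^sup>2\<close>. The law of \<open>W\<close> is joined to the Gaussian law by the rotation
  \<open>cos t W + sin t Z\<close>, and only angles with \<open>sin t \<ge> \<epsilon>\<close> are used. The derivative along this path involves second
  derivatives of the smoothed indicator of a convex set \<open>A\<close>, whose supremum is of order \<open>(sin t)\<^sup>-\<^sup>2\<close>; a
  direct estimate would cost a factor \<open>ln (1/\<epsilon>)\<close>. In mean square these derivatives are smaller, because they
  are negligible away from the boundary of \<open>A\<close>, and since translates of convex sets intersect in convex
  sets, the probability that \<open>W\<close> is near the boundary is the Gaussian one up to \<open>4 \<kappa>\<close>
  (\<open>exit_probability\<close>, \<open>expectation_smooth_square\<close>). This gives \<open>\<kappa> \<le> C \<epsilon> (1 + sqrt \<kappa> ln (1/\<epsilon>))\<close>, which implies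
  \<open>\<kappa> \<le> C' \<epsilon>\<close>. The geometry of convex sets enters only through \<open>gauss_exit\<close>: a translation by \<open>v\<close> moves at most the
  mass \<open>\<bar>v\<^sub>1\<bar> + \<bar>v\<^sub>2\<bar>\<close> out of a convex set, since every section parallel to an axis is an interval.

  The combinatorial half verifies the hypotheses with \<open>\<epsilon>\<close> a multiple of \<open>1 / (p\<^sup>9 (1 - p)\<^sup>3 sqrt n)\<close>. The
  Poincare inequality for independent coins (\<open>poincare\<close>) reduces all moments to counting: changing one
  pair \<open>e\<close> changes the number of paths of length three between \<open>a\<close> and \<open>b\<close> by at most a multiple of \<open>n\<close> if \<open>e\<close>
  contains \<open>a\<close> or \<open>b\<close>, and by a constant otherwise. The class \<open>arc_field\<close> records this, and the second and fourth
  moments, the fluctuation of \<open>T\<close> (\<open>carre_variance\<close>) and the remainder (\<open>third_moment_sum\<close>) follow from it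
  alone. All factors \<open>Y\<^sub>e\<close> are bounded by one, so the powers of \<open>p\<close> and \<open>1 - p\<close> come only from the lower
  bounds for \<open>\<sigma>\<^sub>1\<close> and \<open>\<sigma>\<^sub>2\<close>.
\<close>

text \<open>
  The \<open>k\<close>-th derivative, for \<open>k \<le> 3\<close>, of the density of the centred normal law with standard deviation \<open>s\<close>.
\<close>

fun dnormal :: "nat \<Rightarrow> real \<Rightarrow> real \<Rightarrow> real" where
  "dnormal 0 s u = normal_density 0 s u"
| "dnormal (Suc 0) s u = - (u / s^2) * normal_density 0 s u"
| "dnormal (Suc (Suc 0)) s u = (u^2 / s^4 - 1 / s^2) * normal_density 0 s u"
| "dnormal (Suc (Suc (Suc _))) s u = (3 * u / s^4 - u^3 / s^6) * normal_density 0 s u"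

section \<open>Derivatives of the normal density\<close>

lemma normal_density_0_eq:
  "s > 0 \<Longrightarrow> normal_density 0 s u = exp (- (u^2) / (2 * s^2)) / (s * sqrt (2 * pi))"
  by (simp add: normal_density_def real_sqrt_mult)

lemma dnormal_scale:
  assumes "s > 0"
  shows "dnormal k s u = dnormal k 1 (u / s) / s ^ (Suc (min k 3))"
proof -
  have *: "normal_density 0 s u = normal_density 0 1 (u / s) / s"
    using assms by (simp add: normal_density_0_eq power_divide field_simps)
  show ?thesis
    by (cases "(k, s, u)" rule: dnormal.cases)
       (use assms in \<open>simp_all add: * field_simps power_divide eval_nat_numeral\<close>)
qed

lemma dnormal_DERIV:
  assumes "s > 0" "k \<le> 2"
  shows "(dnormal k s has_real_derivative dnormal (Suc k) s u) (at u)"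
proof -
  have n: "(normal_density 0 s has_real_derivative - (u / s^2) * normal_density 0 s u) (at u)" for u
    unfolding normal_density_0_eq[OF assms(1), abs_def]
    by (rule derivative_eq_intros refl | (use assms in \<open>simp add: field_simps power2_eq_square\<close>; fail))+
  have "k = 0 \<or> k = Suc 0 \<or> k = Suc (Suc 0)"
    using assms(2) by auto
  then show ?thesis
  proof (elim disjE)
    assume k: "k = 0"
    have "dnormal 0 s = normal_density 0 s" by auto
    then show ?thesis using n k by simp
  next
    assume k: "k = Suc 0"
    have e: "dnormal (Suc 0) s = (\<lambda>u. - (u / s^2) * normal_density 0 s u)" by auto
    show ?thesis unfolding k e
      by (rule derivative_eq_intros n refl
        | (use assms in \<open>simp add: field_simps eval_nat_numeral\<close>; fail))+
  next
    assume k: "k = Suc (Suc 0)"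
    have e: "dnormal (Suc (Suc 0)) s = (\<lambda>u. (u^2 / s^4 - 1 / s^2) * normal_density 0 s u)" by auto
    show ?thesis unfolding k e
      by (rule derivative_eq_intros n refl
        | (use assms in \<open>simp add: field_simps eval_nat_numeral\<close>; fail))+
  qed
qed

lemma dnormal_continuous[continuous_intros]:
  assumes "s > 0" "continuous_on S f"
  shows "continuous_on S (\<lambda>x. dnormal k s (f x))"
proof -
  have "continuous_on UNIV (dnormal k s)"
    by (cases "(k, s, 0::real)" rule: dnormal.cases)
       (use assms in \<open>auto simp: normal_density_def intro!: continuous_intros\<close>)
  then show ?thesis
    using assms(2) by (metis continuous_on_compose2 subset_UNIV)
qed

lemma dnormal_measurable[measurable]: "dnormal k s \<in> borel_measurable borel"
  by (cases "(k, s, 0::real)" rule: dnormal.cases) (auto simp: fun_eq_iff cong: measurable_cong)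

text \<open>
  With \<open>s = sin t\<close>, the derivative in \<open>t\<close> has two sources: the heat equation \<open>\<partial>\<^sub>s \<phi>\<^sub>s = s \<phi>\<^sub>s''\<close> and the motion of
  the centre \<open>cos t w\<close>.
\<close>

lemma dnormal_path_DERIV:
  assumes "sin t > 0"
  shows "((\<lambda>t. dnormal 0 (sin t) (y - cos t * w)) has_real_derivative
     (sin t * cos t * dnormal 2 (sin t) (y - cos t * w) + sin t * w * dnormal 1 (sin t) (y - cos t * w))) (at t)"
proof -
  define G where "G t = exp (- ((y - cos t * w)^2) / (2 * (sin t)^2)) / (sin t * sqrt (2 * pi))" for t
  have ev: "eventually (\<lambda>t. G t = dnormal 0 (sin t) (y - cos t * w)) (nhds t)"
  proof -
    have "open {t::real. sin t > 0}" by (intro open_Collect_less continuous_intros)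
    then have "eventually (\<lambda>t. t \<in> {t::real. sin t > 0}) (nhds t)"
      using assms by (intro eventually_nhds_in_open) auto
    then show ?thesis
      by (rule eventually_mono) (simp add: G_def normal_density_0_eq)
  qed
  have "(G has_real_derivative
     (sin t * cos t * dnormal 2 (sin t) (y - cos t * w) + sin t * w * dnormal 1 (sin t) (y - cos t * w))) (at t)"
    unfolding G_def[abs_def]
    apply (rule derivative_eq_intros refl | (use assms in \<open>simp; fail\<close>))+
    using assms
    apply (simp add: numeral_2_eq_2 normal_density_0_eq)
    apply (simp add: field_simps eval_nat_numeral)
    done
  then show ?thesis
    using DERIV_cong_ev[OF refl ev refl] by simp
qed

lemma dnormal_integrable_1:
  "integrable lborel (dnormal k 1)" "integrable lborel (\<lambda>u. u * dnormal k 1 u)"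
proof -
  note m = integrable_std_normal_moment
  have m0: "integrable lborel std_normal_density" using m[of 0] by simp
  have m1: "integrable lborel (\<lambda>x. std_normal_density x * x)" using m[of 1] by simp
  have "integrable lborel (dnormal k 1) \<and> integrable lborel (\<lambda>u. u * dnormal k 1 u)"
  proof (cases "(k, 1::real, 0::real)" rule: dnormal.cases)
    case 1
    then have e: "dnormal k 1 = std_normal_density" "(\<lambda>u. u * dnormal k 1 u) = (\<lambda>x. std_normal_density x * x)"
      by (auto simp: fun_eq_iff)
    show ?thesis unfolding e(2) unfolding e(1) using m0 m1 by simp
  next
    case 2
    then have e: "dnormal k 1 = (\<lambda>x. - (std_normal_density x * x))"
      "(\<lambda>u. u * dnormal k 1 u) = (\<lambda>x. - (std_normal_density x * x^2))"
      by (auto simp: fun_eq_iff power2_eq_square)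
    show ?thesis unfolding e(2) unfolding e(1) using m1 m[of 2] by simp
  next
    case 3
    then have e: "dnormal k 1 = (\<lambda>x. std_normal_density x * x^2 - std_normal_density x)"
      "(\<lambda>u. u * dnormal k 1 u) = (\<lambda>x. std_normal_density x * x^3 - std_normal_density x * x)"
      by (auto simp: fun_eq_iff eval_nat_numeral algebra_simps)
    show ?thesis unfolding e(2) unfolding e(1) using m0 m1 m[of 2] m[of 3] by simp
  next
    case (4 j)
    then have e: "dnormal k 1 = (\<lambda>x. 3 * (std_normal_density x * x) - std_normal_density x * x^3)"
      "(\<lambda>u. u * dnormal k 1 u) = (\<lambda>x. 3 * (std_normal_density x * x^2) - std_normal_density x * x^4)"
      by (auto simp: fun_eq_iff eval_nat_numeral algebra_simps)
    show ?thesis unfolding e(2) unfolding e(1) using m1 m[of 2] m[of 3] m[of 4] by simp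
  qed
  then show "integrable lborel (dnormal k 1)" "integrable lborel (\<lambda>u. u * dnormal k 1 u)" by auto
qed

lemma dnormal_integrable[simp, intro]:
  assumes "s > 0"
  shows "integrable lborel (dnormal k s)"
proof -
  have "integrable lborel (\<lambda>u. dnormal k 1 (0 + (1/s) * u) / s ^ Suc (min k 3))"
    by (intro integrable_divide lborel_integrable_real_affine dnormal_integrable_1) (use assms in auto)
  moreover have "(\<lambda>u. dnormal k 1 (0 + (1/s) * u) / s ^ Suc (min k 3)) = dnormal k s"
    using dnormal_scale[OF assms, of k] by (auto simp: fun_eq_iff)
  ultimately show ?thesis by simp
qed

lemma dnormal_moment_integrable[simp, intro]:
  assumes "s > 0"
  shows "integrable lborel (\<lambda>u. u * dnormal k s u)"
proof -
  have "integrable lborel (\<lambda>u. s * ((0 + (1/s) * u) * dnormal k 1 (0 + (1/s) * u)) / s ^ Suc (min k 3))"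
    by (intro integrable_divide integrable_mult_right
        lborel_integrable_real_affine[of "\<lambda>u. u * dnormal k 1 u"] dnormal_integrable_1) (use assms in auto)
  moreover have "(\<lambda>u. s * ((0 + (1/s) * u) * dnormal k 1 (0 + (1/s) * u)) / s ^ Suc (min k 3)) = (\<lambda>u. u * dnormal k s u)"
    using dnormal_scale[OF assms, of k] assms by (auto simp: fun_eq_iff)
  ultimately show ?thesis by simp
qed

text \<open>
  A constant that dominates all \<open>L\<^sup>1\<close> norms and first absolute moments of the derivatives; only its
  finiteness and \<open>1 \<le> kernel_mass\<close> matter.
\<close>

definition kernel_mass :: real where
  "kernel_mass = 1 + (\<Sum>k\<le>3. (\<integral>u. \<bar>dnormal k 1 u\<bar> \<partial>lborel) + (\<integral>u. \<bar>u * dnormal k 1 u\<bar> \<partial>lborel))"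

lemma kernel_mass_ge: "k \<le> 3 \<Longrightarrow> (\<integral>u. \<bar>dnormal k 1 u\<bar> \<partial>lborel) \<le> kernel_mass"
    "k \<le> 3 \<Longrightarrow> (\<integral>u. \<bar>u * dnormal k 1 u\<bar> \<partial>lborel) \<le> kernel_mass" "1 \<le> kernel_mass"
proof -
  let ?f = "\<lambda>k. (\<integral>u. \<bar>dnormal k 1 u\<bar> \<partial>lborel) + (\<integral>u. \<bar>u * dnormal k 1 u\<bar> \<partial>lborel)"
  have p: "0 \<le> (\<integral>u. \<bar>dnormal k 1 u\<bar> \<partial>lborel)" "0 \<le> (\<integral>u. \<bar>u * dnormal k 1 u\<bar> \<partial>lborel)" for k
    by simp_all
  have "?f k \<le> (\<Sum>k\<le>3. ?f k)" if "k \<le> 3" for k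
    by (rule member_le_sum) (use that p in auto)
  then have le: "?f k \<le> kernel_mass - 1" if "k \<le> 3" for k
    using that unfolding kernel_mass_def by simp
  show "(\<integral>u. \<bar>dnormal k 1 u\<bar> \<partial>lborel) \<le> kernel_mass" if "k \<le> 3"
    using le[OF that] p[of k] by linarith
  show "(\<integral>u. \<bar>u * dnormal k 1 u\<bar> \<partial>lborel) \<le> kernel_mass" if "k \<le> 3"
    using le[OF that] p[of k] by linarith
  have "0 \<le> (\<Sum>k\<le>3. ?f k)" by (intro sum_nonneg add_nonneg_nonneg p)
  then show "1 \<le> kernel_mass" unfolding kernel_mass_def by simp
qed

lemma dnormal_L1:
  assumes "s > 0" "k \<le> 3"
  shows "(\<integral>u. \<bar>dnormal k s u\<bar> \<partial>lborel) \<le> kernel_mass / s ^ k"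
proof -
  have "(\<integral>u. \<bar>dnormal k s u\<bar> \<partial>lborel) = (\<integral>u. \<bar>dnormal k 1 (0 + (1/s) * u)\<bar> / s ^ Suc k \<partial>lborel)"
    using dnormal_scale[OF assms(1), of k] assms by (simp add: abs_mult min_absorb1)
  also have "\<dots> = (s * ((1/s) * (\<integral>u. \<bar>dnormal k 1 (0 + (1/s) * u)\<bar> \<partial>lborel))) / s ^ Suc k"
    using assms by simp
  also have "(1/s) * (\<integral>u. \<bar>dnormal k 1 (0 + (1/s) * u)\<bar> \<partial>lborel) = (\<integral>u. \<bar>dnormal k 1 u\<bar> \<partial>lborel)"
    using lborel_integral_real_affine[of "1/s" "\<lambda>u. \<bar>dnormal k 1 u\<bar>" 0] assms by simp
  also have "s * (\<integral>u. \<bar>dnormal k 1 u\<bar> \<partial>lborel) / s ^ Suc k \<le> kernel_mass / s ^ k"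
    using kernel_mass_ge(1)[OF assms(2)] assms by (simp add: divide_right_mono)
  finally show ?thesis .
qed

lemma dnormal_moment_L1:
  assumes "s > 0" "k \<le> 3"
  shows "(\<integral>u. \<bar>u\<bar> * \<bar>dnormal k s u\<bar> \<partial>lborel) \<le> kernel_mass * s / s ^ k"
proof -
  have "(\<integral>u. \<bar>u\<bar> * \<bar>dnormal k s u\<bar> \<partial>lborel) = (\<integral>u. \<bar>(0 + (1/s) * u) * dnormal k 1 (0 + (1/s) * u)\<bar> / s ^ k \<partial>lborel)"
    by (intro Bochner_Integration.integral_cong refl, subst dnormal_scale[OF assms(1)])
       (use assms in \<open>simp add: abs_mult min_absorb1\<close>)
  also have "\<dots> = (s * ((1/s) * (\<integral>u. \<bar>(0 + (1/s) * u) * dnormal k 1 (0 + (1/s) * u)\<bar> \<partial>lborel))) / s ^ k"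
    using assms by simp
  also have "(1/s) * (\<integral>u. \<bar>(0 + (1/s) * u) * dnormal k 1 (0 + (1/s) * u)\<bar> \<partial>lborel) = (\<integral>u. \<bar>u * dnormal k 1 u\<bar> \<partial>lborel)"
    using lborel_integral_real_affine[of "1/s" "\<lambda>u. \<bar>u * dnormal k 1 u\<bar>" 0] assms by simp
  also have "s * (\<integral>u. \<bar>u * dnormal k 1 u\<bar> \<partial>lborel) / s ^ k \<le> kernel_mass * s / s ^ k"
    using kernel_mass_ge(2)[OF assms(2)] assms by (simp add: divide_right_mono)
  finally show ?thesis .
qed

text \<open>
  The derivatives have integral zero, which later allows a constant to be subtracted from the function
  that they are integrated against.
\<close>

lemma dnormal_total:
  assumes "s > 0"
  shows "(\<integral>u. dnormal 0 s u \<partial>lborel) = 1" "(\<integral>u. dnormal (Suc 0) s u \<partial>lborel) = 0"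
    "(\<integral>u. dnormal (Suc (Suc 0)) s u \<partial>lborel) = 0"
proof -
  show 0: "(\<integral>u. dnormal 0 s u \<partial>lborel) = 1"
    using integral_normal_density[OF assms, of 0] by simp
  have "has_bochner_integral lborel (\<lambda>x. - ((normal_density 0 s x * (x - 0) ^ (2 * 0 + 1)) / s^2)) (- (0 / s^2))"
    by (intro has_bochner_integral_minus has_bochner_integral_divide normal_moment_odd) (use assms in auto)
  then have "has_bochner_integral lborel (dnormal (Suc 0) s) 0"
    by (rule has_bochner_integral_cong[THEN iffD1, rotated -1]) (auto simp: field_simps)
  then show "(\<integral>u. dnormal (Suc 0) s u \<partial>lborel) = 0" by (rule has_bochner_integral_integral_eq)
  have "has_bochner_integral lborel (\<lambda>x. (normal_density 0 s x * (x - 0) ^ (2 * 1)) / s^4)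
        ((fact (2 * 1) / ((2 / s\<^sup>2)^1 * fact 1)) / s^4)"
    by (intro has_bochner_integral_divide normal_moment_even) (use assms in auto)
  moreover have "has_bochner_integral lborel (\<lambda>x. normal_density 0 s x / s^2) (1 / s^2)"
    by (intro has_bochner_integral_divide) (use assms integral_normal_density[OF assms, of 0] in \<open>auto simp: has_bochner_integral_iff\<close>)
  ultimately have "has_bochner_integral lborel (\<lambda>x. (normal_density 0 s x * (x - 0) ^ (2 * 1)) / s^4 - normal_density 0 s x / s^2)
        ((fact (2 * 1) / ((2 / s\<^sup>2)^1 * fact 1)) / s^4 - 1/ s^2)"
    by (rule has_bochner_integral_diff)
  then have "has_bochner_integral lborel (dnormal (Suc (Suc 0)) s) 0"
    by (rule has_bochner_integral_cong[THEN iffD1, rotated -1])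
       (use assms in \<open>auto simp: field_simps eval_nat_numeral\<close>)
  then show "(\<integral>u. dnormal (Suc (Suc 0)) s u \<partial>lborel) = 0" by (rule has_bochner_integral_integral_eq)
qed

lemma increment_eq_integral:
  fixes f f' :: "real \<Rightarrow> real"
  assumes "\<And>x. (f has_real_derivative f' x) (at x)" and c: "continuous_on UNIV f'"
  shows "f (u + v) - f u = (\<integral>r. indicator {0..1} r * (v * f' (u + r * v)) \<partial>lborel)"
    "integrable lborel (\<lambda>r. indicator {0..1} r * (v * f' (u + r * v)))"
proof -
  have d: "((\<lambda>r. f (u + r * v)) has_vector_derivative v * f' (u + r * v)) (at r within {0..1})" for r
    unfolding has_real_derivative_iff_has_vector_derivative[symmetric]
  proof -
    have "((\<lambda>r. u + r * v) has_real_derivative v) (at r within {0..1})"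
      by (auto intro!: derivative_eq_intros)
    from DERIV_chain2[OF assms(1) this] show "((\<lambda>r. f (u + r * v)) has_real_derivative v * f' (u + r * v)) (at r within {0..1})"
      by (simp add: mult.commute)
  qed
  have co: "continuous_on {0..1} (\<lambda>r. v * f' (u + r * v))"
    by (intro continuous_intros continuous_on_compose2[OF c]) auto
  have "has_bochner_integral lborel (\<lambda>r. indicator {0..1} r *\<^sub>R (v * f' (u + r * v))) (f (u + 1 * v) - f (u + 0 * v))"
    by (rule has_bochner_integral_FTC_Icc[of 0 1 "\<lambda>r. f (u + r * v)"]) (use d co in auto)
  then show "f (u + v) - f u = (\<integral>r. indicator {0..1} r * (v * f' (u + r * v)) \<partial>lborel)"
    "integrable lborel (\<lambda>r. indicator {0..1} r * (v * f' (u + r * v)))"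
    by (auto simp: has_bochner_integral_iff)
qed

lemma nn_integral_shift: 
  fixes f :: "real \<Rightarrow> ennreal"
  assumes [measurable]: "f \<in> borel_measurable borel"
  shows "(\<integral>\<^sup>+u. f (u + v) \<partial>lborel) = (\<integral>\<^sup>+u. f u \<partial>lborel)"
  using nn_integral_real_affine[of f 1 v] by (simp add: add.commute)

text \<open>
  The increment is the integral of \<open>f'\<close> along the segment, and Lebesgue measure is invariant under
  translation, so integrating over the base point first gives the norm of \<open>f'\<close> at every point of the segment.
\<close>

lemma L1_shift:
  fixes f f' :: "real \<Rightarrow> real"
  assumes d: "\<And>x. (f has_real_derivative f' x) (at x)" and c: "continuous_on UNIV f'"
  shows "(\<integral>\<^sup>+u. \<bar>f (u + v) - f u\<bar> \<partial>lborel) \<le> ennreal \<bar>v\<bar> * (\<integral>\<^sup>+u. \<bar>f' u\<bar> \<partial>lborel)"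
proof -
  have [measurable]: "f' \<in> borel_measurable borel"
    using c by (rule borel_measurable_continuous_onI)
  have "(\<integral>\<^sup>+u. \<bar>f (u + v) - f u\<bar> \<partial>lborel)
    \<le> (\<integral>\<^sup>+u. (\<integral>\<^sup>+r. \<bar>v\<bar> * (indicator {0..1} r * ennreal \<bar>f' (u + r * v)\<bar>) \<partial>lborel) \<partial>lborel)"
  proof (rule nn_integral_mono)
    fix u
    have "ennreal \<bar>f (u + v) - f u\<bar> \<le> (\<integral>\<^sup>+r. norm (indicator {0..1} r * (v * f' (u + r * v))) \<partial>lborel)"
      unfolding increment_eq_integral(1)[OF assms] real_norm_def[symmetric]
      by (rule integral_norm_bound_ennreal) (rule increment_eq_integral(2)[OF assms])
    also have "\<dots> = (\<integral>\<^sup>+r. \<bar>v\<bar> * (indicator {0..1} r * ennreal \<bar>f' (u + r * v)\<bar>) \<partial>lborel)"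
      by (intro nn_integral_cong) (auto simp: indicator_def abs_mult ennreal_mult)
    finally show "ennreal \<bar>f (u + v) - f u\<bar> \<le> (\<integral>\<^sup>+r. \<bar>v\<bar> * (indicator {0..1} r * ennreal \<bar>f' (u + r * v)\<bar>) \<partial>lborel)" .
  qed
  also have "\<dots> = (\<integral>\<^sup>+r. (\<integral>\<^sup>+u. \<bar>v\<bar> * (indicator {0..1} r * ennreal \<bar>f' (u + r * v)\<bar>) \<partial>lborel) \<partial>lborel)"
    by (rule lborel_pair.Fubini') simp
  also have "\<dots> = (\<integral>\<^sup>+r. \<bar>v\<bar> * (indicator {0..1::real} r * (\<integral>\<^sup>+u. ennreal \<bar>f' u\<bar> \<partial>lborel)) \<partial>lborel)"
    by (intro nn_integral_cong)
       (simp add: nn_integral_cmult nn_integral_shift[of "\<lambda>u. ennreal \<bar>f' u\<bar>"])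
  also have "\<dots> = ennreal \<bar>v\<bar> * (\<integral>\<^sup>+u. \<bar>f' u\<bar> \<partial>lborel)"
    by (simp add: nn_integral_cmult nn_integral_multc)
  finally show ?thesis .
qed

text \<open>
  The previous argument for the function \<open>f\<close> minus its tangent at \<open>u\<close>, followed by \<open>L1_shift\<close> for \<open>f'\<close>.
\<close>

lemma L1_taylor:
  fixes f f' f'' :: "real \<Rightarrow> real"
  assumes d: "\<And>x. (f has_real_derivative f' x) (at x)" and c: "continuous_on UNIV f'"
    and d': "\<And>x. (f' has_real_derivative f'' x) (at x)" and c': "continuous_on UNIV f''"
  shows "(\<integral>\<^sup>+u. \<bar>f (u + v) - f u - v * f' u\<bar> \<partial>lborel) \<le> ennreal (v^2) * (\<integral>\<^sup>+u. \<bar>f'' u\<bar> \<partial>lborel)"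
proof -
  have [measurable]: "f' \<in> borel_measurable borel" "f'' \<in> borel_measurable borel"
    using c c' by (auto intro: borel_measurable_continuous_onI)
  have "(\<integral>\<^sup>+u. \<bar>f (u + v) - f u - v * f' u\<bar> \<partial>lborel)
    \<le> (\<integral>\<^sup>+u. (\<integral>\<^sup>+r. \<bar>v\<bar> * (indicator {0..1} r * ennreal \<bar>f' (u + r * v) - f' u\<bar>) \<partial>lborel) \<partial>lborel)"
  proof (rule nn_integral_mono)
    fix u
    \<comment> \<open>The base point \<open>u\<close> is fixed while the tangent is subtracted.\<close>
    have d1: "((\<lambda>x. f x - x * f' u) has_real_derivative f' x - f' u) (at x)" for x
      by (rule derivative_eq_intros d refl | simp)+
    have c1: "continuous_on UNIV (\<lambda>x. f' x - f' u)"
      by (intro continuous_intros c)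
    have e: "f (u + v) - f u - v * f' u = f (u + v) - (u + v) * f' u - (f u - u * f' u)"
      by (simp add: algebra_simps)
    have "ennreal \<bar>f (u + v) - f u - v * f' u\<bar> \<le> (\<integral>\<^sup>+r. norm (indicator {0..1} r * (v * (f' (u + r * v) - f' u))) \<partial>lborel)"
      unfolding e increment_eq_integral(1)[OF d1 c1, of u v] real_norm_def[symmetric]
      by (rule integral_norm_bound_ennreal) (rule increment_eq_integral(2)[OF d1 c1])
    also have "\<dots> = (\<integral>\<^sup>+r. \<bar>v\<bar> * (indicator {0..1} r * ennreal \<bar>f' (u + r * v) - f' u\<bar>) \<partial>lborel)"
      by (intro nn_integral_cong) (auto simp: indicator_def abs_mult ennreal_mult)
    finally show "ennreal \<bar>f (u + v) - f u - v * f' u\<bar> \<le> (\<integral>\<^sup>+r. \<bar>v\<bar> * (indicator {0..1} r * ennreal \<bar>f' (u + r * v) - f' u\<bar>) \<partial>lborel)" .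
  qed
  also have "\<dots> = (\<integral>\<^sup>+r. (\<integral>\<^sup>+u. \<bar>v\<bar> * (indicator {0..1} r * ennreal \<bar>f' (u + r * v) - f' u\<bar>) \<partial>lborel) \<partial>lborel)"
    by (rule lborel_pair.Fubini') simp
  also have "\<dots> = (\<integral>\<^sup>+r. \<bar>v\<bar> * (indicator {0..1::real} r * (\<integral>\<^sup>+u. ennreal \<bar>f' (u + r * v) - f' u\<bar> \<partial>lborel)) \<partial>lborel)"
    by (intro nn_integral_cong) (simp add: nn_integral_cmult)
  also have "\<dots> \<le> (\<integral>\<^sup>+r. \<bar>v\<bar> * (indicator {0..1::real} r * (\<bar>v\<bar> * (\<integral>\<^sup>+u. ennreal \<bar>f'' u\<bar> \<partial>lborel))) \<partial>lborel)"
  proof (rule nn_integral_mono, rule mult_left_mono)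
    fix r :: real
    show "indicator {0..1} r * (\<integral>\<^sup>+u. ennreal \<bar>f' (u + r * v) - f' u\<bar> \<partial>lborel)
        \<le> indicator {0..1} r * (\<bar>v\<bar> * (\<integral>\<^sup>+u. ennreal \<bar>f'' u\<bar> \<partial>lborel))"
    proof (cases "r \<in> {0..1}")
      case True
      have "(\<integral>\<^sup>+u. ennreal \<bar>f' (u + r * v) - f' u\<bar> \<partial>lborel) \<le> ennreal \<bar>r * v\<bar> * (\<integral>\<^sup>+u. ennreal \<bar>f'' u\<bar> \<partial>lborel)"
        by (rule L1_shift[OF d' c'])
      also have "\<dots> \<le> ennreal \<bar>v\<bar> * (\<integral>\<^sup>+u. ennreal \<bar>f'' u\<bar> \<partial>lborel)"
        using True by (intro mult_right_mono) (auto simp: abs_mult mult_left_le_one_le)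
      finally show ?thesis using True by simp
    qed simp
  qed auto
  also have "\<dots> = ennreal (v^2) * (\<integral>\<^sup>+u. \<bar>f'' u\<bar> \<partial>lborel)"
    by (simp add: nn_integral_cmult nn_integral_multc ennreal_mult[symmetric] mult.assoc[symmetric] power2_eq_square)
  finally show ?thesis .
qed

section \<open>Smoothed indicators of planar sets\<close>

lemma nn_integral_le_imp_integral_le:
  fixes f :: "'a \<Rightarrow> real"
  assumes "integrable M f" "\<And>x. 0 \<le> f x" "0 \<le> c" "(\<integral>\<^sup>+x. f x \<partial>M) \<le> ennreal c"
  shows "(\<integral>x. f x \<partial>M) \<le> c"
proof -
  have "ennreal (\<integral>x. f x \<partial>M) \<le> ennreal c"
    using assms by (subst nn_integral_eq_integral[symmetric]) auto
  then show ?thesis using assms(3) by (simp add: ennreal_le_iff)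
qed

lemma dnormal_shift_integrable: "s > 0 \<Longrightarrow> integrable lborel (\<lambda>u. dnormal k s (u + v))"
  using lborel_integrable_real_affine[OF dnormal_integrable, of s 1 k v] by (simp add: add.commute)

lemma dnormal_L1_shift:
  assumes s: "s > 0" and k: "k \<le> 2"
  shows "(\<integral>u. \<bar>dnormal k s (u + v) - dnormal k s u\<bar> \<partial>lborel) \<le> \<bar>v\<bar> * (kernel_mass / s ^ Suc k)"
proof (rule nn_integral_le_imp_integral_le)
  have "(\<integral>\<^sup>+u. \<bar>dnormal k s (u + v) - dnormal k s u\<bar> \<partial>lborel) \<le> ennreal \<bar>v\<bar> * (\<integral>\<^sup>+u. \<bar>dnormal (Suc k) s u\<bar> \<partial>lborel)"
    by (intro L1_shift dnormal_DERIV dnormal_continuous continuous_on_id) (use s k in auto)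
  also have "(\<integral>\<^sup>+u. \<bar>dnormal (Suc k) s u\<bar> \<partial>lborel) = ennreal (\<integral>u. \<bar>dnormal (Suc k) s u\<bar> \<partial>lborel)"
    using s by (intro nn_integral_eq_integral integrable_abs dnormal_integrable) auto
  also have "\<dots> \<le> ennreal (kernel_mass / s ^ Suc k)"
    using dnormal_L1[of s "Suc k"] s k by (intro ennreal_leI) auto
  finally show "(\<integral>\<^sup>+u. \<bar>dnormal k s (u + v) - dnormal k s u\<bar> \<partial>lborel) \<le> ennreal (\<bar>v\<bar> * (kernel_mass / s ^ Suc k))"
    using kernel_mass_ge(3) s by (subst ennreal_mult) (auto simp: mult_left_mono simp del: power_Suc)
qed (use s kernel_mass_ge(3) in \<open>auto intro!: integrable_abs Bochner_Integration.integrable_diff dnormal_shift_integrable\<close>)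

lemma dnormal_L1_taylor:
  assumes s: "s > 0" and k: "k \<le> 1"
  shows "(\<integral>u. \<bar>dnormal k s (u + v) - dnormal k s u - v * dnormal (Suc k) s u\<bar> \<partial>lborel) \<le> v^2 * (kernel_mass / s ^ Suc (Suc k))"
proof (rule nn_integral_le_imp_integral_le)
  have "(\<integral>\<^sup>+u. \<bar>dnormal k s (u + v) - dnormal k s u - v * dnormal (Suc k) s u\<bar> \<partial>lborel)
      \<le> ennreal (v^2) * (\<integral>\<^sup>+u. \<bar>dnormal (Suc (Suc k)) s u\<bar> \<partial>lborel)"
    by (intro L1_taylor dnormal_DERIV dnormal_continuous continuous_on_id) (use s k in auto)
  also have "(\<integral>\<^sup>+u. \<bar>dnormal (Suc (Suc k)) s u\<bar> \<partial>lborel) = ennreal (\<integral>u. \<bar>dnormal (Suc (Suc k)) s u\<bar> \<partial>lborel)"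
    using s by (intro nn_integral_eq_integral integrable_abs dnormal_integrable) auto
  also have "\<dots> \<le> ennreal (kernel_mass / s ^ Suc (Suc k))"
    using dnormal_L1[of s "Suc (Suc k)"] s k by (intro ennreal_leI) auto
  finally show "(\<integral>\<^sup>+u. \<bar>dnormal k s (u + v) - dnormal k s u - v * dnormal (Suc k) s u\<bar> \<partial>lborel) \<le> ennreal (v^2 * (kernel_mass / s ^ Suc (Suc k)))"
    using kernel_mass_ge(3) s by (subst ennreal_mult) (auto simp: mult_left_mono simp del: power_Suc)
qed (use s kernel_mass_ge(3) in \<open>auto intro!: integrable_abs Bochner_Integration.integrable_diff dnormal_shift_integrable\<close>)

lemma product_integral:
  fixes f g :: "real \<Rightarrow> real"
  assumes f: "integrable lborel f" and g: "integrable lborel g"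
  shows "integrable lborel (\<lambda>y. f (fst y) * g (snd y))"
    "(\<integral>y. f (fst y) * g (snd y) \<partial>lborel) = (\<integral>x. f x \<partial>lborel) * (\<integral>x. g x \<partial>lborel)"
proof -
  have [measurable]: "f \<in> borel_measurable borel" "g \<in> borel_measurable borel"
    using f g by auto
  have i: "integrable (lborel \<Otimes>\<^sub>M lborel) (\<lambda>y. f (fst y) * g (snd y))"
  proof (rule lborel_pair.Fubini_integrable)
    have "(\<lambda>x. \<integral>y. norm (f (fst (x, y)) * g (snd (x, y))) \<partial>lborel) = (\<lambda>x. \<bar>f x\<bar> * (\<integral>y. \<bar>g y\<bar> \<partial>lborel))"
      by (simp add: abs_mult)
    then show "integrable lborel (\<lambda>x. \<integral>y. norm (f (fst (x, y)) * g (snd (x, y))) \<partial>lborel)"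
      using f by simp
  qed (use g in auto)
  then show "integrable lborel (\<lambda>y. f (fst y) * g (snd y))"
    by (simp add: lborel_prod)
  show "(\<integral>y. f (fst y) * g (snd y) \<partial>lborel) = (\<integral>x. f x \<partial>lborel) * (\<integral>x. g x \<partial>lborel)"
    using lborel_pair.integral_fst'[OF i] by (simp add: lborel_prod)
qed

text \<open>
  The partial derivative of order \<open>(i, j)\<close> of the planar normal density with covariance \<open>s\<^sup>2\<close> times the identity.
\<close>

definition kernel :: "nat \<Rightarrow> nat \<Rightarrow> real \<Rightarrow> real \<times> real \<Rightarrow> real" where
  "kernel i j s y = dnormal i s (fst y) * dnormal j s (snd y)"

lemma kernel_measurable[measurable]: "kernel i j s \<in> borel_measurable borel"
  unfolding kernel_def[abs_def] by (subst borel_prod[symmetric]) measurable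

lemma kernel_integrable: "s > 0 \<Longrightarrow> integrable lborel (kernel i j s)"
  unfolding kernel_def[abs_def] by (intro product_integral dnormal_integrable)

lemma kernel_L1:
  assumes "s > 0" "i \<le> 3" "j \<le> 3"
  shows "(\<integral>y. \<bar>kernel i j s y\<bar> \<partial>lborel) \<le> kernel_mass^2 / s ^ (i + j)"
proof -
  have "(\<integral>y. \<bar>kernel i j s y\<bar> \<partial>lborel) = (\<integral>x. \<bar>dnormal i s x\<bar> \<partial>lborel) * (\<integral>x. \<bar>dnormal j s x\<bar> \<partial>lborel)"
    unfolding kernel_def abs_mult using assms by (intro product_integral integrable_abs dnormal_integrable)
  also have "\<dots> \<le> (kernel_mass / s ^ i) * (kernel_mass / s ^ j)"
    using assms kernel_mass_ge(3) by (intro mult_mono dnormal_L1) auto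
  finally show ?thesis by (simp add: power2_eq_square power_add)
qed

lemma kernel_moment:
  assumes "s > 0" "i \<le> 3" "j \<le> 3"
  shows "integrable lborel (\<lambda>y. (\<bar>fst y\<bar> + \<bar>snd y\<bar>) * \<bar>kernel i j s y\<bar>)"
    "(\<integral>y. (\<bar>fst y\<bar> + \<bar>snd y\<bar>) * \<bar>kernel i j s y\<bar> \<partial>lborel) \<le> 2 * kernel_mass^2 * s / s ^ (i + j)"
proof -
  have i1: "integrable lborel (\<lambda>u. \<bar>u\<bar> * \<bar>dnormal k s u\<bar>)" for k
    using integrable_abs[OF dnormal_moment_integrable[OF assms(1), of k]] by (simp add: abs_mult)
  have i2: "integrable lborel (\<lambda>u. \<bar>dnormal k s u\<bar>)" for k
    using assms by (intro integrable_abs dnormal_integrable)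
  have e: "(\<bar>fst y\<bar> + \<bar>snd y\<bar>) * \<bar>kernel i j s y\<bar>
    = (\<bar>fst y\<bar> * \<bar>dnormal i s (fst y)\<bar>) * \<bar>dnormal j s (snd y)\<bar> + \<bar>dnormal i s (fst y)\<bar> * (\<bar>snd y\<bar> * \<bar>dnormal j s (snd y)\<bar>)" for y
    by (simp add: kernel_def abs_mult algebra_simps)
  show "integrable lborel (\<lambda>y. (\<bar>fst y\<bar> + \<bar>snd y\<bar>) * \<bar>kernel i j s y\<bar>)"
    unfolding e by (intro Bochner_Integration.integrable_add product_integral i1 i2)
  have "(\<integral>y. (\<bar>fst y\<bar> + \<bar>snd y\<bar>) * \<bar>kernel i j s y\<bar> \<partial>lborel)
    = (\<integral>u. \<bar>u\<bar> * \<bar>dnormal i s u\<bar> \<partial>lborel) * (\<integral>u. \<bar>dnormal j s u\<bar> \<partial>lborel)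
      + (\<integral>u. \<bar>dnormal i s u\<bar> \<partial>lborel) * (\<integral>u. \<bar>u\<bar> * \<bar>dnormal j s u\<bar> \<partial>lborel)"
    unfolding e
    by (simp only: Bochner_Integration.integral_add[OF product_integral(1)[OF i1 i2] product_integral(1)[OF i2 i1]]
        product_integral(2)[OF i1 i2] product_integral(2)[OF i2 i1])
  also have "\<dots> \<le> (kernel_mass * s / s ^ i) * (kernel_mass / s ^ j) + (kernel_mass / s ^ i) * (kernel_mass * s / s ^ j)"
    using assms kernel_mass_ge(3) by (intro add_mono mult_mono dnormal_L1 dnormal_moment_L1) auto
  also have "\<dots> = 2 * kernel_mass^2 * s / s ^ (i + j)"
    by (simp add: power2_eq_square power_add)
  finally show "(\<integral>y. (\<bar>fst y\<bar> + \<bar>snd y\<bar>) * \<bar>kernel i j s y\<bar> \<partial>lborel) \<le> 2 * kernel_mass^2 * s / s ^ (i + j)" .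
qed

lemma kernel_total:
  assumes "s > 0"
  shows "(\<integral>y. kernel 0 0 s y \<partial>lborel) = 1"
    "i \<le> 2 \<Longrightarrow> j \<le> 2 \<Longrightarrow> i + j > 0 \<Longrightarrow> (\<integral>y. kernel i j s y \<partial>lborel) = 0"
proof -
  have e: "(\<integral>y. kernel i j s y \<partial>lborel) = (\<integral>x. dnormal i s x \<partial>lborel) * (\<integral>x. dnormal j s x \<partial>lborel)" for i j
    unfolding kernel_def using assms by (intro product_integral dnormal_integrable)
  show "(\<integral>y. kernel 0 0 s y \<partial>lborel) = 1"
    by (simp only: e dnormal_total[OF assms] mult_1)
  assume "i \<le> 2" "j \<le> 2" "i + j > 0"
  then have "i \<in> {Suc 0, Suc (Suc 0)} \<or> j \<in> {Suc 0, Suc (Suc 0)}" by auto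
  then show "(\<integral>y. kernel i j s y \<partial>lborel) = 0"
    by (auto simp only: e dnormal_total[OF assms] mult_zero_left mult_zero_right insert_iff empty_iff)
qed

text \<open>
  For a product \<open>f(x) g(y)\<close> the second-order remainder splits into the remainder of \<open>f\<close>, the remainder of \<open>g\<close>, and
  the product of the first-order terms, so the one-dimensional bounds suffice.
\<close>

lemma kernel_L1_taylor:
  assumes s: "s > 0" and ij: "i + j = 1"
  shows "integrable lborel (\<lambda>u. \<bar>kernel i j s (u + v) - kernel i j s u - fst v * kernel (Suc i) j s u - snd v * kernel i (Suc j) s u\<bar>)" (is "integrable _ ?F")
    "(\<integral>u. \<bar>kernel i j s (u + v) - kernel i j s u - fst v * kernel (Suc i) j s u - snd v * kernel i (Suc j) s u\<bar> \<partial>lborel)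
       \<le> (\<bar>fst v\<bar> + \<bar>snd v\<bar>)^2 * (kernel_mass^2 / s ^ 3)"
proof -
  define v1 v2 where "v1 = fst v" and "v2 = snd v"
  define f f' g g' where "f = dnormal i s" and "f' = dnormal (Suc i) s" and "g = dnormal j s" and "g' = dnormal (Suc j) s"
  define Rf Rg Dg where "Rf u = f (u + v1) - f u - v1 * f' u" and "Rg u = g (u + v2) - g u - v2 * g' u"
    and "Dg u = g (u + v2) - g u" for u
  have le: "i \<le> 1" "j \<le> 1" using ij by auto
  have e3: "i + j + 2 = 3" using ij by simp
  have int: "integrable lborel f" "integrable lborel f'" "integrable lborel g" "integrable lborel g'"
    "integrable lborel Rf" "integrable lborel Rg" "integrable lborel Dg" "integrable lborel (\<lambda>u. g (u + v2))"
    unfolding f_def f'_def g_def g'_def Rf_def Rg_def Dg_def using s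
    by (auto intro!: Bochner_Integration.integrable_diff dnormal_shift_integrable)
  have int': "integrable lborel (\<lambda>u. \<bar>f u\<bar>)" "integrable lborel (\<lambda>u. \<bar>f' u\<bar>)"
    "integrable lborel (\<lambda>u. \<bar>Rf u\<bar>)" "integrable lborel (\<lambda>u. \<bar>Rg u\<bar>)" "integrable lborel (\<lambda>u. \<bar>Dg u\<bar>)"
    "integrable lborel (\<lambda>u. \<bar>g (u + v2)\<bar>)"
    using int by (auto intro!: integrable_abs)
  have g_shift: "(\<integral>u. \<bar>g (u + v2)\<bar> \<partial>lborel) = (\<integral>u. \<bar>g u\<bar> \<partial>lborel)"
    using lborel_integral_real_affine[of 1 "\<lambda>u. \<bar>g u\<bar>" v2] by (simp add: add.commute)
  have F_eq: "kernel i j s (u + v) - kernel i j s u - fst v * kernel (Suc i) j s u - snd v * kernel i (Suc j) s u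
     = Rf (fst u) * g (snd u + v2) + f (fst u) * Rg (snd u) + v1 * (f' (fst u) * Dg (snd u))" for u
    unfolding kernel_def f_def f'_def g_def g'_def Rf_def Rg_def Dg_def v1_def v2_def by (simp add: algebra_simps)
  note I = product_integral(1)
  have i1: "integrable lborel (\<lambda>u. Rf (fst u) * g (snd u + v2))" by (rule I[OF int(5,8)])
  have i2: "integrable lborel (\<lambda>u. f (fst u) * Rg (snd u))" by (rule I[OF int(1,6)])
  have i3: "integrable lborel (\<lambda>u. f' (fst u) * Dg (snd u))" by (rule I[OF int(2,7)])
  show iF: "integrable lborel ?F"
    unfolding F_eq by (intro integrable_abs Bochner_Integration.integrable_add integrable_mult_right i1 i2 i3)
  have "(\<integral>u. ?F u \<partial>lborel) \<le> (\<integral>u. \<bar>Rf (fst u)\<bar> * \<bar>g (snd u + v2)\<bar> + \<bar>f (fst u)\<bar> * \<bar>Rg (snd u)\<bar> + \<bar>v1\<bar> * (\<bar>f' (fst u)\<bar> * \<bar>Dg (snd u)\<bar>) \<partial>lborel)"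
  proof (rule integral_mono[OF iF])
    show "integrable lborel (\<lambda>u. \<bar>Rf (fst u)\<bar> * \<bar>g (snd u + v2)\<bar> + \<bar>f (fst u)\<bar> * \<bar>Rg (snd u)\<bar> + \<bar>v1\<bar> * (\<bar>f' (fst u)\<bar> * \<bar>Dg (snd u)\<bar>))"
      using I[OF int'(3,6)] I[OF int'(1,4)] I[OF int'(2,5)] by (intro Bochner_Integration.integrable_add integrable_mult_right)
  next
    fix u :: "real \<times> real"
    show "?F u \<le> \<bar>Rf (fst u)\<bar> * \<bar>g (snd u + v2)\<bar> + \<bar>f (fst u)\<bar> * \<bar>Rg (snd u)\<bar> + \<bar>v1\<bar> * (\<bar>f' (fst u)\<bar> * \<bar>Dg (snd u)\<bar>)"
      unfolding F_eq abs_mult[symmetric] by linarith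
  qed
  also have "\<dots> = (\<integral>u. \<bar>Rf u\<bar> \<partial>lborel) * (\<integral>u. \<bar>g u\<bar> \<partial>lborel) + (\<integral>u. \<bar>f u\<bar> \<partial>lborel) * (\<integral>u. \<bar>Rg u\<bar> \<partial>lborel)
      + \<bar>v1\<bar> * ((\<integral>u. \<bar>f' u\<bar> \<partial>lborel) * (\<integral>u. \<bar>Dg u\<bar> \<partial>lborel))"
    using I[OF int'(3,6)] I[OF int'(1,4)] I[OF int'(2,5)] g_shift
      product_integral(2)[OF int'(3,6)] product_integral(2)[OF int'(1,4)] product_integral(2)[OF int'(2,5)]
    by simp
  also have "\<dots> \<le> (v1^2 * (kernel_mass / s ^ Suc (Suc i))) * (kernel_mass / s ^ j) + (kernel_mass / s ^ i) * (v2^2 * (kernel_mass / s ^ Suc (Suc j)))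
      + \<bar>v1\<bar> * ((kernel_mass / s ^ Suc i) * (\<bar>v2\<bar> * (kernel_mass / s ^ Suc j)))"
    unfolding f_def f'_def g_def g'_def Rf_def Rg_def Dg_def using s le kernel_mass_ge(3)
    by (intro add_mono mult_mono mult_left_mono dnormal_L1 dnormal_L1_taylor dnormal_L1_shift) (auto simp del: power_Suc)
  also have "\<dots> = (v1^2 + v2^2 + \<bar>v1\<bar> * \<bar>v2\<bar>) * (kernel_mass^2 / s ^ (i + j + 2))"
    using s by (simp add: power_add field_simps power2_eq_square)
  also have "\<dots> \<le> (\<bar>v1\<bar> + \<bar>v2\<bar>)^2 * (kernel_mass^2 / s ^ (i + j + 2))"
    using s by (intro mult_right_mono) (auto simp: power2_sum)
  finally show "(\<integral>u. ?F u \<partial>lborel) \<le> (\<bar>fst v\<bar> + \<bar>snd v\<bar>)^2 * (kernel_mass^2 / s ^ 3)"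
    unfolding v1_def v2_def e3 .
qed

lemma integral_lborel_shift:
  fixes f :: "'a::euclidean_space \<Rightarrow> real"
  assumes [measurable]: "f \<in> borel_measurable borel"
  shows "(\<integral>u. f (c + u) \<partial>lborel) = (\<integral>u. f u \<partial>lborel)"
proof -
  have "(\<integral>u. f u \<partial>lborel) = (\<integral>u. f u \<partial>distr lborel borel ((+) c))"
    by (simp add: lborel_distr_plus)
  also have "\<dots> = (\<integral>u. f (c + u) \<partial>lborel)"
    by (rule integral_distr) auto
  finally show ?thesis by simp
qed

text \<open>
  Up to the sign \<open>(-1)\<^sup>i\<^sup>+\<^sup>j\<close>, the partial derivative of order \<open>(i, j)\<close> of \<open>x \<mapsto> P(x + s Z \<in> A)\<close>. All derivatives fall
  on the kernel; the indicator of \<open>A\<close> is never differentiated.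
\<close>

definition smoothed :: "(real \<times> real) set \<Rightarrow> nat \<Rightarrow> nat \<Rightarrow> real \<Rightarrow> real \<times> real \<Rightarrow> real" where
  "smoothed A i j s x = (\<integral>u. indicator A (x + u) * kernel i j s u \<partial>lborel)"

lemma smooth_integrable:
  assumes [measurable]: "A \<in> sets borel" and "s > 0"
  shows "integrable lborel (\<lambda>u. indicator A (x + u) * kernel i j s u)"
  by (rule Bochner_Integration.integrable_bound[OF kernel_integrable[OF assms(2), of i j]])
     (auto simp: indicator_def)

lemma smooth_bound:
  assumes [measurable]: "A \<in> sets borel" and "s > 0" "i \<le> 3" "j \<le> 3"
  shows "\<bar>smoothed A i j s x\<bar> \<le> kernel_mass^2 / s ^ (i + j)"
proof -
  have "\<bar>smoothed A i j s x\<bar> \<le> (\<integral>u. \<bar>kernel i j s u\<bar> \<partial>lborel)"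
    unfolding smoothed_def
    by (rule integral_abs_bound_integral[OF smooth_integrable])
       (use assms kernel_integrable in \<open>auto simp: indicator_def\<close>)
  then show ?thesis using kernel_L1[OF assms(2-4)] by linarith
qed

lemma smooth_taylor:
  assumes A[measurable]: "A \<in> sets borel" and s: "s > 0" and ij: "i + j = 1"
  shows "\<bar>smoothed A i j s (x - v) - smoothed A i j s x - fst v * smoothed A (Suc i) j s x - snd v * smoothed A i (Suc j) s x\<bar>
    \<le> (\<bar>fst v\<bar> + \<bar>snd v\<bar>)^2 * (kernel_mass^2 / s ^ 3)"
proof -
  have m: "(\<lambda>u. indicator A (x - v + u) * kernel i j s u) \<in> borel_measurable borel" by measurable
  have 1: "smoothed A i j s (x - v) = (\<integral>u. indicator A (x + u) * kernel i j s (u + v) \<partial>lborel)"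
    unfolding smoothed_def using integral_lborel_shift[OF m, of v] by (simp add: algebra_simps)
  have int1: "integrable lborel (\<lambda>u. indicator A (x + u) * kernel i j s (u + v))"
  proof (rule Bochner_Integration.integrable_bound)
    show "integrable lborel (\<lambda>u. kernel i j s (u + v))"
      unfolding kernel_def using dnormal_shift_integrable[OF s] product_integral[of "\<lambda>u. dnormal i s (u + fst v)" "\<lambda>u. dnormal j s (u + snd v)"] by simp
  qed (auto simp: indicator_def)
  note int = smooth_integrable[OF A s]
  have E: "smoothed A i j s (x - v) - smoothed A i j s x - fst v * smoothed A (Suc i) j s x - snd v * smoothed A i (Suc j) s x
    = (\<integral>u. indicator A (x + u) * kernel i j s (u + v) - indicator A (x + u) * kernel i j s u
        - fst v * (indicator A (x + u) * kernel (Suc i) j s u) - snd v * (indicator A (x + u) * kernel i (Suc j) s u) \<partial>lborel)"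
    unfolding 1 unfolding smoothed_def using int int1 by simp
  have "\<bar>smoothed A i j s (x - v) - smoothed A i j s x - fst v * smoothed A (Suc i) j s x - snd v * smoothed A i (Suc j) s x\<bar>
    \<le> (\<integral>u. \<bar>kernel i j s (u + v) - kernel i j s u - fst v * kernel (Suc i) j s u - snd v * kernel i (Suc j) s u\<bar> \<partial>lborel)"
    unfolding E
  proof (rule integral_abs_bound_integral)
    show "integrable lborel (\<lambda>u. indicator A (x + u) * kernel i j s (u + v) - indicator A (x + u) * kernel i j s u
        - fst v * (indicator A (x + u) * kernel (Suc i) j s u) - snd v * (indicator A (x + u) * kernel i (Suc j) s u))"
      by (intro Bochner_Integration.integrable_diff integrable_mult_right int int1)
  qed (auto simp: indicator_def intro!: kernel_L1_taylor s ij)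
  also have "\<dots> \<le> (\<bar>fst v\<bar> + \<bar>snd v\<bar>)^2 * (kernel_mass^2 / s ^ 3)"
    by (rule kernel_L1_taylor(2)[OF s ij, of v])
  finally show ?thesis .
qed

text \<open>
  One factor is bounded by its supremum. In the other the constant \<open>indicator A x\<close> may be subtracted because the kernel
  has integral zero; what remains is concentrated near the boundary of \<open>A\<close>.
\<close>

lemma smooth_square_le:
  assumes A[measurable]: "A \<in> sets borel" and s: "s > 0" and ij: "i + j = 2"
  shows "integrable lborel (\<lambda>u. \<bar>indicator A (x + u) - indicator A x\<bar> * \<bar>kernel i j s u\<bar>)"
   "(smoothed A i j s x)^2 \<le> kernel_mass^2 / s^2 * (\<integral>u. \<bar>indicator A (x + u) - indicator A x\<bar> * \<bar>kernel i j s u\<bar> \<partial>lborel)"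
proof -
  have le: "i \<le> 2" "j \<le> 2" using ij by auto
  show i: "integrable lborel (\<lambda>u. \<bar>indicator A (x + u) - indicator A x\<bar> * \<bar>kernel i j s u\<bar>)"
    by (rule Bochner_Integration.integrable_bound[OF kernel_integrable[OF s, of i j]]) (auto simp: indicator_def)
  have i': "integrable lborel (\<lambda>u. (indicator A (x + u) - indicator A x) * kernel i j s u)"
    by (rule Bochner_Integration.integrable_bound[OF kernel_integrable[OF s, of i j]]) (auto simp: indicator_def)
  have "smoothed A i j s x = (\<integral>u. indicator A (x + u) * kernel i j s u \<partial>lborel) - indicator A x * (\<integral>u. kernel i j s u \<partial>lborel)"
    unfolding smoothed_def using kernel_total(2)[OF s le] ij by simp
  also have "\<dots> = (\<integral>u. (indicator A (x + u) - indicator A x) * kernel i j s u \<partial>lborel)"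
    using smooth_integrable[OF A s, of x i j] kernel_integrable[OF s, of i j] by (simp add: left_diff_distrib)
  also have "\<bar>\<dots>\<bar> \<le> (\<integral>u. \<bar>indicator A (x + u) - indicator A x\<bar> * \<bar>kernel i j s u\<bar> \<partial>lborel)"
    by (rule integral_abs_bound_integral[OF i' i]) (simp add: abs_mult)
  finally have 1: "\<bar>smoothed A i j s x\<bar> \<le> (\<integral>u. \<bar>indicator A (x + u) - indicator A x\<bar> * \<bar>kernel i j s u\<bar> \<partial>lborel)" .
  have 2: "\<bar>smoothed A i j s x\<bar> \<le> kernel_mass^2 / s^2"
    using smooth_bound[OF A s, of i j x] le ij by simp
  have "(smoothed A i j s x)^2 = \<bar>smoothed A i j s x\<bar> * \<bar>smoothed A i j s x\<bar>"
    by (simp add: power2_eq_square)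
  also have "\<dots> \<le> kernel_mass^2 / s^2 * (\<integral>u. \<bar>indicator A (x + u) - indicator A x\<bar> * \<bar>kernel i j s u\<bar> \<partial>lborel)"
    using 1 2 by (intro mult_mono) auto
  finally show "(smoothed A i j s x)^2 \<le> kernel_mass^2 / s^2 * (\<integral>u. \<bar>indicator A (x + u) - indicator A x\<bar> * \<bar>kernel i j s u\<bar> \<partial>lborel)" .
qed

lemma dnormal_measurable2[measurable]:
  assumes [measurable]: "f \<in> borel_measurable M" "g \<in> borel_measurable M"
  shows "(\<lambda>x. dnormal k (f x) (g x)) \<in> borel_measurable M"
  by (cases "(k, 0::real, 0::real)" rule: dnormal.cases) (auto simp: normal_density_def)

section \<open>Interpolation along a rotation\<close>

lemma fst_borel_measurable[measurable (raw)]: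
  fixes f :: "'a \<Rightarrow> real \<times> real"
  assumes "f \<in> borel_measurable M"
  shows "(\<lambda>x. fst (f x)) \<in> borel_measurable M" "(\<lambda>x. snd (f x)) \<in> borel_measurable M"
  using borel_measurable_continuous_on[OF continuous_on_fst[OF continuous_on_id] assms]
    borel_measurable_continuous_on[OF continuous_on_snd[OF continuous_on_id] assms] by auto

lemma dnormal_continuous2:
  assumes "continuous_on S f" "continuous_on S g" "\<And>x. x \<in> S \<Longrightarrow> f x > (0::real)"
  shows "continuous_on S (\<lambda>x. dnormal k (f x) (g x))"
proof -
  have "f x \<noteq> 0" if "x \<in> S" for x using assms(3)[OF that] by simp
  then show ?thesis
    by (cases "(k, 0::real, 0::real)" rule: dnormal.cases)
       (use assms in \<open>auto simp: normal_density_def intro!: continuous_intros\<close>)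
qed

text \<open>
  The derivative in \<open>t\<close> of the density at \<open>y\<close> of \<open>cos t w + sin t Z\<close>, where \<open>Z\<close> is standard normal.
\<close>

definition path_velocity :: "real \<times> real \<Rightarrow> real \<Rightarrow> real \<times> real \<Rightarrow> real" where
  "path_velocity w t y = sin t * cos t * (kernel 2 0 (sin t) (y - cos t *\<^sub>R w) + kernel 0 2 (sin t) (y - cos t *\<^sub>R w))
     + sin t * (fst w * kernel 1 0 (sin t) (y - cos t *\<^sub>R w) + snd w * kernel 0 1 (sin t) (y - cos t *\<^sub>R w))"

lemma path_velocity_DERIV:
  assumes "sin t > 0"
  shows "((\<lambda>t. kernel 0 0 (sin t) (y - cos t *\<^sub>R w)) has_real_derivative path_velocity w t y) (at t)"
proof -
  have "((\<lambda>t. dnormal 0 (sin t) (fst y - cos t * fst w) * dnormal 0 (sin t) (snd y - cos t * snd w)) has_real_derivative path_velocity w t y) (at t)"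
    by (rule DERIV_cong[OF DERIV_mult[OF dnormal_path_DERIV[OF assms] dnormal_path_DERIV[OF assms]]])
       (simp add: path_velocity_def kernel_def algebra_simps)
  then show ?thesis
    by (simp add: kernel_def)
qed

lemma sin_pos_halfpi: "0 < t0 \<Longrightarrow> t0 \<le> t \<Longrightarrow> t \<le> pi / 2 \<Longrightarrow> sin t > 0"
  using pi_gt_zero by (intro sin_gt_zero) linarith+

lemma path_velocity_FTC:
  assumes "0 < t0" "t0 \<le> pi / 2"
  shows "(\<integral>t. indicator {t0..pi/2} t * path_velocity w t y \<partial>lborel) = kernel 0 0 1 y - kernel 0 0 (sin t0) (y - cos t0 *\<^sub>R w)"
proof -
  have d: "((\<lambda>t. kernel 0 0 (sin t) (y - cos t *\<^sub>R w)) has_vector_derivative path_velocity w t y) (at t within {t0..pi/2})"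
    if "t0 \<le> t" "t \<le> pi / 2" for t
    unfolding has_real_derivative_iff_has_vector_derivative[symmetric]
    using path_velocity_DERIV[OF sin_pos_halfpi[OF assms(1) that]] by (rule DERIV_subset) simp
  have c: "continuous_on {t0..pi/2} (\<lambda>t. path_velocity w t y)"
    unfolding path_velocity_def kernel_def fst_diff snd_diff fst_scaleR snd_scaleR
    by (intro continuous_intros dnormal_continuous2) (use assms in \<open>auto intro: sin_pos_halfpi\<close>)
  have "has_bochner_integral lborel (\<lambda>t. indicator {t0..pi/2} t *\<^sub>R path_velocity w t y)
     (kernel 0 0 (sin (pi/2)) (y - cos (pi/2) *\<^sub>R w) - kernel 0 0 (sin t0) (y - cos t0 *\<^sub>R w))"
    by (rule has_bochner_integral_FTC_Icc[OF assms(2) d c]) auto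
  then show ?thesis by (simp add: has_bochner_integral_iff)
qed

lemma kernel_shift_integrable:
  assumes "s > 0"
  shows "integrable lborel (\<lambda>y. kernel i j s (y + v))"
  unfolding kernel_def using dnormal_shift_integrable[OF assms] product_integral[of "\<lambda>u. dnormal i s (u + fst v)" "\<lambda>u. dnormal j s (u + snd v)"] by simp

lemma kernel_shift_integrable':
  assumes "s > 0"
  shows "integrable lborel (\<lambda>y. kernel i j s (y - v))"
  using kernel_shift_integrable[OF assms, of i j "-v"] by (simp only: add_uminus_conv_diff)

lemma kernel_shift_L1:
  assumes "s > 0" "i \<le> 3" "j \<le> 3"
  shows "(\<integral>y. \<bar>kernel i j s (y - v)\<bar> \<partial>lborel) \<le> kernel_mass^2 / s ^ (i + j)"
proof -
  have "(\<integral>y. \<bar>kernel i j s (-v + y)\<bar> \<partial>lborel) = (\<integral>y. \<bar>kernel i j s y\<bar> \<partial>lborel)"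
    by (rule integral_lborel_shift) measurable
  then show ?thesis
    using kernel_L1[OF assms] by (simp only: uminus_add_conv_diff)
qed

lemma smooth_eq_shift:
  assumes [measurable]: "A \<in> sets borel"
  shows "smoothed A i j s x = (\<integral>y. indicator A y * kernel i j s (y - x) \<partial>lborel)"
proof -
  have "(\<integral>u. indicator A (x + u) * kernel i j s (x + u - x) \<partial>lborel) = (\<integral>y. indicator A y * kernel i j s (y - x) \<partial>lborel)"
    by (rule integral_lborel_shift) measurable
  then show ?thesis by (simp only: smoothed_def add_diff_cancel_left')
qed

lemma indicator_kernel_integrable:
  assumes [measurable]: "A \<in> sets borel" and "s > 0"
  shows "integrable lborel (\<lambda>y. indicator A y * kernel i j s (y - x))"
proof (rule Bochner_Integration.integrable_bound)
  show "integrable lborel (\<lambda>y. kernel i j s (y - x))"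
    by (rule kernel_shift_integrable'[OF assms(2)])
qed (auto simp: indicator_def)

definition smooth_velocity :: "(real \<times> real) set \<Rightarrow> real \<times> real \<Rightarrow> real \<Rightarrow> real" where
  "smooth_velocity A w t = sin t * cos t * (smoothed A 2 0 (sin t) (cos t *\<^sub>R w) + smoothed A 0 2 (sin t) (cos t *\<^sub>R w))
     + sin t * (fst w * smoothed A 1 0 (sin t) (cos t *\<^sub>R w) + snd w * smoothed A 0 1 (sin t) (cos t *\<^sub>R w))"

lemma smooth_velocity_eq:
  assumes [measurable]: "A \<in> sets borel" and "sin t > 0"
  shows "(\<integral>y. indicator A y * path_velocity w t y \<partial>lborel) = smooth_velocity A w t"
proof -
  note i = indicator_kernel_integrable[OF assms, of _ _ "cos t *\<^sub>R w"]
  have e: "(\<lambda>y. indicator A y * path_velocity w t y) = (\<lambda>y.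
    sin t * cos t * (indicator A y * kernel 2 0 (sin t) (y - cos t *\<^sub>R w) + indicator A y * kernel 0 2 (sin t) (y - cos t *\<^sub>R w))
     + sin t * (fst w * (indicator A y * kernel 1 0 (sin t) (y - cos t *\<^sub>R w)) + snd w * (indicator A y * kernel 0 1 (sin t) (y - cos t *\<^sub>R w))))"
    by (auto simp: path_velocity_def algebra_simps)
  show ?thesis
    unfolding e smooth_velocity_def smooth_eq_shift[OF assms(1)] using i by simp
qed

lemma path_velocity_abs_bound:
  assumes t: "sin t > 0" and [measurable]: "A \<in> sets borel"
  shows "integrable lborel (\<lambda>y. indicator A y * path_velocity w t y)"
    "(\<integral>y. \<bar>indicator A y * path_velocity w t y\<bar> \<partial>lborel) \<le> kernel_mass^2 * (2 / sin t + \<bar>fst w\<bar> + \<bar>snd w\<bar>)"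
proof -
  let ?k = "\<lambda>i j y. \<bar>kernel i j (sin t) (y - cos t *\<^sub>R w)\<bar>"
  let ?B = "\<lambda>y. sin t * (?k 2 0 y + ?k 0 2 y) + sin t * (\<bar>fst w\<bar> * ?k 1 0 y + \<bar>snd w\<bar> * ?k 0 1 y)"
  note i = kernel_shift_integrable'[OF t, THEN integrable_abs]
  have iB: "integrable lborel ?B"
    by (intro Bochner_Integration.integrable_add integrable_mult_right i)
  have le: "\<bar>indicator A y * path_velocity w t y\<bar> \<le> ?B y" for y
  proof -
    have "\<bar>indicator A y * path_velocity w t y\<bar> \<le> \<bar>path_velocity w t y\<bar>" by (auto simp: indicator_def)
    also have "\<dots> \<le> \<bar>sin t * cos t * (kernel 2 0 (sin t) (y - cos t *\<^sub>R w) + kernel 0 2 (sin t) (y - cos t *\<^sub>R w))\<bar>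
       + \<bar>sin t * (fst w * kernel 1 0 (sin t) (y - cos t *\<^sub>R w) + snd w * kernel 0 1 (sin t) (y - cos t *\<^sub>R w))\<bar>"
      unfolding path_velocity_def by (rule abs_triangle_ineq)
    also have "\<dots> = (sin t * \<bar>cos t\<bar>) * \<bar>kernel 2 0 (sin t) (y - cos t *\<^sub>R w) + kernel 0 2 (sin t) (y - cos t *\<^sub>R w)\<bar>
       + sin t * \<bar>fst w * kernel 1 0 (sin t) (y - cos t *\<^sub>R w) + snd w * kernel 0 1 (sin t) (y - cos t *\<^sub>R w)\<bar>"
      using t by (simp add: abs_mult)
    also have "\<dots> \<le> ?B y"
      using t abs_triangle_ineq[of "fst w * kernel 1 0 (sin t) (y - cos t *\<^sub>R w)" "snd w * kernel 0 1 (sin t) (y - cos t *\<^sub>R w)"]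
      by (intro add_mono mult_mono mult_left_mono abs_triangle_ineq) (auto simp: mult_le_cancel_left1 abs_mult)
    finally show ?thesis .
  qed
  have [measurable]: "path_velocity w t \<in> borel_measurable borel"
    unfolding path_velocity_def by measurable
  show I: "integrable lborel (\<lambda>y. indicator A y * path_velocity w t y)"
  proof (rule Bochner_Integration.integrable_bound[OF iB])
    show "AE y in lborel. norm (indicator A y * path_velocity w t y) \<le> norm (?B y)"
      unfolding real_norm_def by (rule AE_I2, rule order_trans[OF le abs_ge_self])
  qed measurable
  have "(\<integral>y. \<bar>indicator A y * path_velocity w t y\<bar> \<partial>lborel) \<le> (\<integral>y. ?B y \<partial>lborel)"
    by (intro integral_mono integrable_abs I iB le)
  also have "\<dots> = sin t * ((\<integral>y. ?k 2 0 y \<partial>lborel) + (\<integral>y. ?k 0 2 y \<partial>lborel))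
     + sin t * (\<bar>fst w\<bar> * (\<integral>y. ?k 1 0 y \<partial>lborel) + \<bar>snd w\<bar> * (\<integral>y. ?k 0 1 y \<partial>lborel))"
    using i by simp
  also have "\<dots> \<le> sin t * (kernel_mass^2 / sin t ^ (2 + 0) + kernel_mass^2 / sin t ^ (0 + 2))
     + sin t * (\<bar>fst w\<bar> * (kernel_mass^2 / sin t ^ (1 + 0)) + \<bar>snd w\<bar> * (kernel_mass^2 / sin t ^ (0 + 1)))"
    using t by (intro add_mono mult_left_mono kernel_shift_L1) auto
  also have "\<dots> = kernel_mass^2 * (2 / sin t + \<bar>fst w\<bar> + \<bar>snd w\<bar>)"
    using t by (simp add: field_simps power2_eq_square)
  finally show "(\<integral>y. \<bar>indicator A y * path_velocity w t y\<bar> \<partial>lborel) \<le> kernel_mass^2 * (2 / sin t + \<bar>fst w\<bar> + \<bar>snd w\<bar>)" .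
qed

text \<open>
  The derivative is integrated in \<open>t\<close> for each fixed \<open>y\<close> and then over \<open>y \<in> A\<close>; exchanging the two integrals avoids
  differentiating under an integral over the arbitrary set \<open>A\<close>.
\<close>

lemma smooth_interpolation:
  assumes A[measurable]: "A \<in> sets borel" and t0: "0 < t0" "t0 \<le> pi / 2"
  shows "integrable lborel (\<lambda>t. indicator {t0..pi/2} t * smooth_velocity A w t)"
    "smoothed A 0 0 1 0 - smoothed A 0 0 (sin t0) (cos t0 *\<^sub>R w) = (\<integral>t. indicator {t0..pi/2} t * smooth_velocity A w t \<partial>lborel)"
proof -
  define H where "H t y = indicator {t0..pi/2} t * (indicator A y * path_velocity w t y)" for t y
  have [measurable]: "(\<lambda>x. H (fst x) (snd x)) \<in> borel_measurable (lborel \<Otimes>\<^sub>M lborel)"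
    unfolding H_def path_velocity_def kernel_def fst_diff snd_diff fst_scaleR snd_scaleR by measurable
  have sp: "sin t > 0" if "t \<in> {t0..pi/2}" for t using t0 that by (auto intro: sin_pos_halfpi)
  have s0: "sin t0 > 0" using t0 sp by auto
  have Ht: "(\<lambda>y. H t y) = (\<lambda>y. 0)" if "t \<notin> {t0..pi/2}" for t
    using that by (auto simp: H_def)
  have Ht': "(\<lambda>y. H t y) = (\<lambda>y. indicator A y * path_velocity w t y)" if "t \<in> {t0..pi/2}" for t
    using that by (auto simp: H_def)
  have iy: "integrable lborel (\<lambda>y. H t y)" for t
    by (cases "t \<in> {t0..pi/2}") (auto simp: Ht Ht' intro!: path_velocity_abs_bound sp)
  have int: "integrable (lborel \<Otimes>\<^sub>M lborel) (\<lambda>x. H (fst x) (snd x))"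
  proof (rule lborel_pair.Fubini_integrable)
    show "integrable lborel (\<lambda>t. \<integral>y. norm (H (fst (t, y)) (snd (t, y))) \<partial>lborel)"
    proof (rule Bochner_Integration.integrable_bound)
      let ?C = "kernel_mass^2 * (2 / sin t0 + \<bar>fst w\<bar> + \<bar>snd w\<bar>)"
      show "integrable lborel (\<lambda>t. indicator {t0..pi/2} t * ?C)"
        by (intro integrable_mult_left integrable_real_indicator) (auto simp: emeasure_lborel_Icc_eq)
      show "AE t in lborel. norm (\<integral>y. norm (H (fst (t, y)) (snd (t, y))) \<partial>lborel) \<le> norm (indicator {t0..pi/2} t * ?C)"
      proof (rule AE_I2)
        fix t :: real
        show "norm (\<integral>y. norm (H (fst (t, y)) (snd (t, y))) \<partial>lborel) \<le> norm (indicator {t0..pi/2} t * ?C)"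
        proof (cases "t \<in> {t0..pi/2}")
          case True
          have "sin t0 \<le> sin t" using True t0 by (intro sin_monotone_2pi_le) auto
          then have "2 / sin t \<le> 2 / sin t0" using s0 by (simp add: frac_le)
          then have "kernel_mass^2 * (2 / sin t + \<bar>fst w\<bar> + \<bar>snd w\<bar>) \<le> ?C"
            by (intro mult_left_mono) auto
          with path_velocity_abs_bound(2)[OF sp[OF True] A, of w]
          have "(\<integral>y. \<bar>indicator A y * path_velocity w t y\<bar> \<partial>lborel) \<le> ?C" by linarith
          moreover have "0 \<le> ?C" using s0 by (intro mult_nonneg_nonneg add_nonneg_nonneg) auto
          ultimately show ?thesis using True fun_cong[OF Ht'[OF True]] by simp
        next
          case False
          then show ?thesis using fun_cong[OF Ht[OF False]] by simp
        qed
      qed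
    qed measurable
  qed (use iy in auto)
  have e1: "(\<integral>y. H t y \<partial>lborel) = indicator {t0..pi/2} t * smooth_velocity A w t" for t
    by (cases "t \<in> {t0..pi/2}") (simp_all add: Ht Ht' smooth_velocity_eq[OF A sp])
  show "integrable lborel (\<lambda>t. indicator {t0..pi/2} t * smooth_velocity A w t)"
    using lborel_pair.integrable_fst'[OF int] by (simp add: e1)
  have e2: "(\<integral>t. H t y \<partial>lborel) = indicator A y * kernel 0 0 1 (y - 0) - indicator A y * kernel 0 0 (sin t0) (y - cos t0 *\<^sub>R w)" for y
  proof -
    have "(\<integral>t. H t y \<partial>lborel) = (\<integral>t. indicator A y * (indicator {t0..pi/2} t * path_velocity w t y) \<partial>lborel)"
      unfolding H_def by (simp add: ac_simps)
    also have "\<dots> = indicator A y * (\<integral>t. indicator {t0..pi/2} t * path_velocity w t y \<partial>lborel)"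
      by (rule integral_mult_right_zero)
    finally show ?thesis unfolding path_velocity_FTC[OF t0] by (simp add: right_diff_distrib)
  qed
  have "(\<integral>t. indicator {t0..pi/2} t * smooth_velocity A w t \<partial>lborel) = (\<integral>t. (\<integral>y. H t y \<partial>lborel) \<partial>lborel)"
    by (simp add: e1)
  also have "\<dots> = (\<integral>y. (\<integral>t. H t y \<partial>lborel) \<partial>lborel)"
    using lborel_pair.Fubini_integral[of H] int by (simp add: split_beta')
  also have "\<dots> = smoothed A 0 0 1 0 - smoothed A 0 0 (sin t0) (cos t0 *\<^sub>R w)"
    unfolding e2 smooth_eq_shift[OF A]
    by (rule Bochner_Integration.integral_diff) (intro indicator_kernel_integrable A s0 zero_less_one)+
  finally show "smoothed A 0 0 1 0 - smoothed A 0 0 (sin t0) (cos t0 *\<^sub>R w) = (\<integral>t. indicator {t0..pi/2} t * smooth_velocity A w t \<partial>lborel)"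
    by simp
qed

text \<open>
  The factor \<open>cos t\<close> makes every term an exact derivative of a function of \<open>sin t\<close>.
\<close>

lemma path_bound_integral:
  fixes a b d :: real
  assumes t0: "0 < t0" "t0 \<le> pi / 2"
  shows "has_bochner_integral lborel
      (\<lambda>t. indicator {t0..pi/2} t * (cos t * (a / sin t + b / sqrt (sin t) + d / (sin t)^2)))
      (a * ln (1 / sin t0) + 2 * b * (1 - sqrt (sin t0)) + d * (1 / sin t0 - 1))"
proof -
  define F where "F t = a * ln (sin t) + 2 * b * sqrt (sin t) - d / sin t" for t
  have sp: "sin t > 0" if "t0 \<le> t" "t \<le> pi/2" for t
    by (rule sin_pos_halfpi[OF t0(1) that])
  have sp': "sin t \<noteq> 0" "sin t \<ge> 0" if "t \<in> {t0..pi/2}" for t using sp[of t] that by auto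
  have s0: "sin t0 > 0" using t0 sp by auto
  have "has_bochner_integral lborel
      (\<lambda>t. indicator {t0..pi/2} t *\<^sub>R (cos t * (a / sin t + b / sqrt (sin t) + d / (sin t)^2)))
      (F (pi/2) - F t0)"
  proof (rule has_bochner_integral_FTC_Icc[OF t0(2)])
    fix t assume t: "t0 \<le> t" "t \<le> pi / 2"
    have "(F has_real_derivative (cos t * (a / sin t + b / sqrt (sin t) + d / (sin t)^2))) (at t within {t0..pi/2})"
      unfolding F_def[abs_def] using sp[OF t]
      by (auto intro!: derivative_eq_intros simp: field_simps power2_eq_square)
    then show "(F has_vector_derivative (cos t * (a / sin t + b / sqrt (sin t) + d / (sin t)^2))) (at t within {t0..pi/2})"
      unfolding has_real_derivative_iff_has_vector_derivative .
  next
    show "continuous_on {t0..pi/2} (\<lambda>t. cos t * (a / sin t + b / sqrt (sin t) + d / (sin t)^2))"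
      using sp' by (intro continuous_intros) auto
  qed
  moreover have "F (pi/2) - F t0 = a * ln (1 / sin t0) + 2 * b * (1 - sqrt (sin t0)) + d * (1 / sin t0 - 1)"
    using s0 by (simp add: F_def ln_div) (simp add: algebra_simps)
  ultimately show ?thesis unfolding real_scaleR_def by simp
qed

abbreviation gauss :: "(real \<times> real) set \<Rightarrow> real" where
  "gauss A \<equiv> measure std_bivariate_normal A"

lemma sets_std_bivariate_normal[simp, measurable_cong]: "sets std_bivariate_normal = sets borel"
  by (simp add: std_bivariate_normal_def)

lemma space_std_bivariate_normal[simp]: "space std_bivariate_normal = UNIV"
  by (simp add: std_bivariate_normal_def)

interpretation gauss: prob_space std_bivariate_normal
  by (rule prob_space_std_bivariate_normal)

abbreviation std_normal_law :: "real measure" where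
  "std_normal_law \<equiv> density lborel (\<lambda>x. ennreal (std_normal_density x))"

interpretation N1: prob_space std_normal_law
  by (rule prob_space_normal_density) simp

interpretation N2: pair_prob_space std_normal_law std_normal_law ..

section \<open>Convex sets and the planar normal law\<close>

lemma std_normal_density_le_half: "std_normal_density x \<le> 1 / 2"
proof -
  have "2 \<le> sqrt (2 * pi)"
    using pi_ge_two by (intro real_le_rsqrt) simp
  then have "1 / sqrt (2 * pi) \<le> 1 / 2"
    by (intro divide_left_mono) auto
  moreover have "std_normal_density x \<le> 1 / sqrt (2 * pi) * 1"
    unfolding std_normal_density_def by (intro mult_left_mono) auto
  ultimately show ?thesis by linarith
qed

lemma std_normal_law_small:
  assumes [measurable]: "S \<in> sets borel" and d: "\<And>a b. a \<in> S \<Longrightarrow> b \<in> S \<Longrightarrow> \<bar>b - a\<bar> \<le> d"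
    and "0 \<le> d"
  shows "emeasure std_normal_law S \<le> ennreal d"
proof (cases "S = {}")
  case False
  then obtain a where a: "a \<in> S" by auto
  define h where "h = (1 / 2 :: real)"
  have "emeasure std_normal_law S = (\<integral>\<^sup>+x. ennreal (std_normal_density x) * indicator S x \<partial>lborel)"
    by (simp add: emeasure_density)
  also have "\<dots> \<le> (\<integral>\<^sup>+x. ennreal h * indicator {a - d..a + d} x \<partial>lborel)"
  proof (intro nn_integral_mono)
    fix x :: real
    show "ennreal (std_normal_density x) * indicator S x \<le> ennreal h * indicator {a - d..a + d} x"
      using d[OF a, of x] std_normal_density_le_half[of x, folded h_def]
      by (auto simp: indicator_def abs_le_iff intro!: ennreal_leI)
  qed
  also have "\<dots> = ennreal h * ennreal (2 * d)"
    using assms(3) by (simp add: nn_integral_cmult h_def)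
  also have "\<dots> = ennreal d"
    using assms(3) by (subst ennreal_mult[symmetric]) (auto simp: h_def)
  finally show ?thesis .
qed simp

text \<open>
  If two points of a line lie in a convex set and their translates along the line do not, then the
  translate of one of them would lie between them as soon as the translation were shorter than their distance.
\<close>

lemma convex_exit_distance:
  fixes A :: "'a::real_vector set"
  assumes A: "convex A" and a: "a \<in> A" "a + r *\<^sub>R e \<in> A"
    and v: "a + v *\<^sub>R e \<notin> A" "a + r *\<^sub>R e + v *\<^sub>R e \<notin> A"
  shows "\<bar>r\<bar> \<le> \<bar>v\<bar>"
proof (rule ccontr)
  assume n: "\<not> \<bar>r\<bar> \<le> \<bar>v\<bar>"
  then have r: "r \<noteq> 0" by auto
  have on: "a + u *\<^sub>R (r *\<^sub>R e) \<in> A" if "0 \<le> u" "u \<le> 1" for u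
    using convexD_alt[OF A a that] by (simp add: algebra_simps)
  have "0 \<le> v / r \<and> v / r \<le> 1 \<or> 0 \<le> (r + v) / r \<and> (r + v) / r \<le> 1"
    using n r by (auto simp: field_simps abs_if split: if_splits)
  then show False
  proof
    assume "0 \<le> v / r \<and> v / r \<le> 1"
    with on[of "v / r"] r v(1) show False by simp
  next
    assume "0 \<le> (r + v) / r \<and> (r + v) / r \<le> 1"
    with on[of "(r + v) / r"] r v(2) show False by (simp add: scaleR_left_distrib add.assoc)
  qed
qed

lemma gauss_exit_fst:
  assumes [measurable]: "A \<in> sets borel" and A: "convex A"
  shows "gauss {x \<in> A. x + (v, 0) \<notin> A} \<le> \<bar>v\<bar>"
proof -
  let ?B = "{x \<in> A. x + (v, 0) \<notin> A}"
  have B: "?B \<in> sets borel" by measurable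
  have B': "?B \<in> sets (std_normal_law \<Otimes>\<^sub>M std_normal_law)"
    using B by (simp only: std_bivariate_normal_eq_pair[symmetric] sets_std_bivariate_normal)
  have "emeasure std_bivariate_normal ?B = (\<integral>\<^sup>+y. emeasure std_normal_law ((\<lambda>x. (x, y)) -` ?B) \<partial>std_normal_law)"
    unfolding std_bivariate_normal_eq_pair by (rule N2.emeasure_pair_measure_alt2[OF B'])
  also have "\<dots> \<le> (\<integral>\<^sup>+y. ennreal \<bar>v\<bar> \<partial>std_normal_law)"
  proof (intro nn_integral_mono std_normal_law_small)
    fix y a b assume ab: "a \<in> (\<lambda>x. (x, y)) -` ?B" "b \<in> (\<lambda>x. (x, y)) -` ?B"
    show "\<bar>b - a\<bar> \<le> \<bar>v\<bar>"
      by (rule convex_exit_distance[OF A, of "(a, y)" _ "(1, 0)"]) (use ab in auto)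
  next
    fix y
    have "(\<lambda>x. (x, y)) -` ?B \<in> sets std_normal_law" by (rule sets_Pair2[OF B'])
    then show "(\<lambda>x. (x, y)) -` ?B \<in> sets borel" by simp
  qed simp
  also have "\<dots> = ennreal \<bar>v\<bar>" using N1.emeasure_space_1 by simp
  finally show ?thesis by (simp add: gauss.emeasure_eq_measure)
qed

lemma gauss_exit_snd:
  assumes [measurable]: "A \<in> sets borel" and A: "convex A"
  shows "gauss {x \<in> A. x + (0, v) \<notin> A} \<le> \<bar>v\<bar>"
proof -
  let ?B = "{x \<in> A. x + (0, v) \<notin> A}"
  have B: "?B \<in> sets borel" by measurable
  have B': "?B \<in> sets (std_normal_law \<Otimes>\<^sub>M std_normal_law)"
    using B by (simp only: std_bivariate_normal_eq_pair[symmetric] sets_std_bivariate_normal)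
  have "emeasure std_bivariate_normal ?B = (\<integral>\<^sup>+x. emeasure std_normal_law (Pair x -` ?B) \<partial>std_normal_law)"
    unfolding std_bivariate_normal_eq_pair by (rule N1.emeasure_pair_measure_alt[OF B'])
  also have "\<dots> \<le> (\<integral>\<^sup>+y. ennreal \<bar>v\<bar> \<partial>std_normal_law)"
  proof (intro nn_integral_mono std_normal_law_small)
    fix x a b assume ab: "a \<in> Pair x -` ?B" "b \<in> Pair x -` ?B"
    show "\<bar>b - a\<bar> \<le> \<bar>v\<bar>"
      by (rule convex_exit_distance[OF A, of "(x, a)" _ "(0, 1)"]) (use ab in auto)
  next
    fix x
    have "Pair x -` ?B \<in> sets std_normal_law" by (rule sets_Pair1[OF B'])
    then show "Pair x -` ?B \<in> sets borel" by simp
  qed simp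
  also have "\<dots> = ennreal \<bar>v\<bar>" using N1.emeasure_space_1 by simp
  finally show ?thesis by (simp add: gauss.emeasure_eq_measure)
qed

lemma convex_scale_shift:
  assumes "convex (A :: (real \<times> real) set)"
  shows "convex {w. c *\<^sub>R w + u \<in> A}"
proof (rule convexI)
  fix x y and a b :: real assume *: "x \<in> {w. c *\<^sub>R w + u \<in> A}" "y \<in> {w. c *\<^sub>R w + u \<in> A}" "0 \<le> a" "0 \<le> b" "a + b = 1"
  have "a *\<^sub>R (c *\<^sub>R x + u) + b *\<^sub>R (c *\<^sub>R y + u) \<in> A"
    using * assms by (intro convexD) auto
  moreover have "a *\<^sub>R (c *\<^sub>R x + u) + b *\<^sub>R (c *\<^sub>R y + u) = c *\<^sub>R (a *\<^sub>R x + b *\<^sub>R y) + (a + b) *\<^sub>R u"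
    by (simp add: algebra_simps)
  ultimately show "a *\<^sub>R x + b *\<^sub>R y \<in> {w. c *\<^sub>R w + u \<in> A}"
    using * by simp
qed

lemma convex_translate: "convex (A :: (real \<times> real) set) \<Longrightarrow> convex {x. x + v \<in> A}"
  using convex_scale_shift[of A 1 v] by simp

text \<open>
  On each line parallel to an axis the points that leave \<open>A\<close> lie within a set of diameter at most the
  length of the shift; this replaces any estimate of the Gaussian perimeter of a convex set.
\<close>

lemma gauss_exit:
  assumes [measurable]: "A \<in> sets borel" and A: "convex A"
  shows "gauss {x \<in> A. x + v \<notin> A} \<le> \<bar>fst v\<bar> + \<bar>snd v\<bar>"
proof -
  let ?A = "{x. x + (fst v, 0) \<in> A}"
  have [measurable]: "?A \<in> sets borel" by measurable
  have "{x \<in> A. x + v \<notin> A} \<subseteq> {x \<in> A. x + (fst v, 0) \<notin> A} \<union> {x \<in> ?A. x + (0, snd v) \<notin> ?A}"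
    by (cases v) (auto simp: add.assoc)
  then have "gauss {x \<in> A. x + v \<notin> A} \<le> gauss ({x \<in> A. x + (fst v, 0) \<notin> A} \<union> {x \<in> ?A. x + (0, snd v) \<notin> ?A})"
    by (rule gauss.finite_measure_mono) measurable
  also have "\<dots> \<le> gauss {x \<in> A. x + (fst v, 0) \<notin> A} + gauss {x \<in> ?A. x + (0, snd v) \<notin> ?A}"
    by (rule measure_Un_le) measurable
  also have "\<dots> \<le> \<bar>fst v\<bar> + \<bar>snd v\<bar>"
    by (intro add_mono gauss_exit_fst gauss_exit_snd A convex_translate) measurable
  finally show ?thesis .
qed

text \<open>
  The distance over Borel convex sets. Restricting to Borel sets keeps translates, dilates and finite
  intersections inside the class without recourse to the completed measure.
\<close>

definition convex_gap :: "'a pmf \<Rightarrow> ('a \<Rightarrow> real \<times> real) \<Rightarrow> real" where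
  "convex_gap D W = (SUP A\<in>{A. A \<in> sets borel \<and> convex A}. \<bar>measure_pmf.prob D {\<omega>. W \<omega> \<in> A} - gauss A\<bar>)"

lemma convex_gap_bdd: "bdd_above ((\<lambda>A. \<bar>measure_pmf.prob D {\<omega>. W \<omega> \<in> A} - gauss A\<bar>) ` S)"
proof (rule bdd_aboveI2)
  fix A
  have "0 \<le> measure_pmf.prob D {\<omega>. W \<omega> \<in> A}" "measure_pmf.prob D {\<omega>. W \<omega> \<in> A} \<le> 1" "0 \<le> gauss A" "gauss A \<le> 1"
    by auto
  then show "\<bar>measure_pmf.prob D {\<omega>. W \<omega> \<in> A} - gauss A\<bar> \<le> 1" by linarith
qed

lemma convex_gap_upper:
  assumes "A \<in> sets borel" "convex A"
  shows "\<bar>measure_pmf.prob D {\<omega>. W \<omega> \<in> A} - gauss A\<bar> \<le> convex_gap D W"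
  unfolding convex_gap_def by (rule cSUP_upper[OF _ convex_gap_bdd]) (use assms in auto)

lemma convex_gap_nonneg: "0 \<le> convex_gap D W"
  using convex_gap_upper[of "{}" D W] by simp

lemma convex_gap_least:
  assumes "\<And>A. A \<in> sets borel \<Longrightarrow> convex A \<Longrightarrow> \<bar>measure_pmf.prob D {\<omega>. W \<omega> \<in> A} - gauss A\<bar> \<le> c"
  shows "convex_gap D W \<le> c"
  unfolding convex_gap_def by (rule cSUP_least) (use assms in \<open>auto intro: exI[of _ "{}"]\<close>)

text \<open>
  A finitely supported law does not distinguish \<open>A\<close> from the hull of the atoms in \<open>A\<close>, which is compact.
\<close>

lemma prob_le_prob_hull:
  "measure_pmf.prob D {\<omega>. W \<omega> \<in> A} \<le> measure_pmf.prob D {\<omega>. W \<omega> \<in> convex hull (A \<inter> W ` set_pmf D)}"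
proof -
  have "measure_pmf.prob D {\<omega>. W \<omega> \<in> A} = measure_pmf.prob D ({\<omega>. W \<omega> \<in> A} \<inter> set_pmf D)"
    by (simp add: measure_Int_set_pmf)
  also have "\<dots> \<le> measure_pmf.prob D {\<omega>. W \<omega> \<in> convex hull (A \<inter> W ` set_pmf D)}"
    by (rule measure_pmf.finite_measure_mono) (auto intro!: hull_inc)
  finally show ?thesis .
qed

lemma pmf_expectation_indicator:
  "measure_pmf.expectation D (\<lambda>\<omega>. indicator A (f \<omega>)) = measure_pmf.prob D {\<omega>. f \<omega> \<in> A}"
proof -
  have "(\<lambda>\<omega>. indicator A (f \<omega>)) = (indicator {\<omega>. f \<omega> \<in> A} :: _ \<Rightarrow> real)"
    by (auto simp: indicator_def)
  then show ?thesis by simp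
qed

lemma borel_scale_shift:
  assumes [measurable]: "(A :: (real \<times> real) set) \<in> sets borel"
  shows "{w. c *\<^sub>R w + u \<in> A} \<in> sets borel"
  by measurable

text \<open>
  The event is expressed through three convex sets, \<open>A\<close> seen from \<open>w\<close>, its translate, and their intersection, so
  the law of \<open>W\<close> may be replaced by the Gaussian law at the price of \<open>4\<close> times the distance.
\<close>

lemma exit_probability:
  assumes [measurable]: "A \<in> sets borel" and A: "convex A" and c: "1 / 2 \<le> c" and fin: "finite (set_pmf D)"
  shows "measure_pmf.expectation D (\<lambda>\<omega>. \<bar>indicator A (c *\<^sub>R W \<omega> + u) - indicator A (c *\<^sub>R W \<omega>)\<bar>)
     \<le> 4 * convex_gap D W + 4 * (\<bar>fst u\<bar> + \<bar>snd u\<bar>)"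
proof -
  let ?B = "{w. c *\<^sub>R w + 0 \<in> A}" and ?B' = "{w. c *\<^sub>R w + u \<in> A}"
  have [measurable]: "?B \<in> sets borel" "?B' \<in> sets borel" by measurable
  have cv: "convex ?B" "convex ?B'" using A by (auto intro: convex_scale_shift simp del: add_0_right)
  have int: "integrable D (f :: _ \<Rightarrow> real)" for f using fin by (rule integrable_measure_pmf_finite)
  have "(\<lambda>\<omega>. \<bar>indicator A (c *\<^sub>R W \<omega> + u) - indicator A (c *\<^sub>R W \<omega>)\<bar> :: real)
    = (\<lambda>\<omega>. indicator ?B (W \<omega>) + indicator ?B' (W \<omega>) - 2 * indicator (?B \<inter> ?B') (W \<omega>))"
    by (auto simp: indicator_def)
  then have "measure_pmf.expectation D (\<lambda>\<omega>. \<bar>indicator A (c *\<^sub>R W \<omega> + u) - indicator A (c *\<^sub>R W \<omega>)\<bar>)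
    = measure_pmf.prob D {\<omega>. W \<omega> \<in> ?B} + measure_pmf.prob D {\<omega>. W \<omega> \<in> ?B'} - 2 * measure_pmf.prob D {\<omega>. W \<omega> \<in> ?B \<inter> ?B'}"
    by (simp only: Bochner_Integration.integral_add Bochner_Integration.integral_diff integral_mult_right_zero int pmf_expectation_indicator)
  moreover have "\<bar>measure_pmf.prob D {\<omega>. W \<omega> \<in> ?B} - gauss ?B\<bar> \<le> convex_gap D W"
    by (intro convex_gap_upper cv) measurable
  moreover have "\<bar>measure_pmf.prob D {\<omega>. W \<omega> \<in> ?B'} - gauss ?B'\<bar> \<le> convex_gap D W"
    by (intro convex_gap_upper cv) measurable
  moreover have "\<bar>measure_pmf.prob D {\<omega>. W \<omega> \<in> ?B \<inter> ?B'} - gauss (?B \<inter> ?B')\<bar> \<le> convex_gap D W"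
    by (intro convex_gap_upper cv convex_Int) measurable
  moreover have "gauss ?B - gauss (?B \<inter> ?B') \<le> 2 * (\<bar>fst u\<bar> + \<bar>snd u\<bar>)"
       "gauss ?B' - gauss (?B \<inter> ?B') \<le> 2 * (\<bar>fst u\<bar> + \<bar>snd u\<bar>)"
  proof -
    have c0: "c > 0" using c by simp
    have k: "\<bar>fst ((1 / c) *\<^sub>R u)\<bar> + \<bar>snd ((1 / c) *\<^sub>R u)\<bar> \<le> 2 * (\<bar>fst u\<bar> + \<bar>snd u\<bar>)"
    proof -
      have "1 / c \<le> 2" using c c0 by (simp add: field_simps)
      then have "(1 / c) * (\<bar>fst u\<bar> + \<bar>snd u\<bar>) \<le> 2 * (\<bar>fst u\<bar> + \<bar>snd u\<bar>)"
        by (intro mult_right_mono) auto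
      moreover have "\<bar>fst ((1 / c) *\<^sub>R u)\<bar> + \<bar>snd ((1 / c) *\<^sub>R u)\<bar> = (1 / c) * (\<bar>fst u\<bar> + \<bar>snd u\<bar>)"
        using c0 by (simp add: abs_mult field_simps)
      ultimately show ?thesis by simp
    qed
    have "gauss ?B - gauss (?B \<inter> ?B') = gauss (?B - ?B \<inter> ?B')"
      by (rule gauss.finite_measure_Diff[symmetric]) (auto simp del: add_0_right)
    also have "?B - ?B \<inter> ?B' = {w \<in> ?B. w + (1 / c) *\<^sub>R u \<notin> ?B}"
      using c0 by (auto simp: scaleR_add_right)
    also have "gauss \<dots> \<le> \<bar>fst ((1 / c) *\<^sub>R u)\<bar> + \<bar>snd ((1 / c) *\<^sub>R u)\<bar>"
      by (rule gauss_exit[OF _ cv(1)]) measurable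
    finally show "gauss ?B - gauss (?B \<inter> ?B') \<le> 2 * (\<bar>fst u\<bar> + \<bar>snd u\<bar>)" using k by linarith
    have "gauss ?B' - gauss (?B \<inter> ?B') = gauss (?B' - ?B \<inter> ?B')"
      by (rule gauss.finite_measure_Diff[symmetric]) (auto simp del: add_0_right)
    also have "?B' - ?B \<inter> ?B' = {w \<in> ?B'. w + - ((1 / c) *\<^sub>R u) \<notin> ?B'}"
      using c0 by (auto simp: scaleR_diff_right)
    also have "gauss \<dots> \<le> \<bar>fst (- ((1 / c) *\<^sub>R u))\<bar> + \<bar>snd (- ((1 / c) *\<^sub>R u))\<bar>"
      by (rule gauss_exit[OF _ cv(2)]) measurable
    finally show "gauss ?B' - gauss (?B \<inter> ?B') \<le> 2 * (\<bar>fst u\<bar> + \<bar>snd u\<bar>)" using k by simp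
  qed
  ultimately show ?thesis by linarith
qed

section \<open>Stein couplings\<close>

lemma expectation_abs_le:
  fixes f g :: "'a \<Rightarrow> real"
  assumes fin: "finite (set_pmf D)" and "\<And>x. \<bar>f x\<bar> \<le> g x"
  shows "\<bar>measure_pmf.expectation D f\<bar> \<le> measure_pmf.expectation D g"
proof -
  have int: "integrable D (h :: 'a \<Rightarrow> real)" for h
    using fin by (rule integrable_measure_pmf_finite)
  have "\<bar>measure_pmf.expectation D f\<bar> \<le> measure_pmf.expectation D (\<lambda>x. \<bar>f x\<bar>)"
    by (rule integral_abs_bound)
  also have "\<dots> \<le> measure_pmf.expectation D g"
    by (intro integral_mono int assms(2))
  finally show ?thesis .
qed

lemma pmf_abs_product_le:
  fixes f g :: "'a \<Rightarrow> real"
  assumes fin: "finite (set_pmf D)" and a: "0 < a" and b: "0 < b"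
    and f: "measure_pmf.expectation D (\<lambda>\<omega>. (f \<omega>)^2) \<le> a^2"
    and g: "measure_pmf.expectation D (\<lambda>\<omega>. (g \<omega>)^2) \<le> b^2"
  shows "\<bar>measure_pmf.expectation D (\<lambda>\<omega>. f \<omega> * g \<omega>)\<bar> \<le> a * b"
proof -
  have int: "integrable D (h :: _ \<Rightarrow> real)" for h using fin by (rule integrable_measure_pmf_finite)
  have "\<bar>measure_pmf.expectation D (\<lambda>\<omega>. f \<omega> * g \<omega>)\<bar> \<le> measure_pmf.expectation D (\<lambda>\<omega>. (b / a) / 2 * (f \<omega>)^2 + (a / b) / 2 * (g \<omega>)^2)"
  proof (rule expectation_abs_le[OF fin])
    fix \<omega>
    have "0 \<le> (b * \<bar>f \<omega>\<bar> - a * \<bar>g \<omega>\<bar>)^2" by simp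
    then have "2 * (a * b) * \<bar>f \<omega> * g \<omega>\<bar> \<le> b^2 * (f \<omega>)^2 + a^2 * (g \<omega>)^2"
      by (simp add: power2_diff power_mult_distrib abs_mult algebra_simps)
    then show "\<bar>f \<omega> * g \<omega>\<bar> \<le> (b / a) / 2 * (f \<omega>)^2 + (a / b) / 2 * (g \<omega>)^2"
      using a b by (simp add: field_simps power2_eq_square)
  qed
  also have "\<dots> = (b / a) / 2 * measure_pmf.expectation D (\<lambda>\<omega>. (f \<omega>)^2) + (a / b) / 2 * measure_pmf.expectation D (\<lambda>\<omega>. (g \<omega>)^2)"
    by (simp only: Bochner_Integration.integral_add[OF int int] integral_mult_right_zero)
  also have "\<dots> \<le> (b / a) / 2 * a^2 + (a / b) / 2 * b^2"
    using a b f g by (intro add_mono mult_left_mono) auto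
  also have "\<dots> = a * b" using a b by (simp add: field_simps power2_eq_square)
  finally show ?thesis .
qed

text \<open>
  The key estimate: compared with the trivial bound \<open>s\<^sup>-\<^sup>4\<close> it gains the factor \<open>\<kappa> + s\<close>, the probability that \<open>W\<close> is
  within a distance of order \<open>s\<close> from the boundary of the set.
\<close>

lemma expectation_smooth_square:
  assumes A[measurable]: "A \<in> sets borel" "convex A" and fin: "finite (set_pmf D)"
    and s: "0 < s" and c: "0 \<le> c" and sc: "s^2 + c^2 = 1" and ij: "i + j = 2"
  shows "measure_pmf.expectation D (\<lambda>\<omega>. (smoothed A i j s (c *\<^sub>R W \<omega>))^2)
    \<le> (kernel_mass^2 / s^2 * sqrt (4 * convex_gap D W + 8 * s))^2"
proof -
  let ?E = "measure_pmf.expectation D"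
  have int: "integrable D (h :: _ \<Rightarrow> real)" for h using fin by (rule integrable_measure_pmf_finite)
  have le: "i \<le> 3" "j \<le> 3" using ij by auto
  have rhs: "(kernel_mass^2 / s^2 * sqrt (4 * convex_gap D W + 8 * s))^2 = (kernel_mass^2 / s^2)^2 * (4 * convex_gap D W + 8 * s)"
    using convex_gap_nonneg[of D W] s by (subst power_mult_distrib, subst real_sqrt_pow2) auto
  show ?thesis
  proof (cases "1 / 2 \<le> c")
    case True
    let ?d = "\<lambda>x u. \<bar>indicator A (x + u) - indicator A x\<bar> :: real"
    have "?E (\<lambda>\<omega>. (smoothed A i j s (c *\<^sub>R W \<omega>))^2)
      \<le> ?E (\<lambda>\<omega>. kernel_mass^2 / s^2 * (\<integral>u. ?d (c *\<^sub>R W \<omega>) u * \<bar>kernel i j s u\<bar> \<partial>lborel))"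
      by (intro integral_mono int smooth_square_le A s ij)
    also have "\<dots> = kernel_mass^2 / s^2 * ?E (\<lambda>\<omega>. \<integral>u. ?d (c *\<^sub>R W \<omega>) u * \<bar>kernel i j s u\<bar> \<partial>lborel)"
      by (rule integral_mult_right_zero)
    also have "?E (\<lambda>\<omega>. \<integral>u. ?d (c *\<^sub>R W \<omega>) u * \<bar>kernel i j s u\<bar> \<partial>lborel)
        = (\<Sum>\<omega>\<in>set_pmf D. (\<integral>u. ?d (c *\<^sub>R W \<omega>) u * \<bar>kernel i j s u\<bar> \<partial>lborel) * pmf D \<omega>)"
      by (rule integral_measure_pmf_real[OF fin])
    also have "\<dots> = (\<integral>u. (\<Sum>\<omega>\<in>set_pmf D. ?d (c *\<^sub>R W \<omega>) u * \<bar>kernel i j s u\<bar> * pmf D \<omega>) \<partial>lborel)"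
      using smooth_square_le(1)[OF A(1) s ij] by (subst Bochner_Integration.integral_sum) auto
    also have "\<dots> = (\<integral>u. ?E (\<lambda>\<omega>. ?d (c *\<^sub>R W \<omega>) u) * \<bar>kernel i j s u\<bar> \<partial>lborel)"
    proof (rule Bochner_Integration.integral_cong[OF refl])
      fix u
      have "?E (\<lambda>\<omega>. ?d (c *\<^sub>R W \<omega>) u) = (\<Sum>\<omega>\<in>set_pmf D. ?d (c *\<^sub>R W \<omega>) u * pmf D \<omega>)"
        by (rule integral_measure_pmf_real[OF fin])
      then show "(\<Sum>\<omega>\<in>set_pmf D. ?d (c *\<^sub>R W \<omega>) u * \<bar>kernel i j s u\<bar> * pmf D \<omega>) = ?E (\<lambda>\<omega>. ?d (c *\<^sub>R W \<omega>) u) * \<bar>kernel i j s u\<bar>"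
        by (simp only: sum_distrib_right) (simp only: ac_simps)
    qed
    also have "\<dots> \<le> (\<integral>u. 4 * convex_gap D W * \<bar>kernel i j s u\<bar> + 4 * ((\<bar>fst u\<bar> + \<bar>snd u\<bar>) * \<bar>kernel i j s u\<bar>) \<partial>lborel)"
    proof (rule integral_mono')
      show "integrable lborel (\<lambda>u. 4 * convex_gap D W * \<bar>kernel i j s u\<bar> + 4 * ((\<bar>fst u\<bar> + \<bar>snd u\<bar>) * \<bar>kernel i j s u\<bar>))"
        by (intro Bochner_Integration.integrable_add integrable_mult_right integrable_abs kernel_integrable kernel_moment s le)
      fix u
      have "?E (\<lambda>\<omega>. ?d (c *\<^sub>R W \<omega>) u) * \<bar>kernel i j s u\<bar> \<le> (4 * convex_gap D W + 4 * (\<bar>fst u\<bar> + \<bar>snd u\<bar>)) * \<bar>kernel i j s u\<bar>"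
        by (intro mult_right_mono exit_probability A True fin) auto
      then show "?E (\<lambda>\<omega>. ?d (c *\<^sub>R W \<omega>) u) * \<bar>kernel i j s u\<bar> \<le> 4 * convex_gap D W * \<bar>kernel i j s u\<bar> + 4 * ((\<bar>fst u\<bar> + \<bar>snd u\<bar>) * \<bar>kernel i j s u\<bar>)"
        by (simp only: distrib_right mult.assoc)
      show "0 \<le> 4 * convex_gap D W * \<bar>kernel i j s u\<bar> + 4 * ((\<bar>fst u\<bar> + \<bar>snd u\<bar>) * \<bar>kernel i j s u\<bar>)"
        using convex_gap_nonneg[of D W] by simp
    qed
    also have "\<dots> = 4 * convex_gap D W * (\<integral>u. \<bar>kernel i j s u\<bar> \<partial>lborel) + 4 * (\<integral>u. (\<bar>fst u\<bar> + \<bar>snd u\<bar>) * \<bar>kernel i j s u\<bar> \<partial>lborel)"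
      using kernel_integrable[OF s, of i j, THEN integrable_abs] kernel_moment(1)[OF s le]
      by (subst Bochner_Integration.integral_add) simp_all
    also have "\<dots> \<le> 4 * convex_gap D W * (kernel_mass^2 / s ^ (i + j)) + 4 * (2 * kernel_mass^2 * s / s ^ (i + j))"
      using convex_gap_nonneg[of D W] by (intro add_mono mult_left_mono kernel_L1 kernel_moment s le) auto
    also have "\<dots> = kernel_mass^2 / s^2 * (4 * convex_gap D W + 8 * s)"
      by (simp add: ij algebra_simps)
    finally have "?E (\<lambda>\<omega>. (smoothed A i j s (c *\<^sub>R W \<omega>))^2) \<le> kernel_mass^2 / s^2 * (kernel_mass^2 / s^2 * (4 * convex_gap D W + 8 * s))"
      by (meson divide_nonneg_nonneg mult_left_mono zero_le_power2)
    then show ?thesis unfolding rhs by (simp add: power2_eq_square mult.assoc)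
  next
    case False
    \<comment> \<open>For small \<open>c\<close> the rescaling by \<open>1 / c\<close> is useless, but then \<open>s\<close> is bounded below and the trivial bound suffices.\<close>
    have "c^2 \<le> (1/2)^2" using False c by (intro power_mono) auto
    then have "(1/2)^2 \<le> s^2" using sc by (simp add: power2_eq_square)
    then have s2: "1 / 2 \<le> s" by (rule power2_le_imp_le) (use s in simp)
    have "?E (\<lambda>\<omega>. (smoothed A i j s (c *\<^sub>R W \<omega>))^2) \<le> ?E (\<lambda>\<omega>. (kernel_mass^2 / s^2)^2)"
    proof (intro integral_mono int)
      fix \<omega>
      have "\<bar>smoothed A i j s (c *\<^sub>R W \<omega>)\<bar>^2 \<le> (kernel_mass^2 / s^2)^2"
        using smooth_bound[OF A(1) s le, of "c *\<^sub>R W \<omega>"] ij by (intro power_mono) auto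
      then show "(smoothed A i j s (c *\<^sub>R W \<omega>))^2 \<le> (kernel_mass^2 / s^2)^2" by simp
    qed
    also have "\<dots> = (kernel_mass^2 / s^2)^2 * 1" by simp
    also have "\<dots> \<le> (kernel_mass^2 / s^2)^2 * (4 * convex_gap D W + 8 * s)"
      using s2 convex_gap_nonneg[of D W] by (intro mult_left_mono) auto
    finally show ?thesis unfolding rhs .
  qed
qed

text \<open>
  The variables \<open>G1\<close>, \<open>G2\<close>, \<open>\<Delta>\<close> form a Stein coupling for \<open>W\<close>. The sums \<open>\<Sum>\<^sub>k G\<^sub>i \<Delta>\<^sub>j\<close> play the role of a random covariance matrix;
  the single parameter \<open>\<epsilon>\<close> bounds both its fluctuation and, through \<open>\<epsilon>\<^sup>2\<close>, the third-order remainder.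
\<close>

locale stein_coupling =
  fixes D :: "'a pmf" and W :: "'a \<Rightarrow> real \<times> real" and I :: "'k set"
    and G1 G2 :: "'k \<Rightarrow> 'a \<Rightarrow> real" and \<Delta> :: "'k \<Rightarrow> 'a \<Rightarrow> real \<times> real" and \<epsilon> :: real
  assumes fin: "finite (set_pmf D)" and finI: "finite I"
    and coupling1: "\<And>\<psi>. measure_pmf.expectation D (\<lambda>\<omega>. fst (W \<omega>) * \<psi> (W \<omega>))
      = (\<Sum>k\<in>I. measure_pmf.expectation D (\<lambda>\<omega>. G1 k \<omega> * (\<psi> (W \<omega>) - \<psi> (W \<omega> - \<Delta> k \<omega>))))"
    and coupling2: "\<And>\<psi>. measure_pmf.expectation D (\<lambda>\<omega>. snd (W \<omega>) * \<psi> (W \<omega>))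
      = (\<Sum>k\<in>I. measure_pmf.expectation D (\<lambda>\<omega>. G2 k \<omega> * (\<psi> (W \<omega>) - \<psi> (W \<omega> - \<Delta> k \<omega>))))"
    and eps: "0 < \<epsilon>"
    and T11: "measure_pmf.expectation D (\<lambda>\<omega>. (1 - (\<Sum>k\<in>I. G1 k \<omega> * fst (\<Delta> k \<omega>)))^2) \<le> \<epsilon>^2"
    and T12: "measure_pmf.expectation D (\<lambda>\<omega>. (\<Sum>k\<in>I. G1 k \<omega> * snd (\<Delta> k \<omega>))^2) \<le> \<epsilon>^2"
    and T21: "measure_pmf.expectation D (\<lambda>\<omega>. (\<Sum>k\<in>I. G2 k \<omega> * fst (\<Delta> k \<omega>))^2) \<le> \<epsilon>^2"
    and T22: "measure_pmf.expectation D (\<lambda>\<omega>. (1 - (\<Sum>k\<in>I. G2 k \<omega> * snd (\<Delta> k \<omega>)))^2) \<le> \<epsilon>^2"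
    and R1: "(\<Sum>k\<in>I. measure_pmf.expectation D (\<lambda>\<omega>. \<bar>G1 k \<omega>\<bar> * (\<bar>fst (\<Delta> k \<omega>)\<bar> + \<bar>snd (\<Delta> k \<omega>)\<bar>)^2)) \<le> \<epsilon>^2"
    and R2: "(\<Sum>k\<in>I. measure_pmf.expectation D (\<lambda>\<omega>. \<bar>G2 k \<omega>\<bar> * (\<bar>fst (\<Delta> k \<omega>)\<bar> + \<bar>snd (\<Delta> k \<omega>)\<bar>)^2)) \<le> \<epsilon>^2"
begin

abbreviation E :: "('a \<Rightarrow> real) \<Rightarrow> real" where "E f \<equiv> measure_pmf.expectation D f"

lemma int: "integrable D (h :: 'a \<Rightarrow> real)"
  using fin by (rule integrable_measure_pmf_finite)

lemma E_sum: "E (\<lambda>\<omega>. \<Sum>k\<in>I. f k \<omega>) = (\<Sum>k\<in>I. E (f k))"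
  by (rule Bochner_Integration.integral_sum) (rule int)

lemma taylor_coupling:
  assumes A: "A \<in> sets borel" and s: "0 < s" and ij: "i + j = 1"
    and R: "(\<Sum>k\<in>I. E (\<lambda>\<omega>. \<bar>G k \<omega>\<bar> * (\<bar>fst (\<Delta> k \<omega>)\<bar> + \<bar>snd (\<Delta> k \<omega>)\<bar>)^2)) \<le> \<epsilon>^2"
  shows "\<bar>(\<Sum>k\<in>I. E (\<lambda>\<omega>. G k \<omega> * (smoothed A i j s (c *\<^sub>R W \<omega>) - smoothed A i j s (c *\<^sub>R (W \<omega> - \<Delta> k \<omega>)))))
    + c * (E (\<lambda>\<omega>. (\<Sum>k\<in>I. G k \<omega> * fst (\<Delta> k \<omega>)) * smoothed A (Suc i) j s (c *\<^sub>R W \<omega>))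
         + E (\<lambda>\<omega>. (\<Sum>k\<in>I. G k \<omega> * snd (\<Delta> k \<omega>)) * smoothed A i (Suc j) s (c *\<^sub>R W \<omega>)))\<bar>
    \<le> c^2 * (kernel_mass^2 / s^3) * \<epsilon>^2"
proof -
  let ?S = "\<lambda>i j \<omega>. smoothed A i j s (c *\<^sub>R W \<omega>)"
  let ?err = "\<lambda>k \<omega>. G k \<omega> * (?S i j \<omega> - smoothed A i j s (c *\<^sub>R (W \<omega> - \<Delta> k \<omega>))) + c * (G k \<omega> * fst (\<Delta> k \<omega>) * ?S (Suc i) j \<omega>) + c * (G k \<omega> * snd (\<Delta> k \<omega>) * ?S i (Suc j) \<omega>)"
  have EQ: "(\<Sum>k\<in>I. E (\<lambda>\<omega>. G k \<omega> * (?S i j \<omega> - smoothed A i j s (c *\<^sub>R (W \<omega> - \<Delta> k \<omega>)))))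
    + c * (E (\<lambda>\<omega>. (\<Sum>k\<in>I. G k \<omega> * fst (\<Delta> k \<omega>)) * ?S (Suc i) j \<omega>) + E (\<lambda>\<omega>. (\<Sum>k\<in>I. G k \<omega> * snd (\<Delta> k \<omega>)) * ?S i (Suc j) \<omega>))
    = (\<Sum>k\<in>I. E (?err k))"
    unfolding sum_distrib_right E_sum
    by (simp only: Bochner_Integration.integral_add[OF int int] integral_mult_right_zero sum.distrib sum_distrib_left distrib_left add.assoc)
  have "\<bar>\<Sum>k\<in>I. E (?err k)\<bar> \<le> (\<Sum>k\<in>I. \<bar>E (?err k)\<bar>)" by (rule sum_abs)
  also have "\<dots> \<le> (\<Sum>k\<in>I. E (\<lambda>\<omega>. (c^2 * (kernel_mass^2 / s^3)) * (\<bar>G k \<omega>\<bar> * (\<bar>fst (\<Delta> k \<omega>)\<bar> + \<bar>snd (\<Delta> k \<omega>)\<bar>)^2)))"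
  proof (intro sum_mono expectation_abs_le fin)
    fix k \<omega>
    let ?v = "c *\<^sub>R \<Delta> k \<omega>"
    have sc: "(\<bar>fst ?v\<bar> + \<bar>snd ?v\<bar>)^2 = c^2 * (\<bar>fst (\<Delta> k \<omega>)\<bar> + \<bar>snd (\<Delta> k \<omega>)\<bar>)^2"
    proof -
      have "\<bar>fst ?v\<bar> + \<bar>snd ?v\<bar> = \<bar>c\<bar> * (\<bar>fst (\<Delta> k \<omega>)\<bar> + \<bar>snd (\<Delta> k \<omega>)\<bar>)"
        by (simp add: abs_mult algebra_simps)
      then show ?thesis by (simp only: power_mult_distrib power2_abs)
    qed
    have "\<bar>?err k \<omega>\<bar> = \<bar>G k \<omega>\<bar> * \<bar>smoothed A i j s (c *\<^sub>R W \<omega> - ?v) - ?S i j \<omega> - fst ?v * ?S (Suc i) j \<omega> - snd ?v * ?S i (Suc j) \<omega>\<bar>"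
      unfolding abs_mult[symmetric] abs_minus_commute[of "?err k \<omega>"]
      by (subst abs_minus_cancel[symmetric]) (rule arg_cong[of _ _ abs], simp add: algebra_simps)
    also have "\<dots> \<le> \<bar>G k \<omega>\<bar> * ((\<bar>fst ?v\<bar> + \<bar>snd ?v\<bar>)^2 * (kernel_mass^2 / s ^ 3))"
      by (intro mult_left_mono smooth_taylor A s ij) auto
    also have "\<dots> = (c^2 * (kernel_mass^2 / s^3)) * (\<bar>G k \<omega>\<bar> * (\<bar>fst (\<Delta> k \<omega>)\<bar> + \<bar>snd (\<Delta> k \<omega>)\<bar>)^2)"
      unfolding sc by (simp only: ac_simps)
    finally show "\<bar>?err k \<omega>\<bar> \<le> (c^2 * (kernel_mass^2 / s^3)) * (\<bar>G k \<omega>\<bar> * (\<bar>fst (\<Delta> k \<omega>)\<bar> + \<bar>snd (\<Delta> k \<omega>)\<bar>)^2)" .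
  qed
  also have "\<dots> = (c^2 * (kernel_mass^2 / s^3)) * (\<Sum>k\<in>I. E (\<lambda>\<omega>. \<bar>G k \<omega>\<bar> * (\<bar>fst (\<Delta> k \<omega>)\<bar> + \<bar>snd (\<Delta> k \<omega>)\<bar>)^2))"
    by (simp only: integral_mult_right_zero sum_distrib_left)
  also have "\<dots> \<le> c^2 * (kernel_mass^2 / s^3) * \<epsilon>^2"
    using R s by (intro mult_left_mono) auto
  finally show ?thesis unfolding EQ .
qed

abbreviation \<kappa> :: real where "\<kappa> \<equiv> convex_gap D W"

text \<open>
  The Laplacian term of the velocity cancels against the expectation of \<open>W \<bullet> \<nabla>\<close>, up to the fluctuation of the
  random covariance matrix, paired with second derivatives, and the Taylor remainder, paired with third derivatives.
\<close>

lemma expectation_smooth_velocity: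
  assumes A[measurable]: "A \<in> sets borel" "convex A" and s: "0 < sin t" and c: "0 \<le> cos t"
  shows "\<bar>E (\<lambda>\<omega>. smooth_velocity A (W \<omega>) t)\<bar>
    \<le> kernel_mass^2 * (cos t * (8 * \<epsilon> * sqrt \<kappa> / sin t + 12 * \<epsilon> / sqrt (sin t) + 2 * \<epsilon>^2 / (sin t)^2))"
proof -
  let ?s = "sin t" and ?c = "cos t"
  let ?S = "\<lambda>i j \<omega>. smoothed A i j ?s (?c *\<^sub>R W \<omega>)"
  define t11 t12 t21 t22 where "t11 \<omega> = (\<Sum>k\<in>I. G1 k \<omega> * fst (\<Delta> k \<omega>))" and "t12 \<omega> = (\<Sum>k\<in>I. G1 k \<omega> * snd (\<Delta> k \<omega>))"
    and "t21 \<omega> = (\<Sum>k\<in>I. G2 k \<omega> * fst (\<Delta> k \<omega>))" and "t22 \<omega> = (\<Sum>k\<in>I. G2 k \<omega> * snd (\<Delta> k \<omega>))" for \<omega>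
  have c1: "?c \<le> 1" and sc: "?s^2 + ?c^2 = 1" by (auto simp: sin_cos_squared_add)
  define b where "b = kernel_mass^2 / ?s^2 * sqrt (4 * \<kappa> + 8 * ?s)"
  have b: "0 < b" unfolding b_def using s kernel_mass_ge(3) convex_gap_nonneg[of D W]
    by (intro mult_pos_pos divide_pos_pos) (auto intro: add_nonneg_pos)
  have sq: "E (\<lambda>\<omega>. (?S i j \<omega>)^2) \<le> b^2" if "i + j = 2" for i j
    unfolding b_def by (rule expectation_smooth_square[OF A fin s c sc that])
  have m11: "\<bar>E (\<lambda>\<omega>. (1 - t11 \<omega>) * ?S 2 0 \<omega>)\<bar> \<le> \<epsilon> * b"
    by (intro pmf_abs_product_le fin eps b sq) (use T11 in \<open>simp_all add: t11_def\<close>)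
  have m12: "\<bar>E (\<lambda>\<omega>. t12 \<omega> * ?S 1 1 \<omega>)\<bar> \<le> \<epsilon> * b"
    by (intro pmf_abs_product_le fin eps b sq) (use T12 in \<open>simp_all add: t12_def\<close>)
  have m21: "\<bar>E (\<lambda>\<omega>. t21 \<omega> * ?S 1 1 \<omega>)\<bar> \<le> \<epsilon> * b"
    by (intro pmf_abs_product_le fin eps b sq) (use T21 in \<open>simp_all add: t21_def\<close>)
  have m22: "\<bar>E (\<lambda>\<omega>. (1 - t22 \<omega>) * ?S 0 2 \<omega>)\<bar> \<le> \<epsilon> * b"
    by (intro pmf_abs_product_le fin eps b sq) (use T22 in \<open>simp_all add: t22_def\<close>)
  define e1 e2 where "e1 = E (\<lambda>\<omega>. fst (W \<omega>) * ?S 1 0 \<omega>) + ?c * (E (\<lambda>\<omega>. t11 \<omega> * ?S 2 0 \<omega>) + E (\<lambda>\<omega>. t12 \<omega> * ?S 1 1 \<omega>))"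
    and "e2 = E (\<lambda>\<omega>. snd (W \<omega>) * ?S 0 1 \<omega>) + ?c * (E (\<lambda>\<omega>. t21 \<omega> * ?S 1 1 \<omega>) + E (\<lambda>\<omega>. t22 \<omega> * ?S 0 2 \<omega>))"
  have e1: "\<bar>e1\<bar> \<le> ?c^2 * (kernel_mass^2 / ?s^3) * \<epsilon>^2"
    using taylor_coupling[OF A(1) s _ R1, of 1 0 ?c] coupling1[of "\<lambda>w. smoothed A 1 0 ?s (?c *\<^sub>R w)"]
    unfolding e1_def t11_def t12_def by (simp add: numeral_2_eq_2)
  have e2: "\<bar>e2\<bar> \<le> ?c^2 * (kernel_mass^2 / ?s^3) * \<epsilon>^2"
    using taylor_coupling[OF A(1) s _ R2, of 0 1 ?c] coupling2[of "\<lambda>w. smoothed A 0 1 ?s (?c *\<^sub>R w)"]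
    unfolding e2_def t21_def t22_def by (simp add: numeral_2_eq_2)
  have Jeq: "E (\<lambda>\<omega>. smooth_velocity A (W \<omega>) t) = ?s * ?c * (E (?S 2 0) + E (?S 0 2))
      + ?s * (E (\<lambda>\<omega>. fst (W \<omega>) * ?S 1 0 \<omega>) + E (\<lambda>\<omega>. snd (W \<omega>) * ?S 0 1 \<omega>))"
    unfolding smooth_velocity_def
    by (simp only: Bochner_Integration.integral_add[OF int int] integral_mult_right_zero)
  have d: "E (\<lambda>\<omega>. (1 - f \<omega>) * g \<omega>) = E g - E (\<lambda>\<omega>. f \<omega> * g \<omega>)" for f g :: "'a \<Rightarrow> real"
    by (simp only: left_diff_distrib mult_1 Bochner_Integration.integral_diff[OF int int])
  have EQ: "E (\<lambda>\<omega>. smooth_velocity A (W \<omega>) t) = ?s * ?c * (E (\<lambda>\<omega>. (1 - t11 \<omega>) * ?S 2 0 \<omega>) - E (\<lambda>\<omega>. t12 \<omega> * ?S 1 1 \<omega>)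
      - E (\<lambda>\<omega>. t21 \<omega> * ?S 1 1 \<omega>) + E (\<lambda>\<omega>. (1 - t22 \<omega>) * ?S 0 2 \<omega>)) + ?s * (e1 + e2)"
    unfolding Jeq e1_def e2_def d by (simp add: algebra_simps)
  have "\<bar>E (\<lambda>\<omega>. smooth_velocity A (W \<omega>) t)\<bar> \<le> \<bar>?s * ?c * (E (\<lambda>\<omega>. (1 - t11 \<omega>) * ?S 2 0 \<omega>) - E (\<lambda>\<omega>. t12 \<omega> * ?S 1 1 \<omega>)
      - E (\<lambda>\<omega>. t21 \<omega> * ?S 1 1 \<omega>) + E (\<lambda>\<omega>. (1 - t22 \<omega>) * ?S 0 2 \<omega>))\<bar> + \<bar>?s * (e1 + e2)\<bar>"
    unfolding EQ by (rule abs_triangle_ineq)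
  also have "\<dots> \<le> ?s * ?c * (4 * (\<epsilon> * b)) + ?s * (2 * (?c^2 * (kernel_mass^2 / ?s^3) * \<epsilon>^2))"
  proof (rule add_mono)
    show "\<bar>?s * ?c * (E (\<lambda>\<omega>. (1 - t11 \<omega>) * ?S 2 0 \<omega>) - E (\<lambda>\<omega>. t12 \<omega> * ?S 1 1 \<omega>)
      - E (\<lambda>\<omega>. t21 \<omega> * ?S 1 1 \<omega>) + E (\<lambda>\<omega>. (1 - t22 \<omega>) * ?S 0 2 \<omega>))\<bar> \<le> ?s * ?c * (4 * (\<epsilon> * b))"
      unfolding abs_mult[of "?s * ?c"] using s c m11 m12 m21 m22 by (simp add: abs_mult) (intro mult_left_mono, linarith, simp)
    show "\<bar>?s * (e1 + e2)\<bar> \<le> ?s * (2 * (?c^2 * (kernel_mass^2 / ?s^3) * \<epsilon>^2))"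
      unfolding abs_mult using s e1 e2 by (simp only: abs_of_pos) (intro mult_left_mono, linarith, simp)
  qed
  also have "\<dots> = ?c * kernel_mass^2 * (4 * \<epsilon> * sqrt (4 * \<kappa> + 8 * ?s) / ?s + 2 * ?c * \<epsilon>^2 / ?s^2)"
    unfolding b_def using s by (simp add: field_simps power2_eq_square power3_eq_cube)
  also have "\<dots> \<le> ?c * kernel_mass^2 * (4 * \<epsilon> * (2 * sqrt \<kappa> + 3 * sqrt ?s) / ?s + 2 * 1 * \<epsilon>^2 / ?s^2)"
  proof -
    have "sqrt (4 * \<kappa> + 8 * ?s) \<le> sqrt (4 * \<kappa>) + sqrt (8 * ?s)"
      using convex_gap_nonneg[of D W] s by (intro sqrt_add_le_add_sqrt) auto
    also have "sqrt (4 * \<kappa>) = 2 * sqrt \<kappa>" by (simp add: real_sqrt_mult)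
    also have "sqrt (8 * ?s) \<le> sqrt (9 * ?s)" using s by simp
    also have "sqrt (9 * ?s) = 3 * sqrt ?s" by (simp add: real_sqrt_mult)
    finally have "sqrt (4 * \<kappa> + 8 * ?s) \<le> 2 * sqrt \<kappa> + 3 * sqrt ?s" by simp
    then show ?thesis
      using s c c1 eps by (intro mult_left_mono add_mono divide_right_mono mult_right_mono) auto
  qed
  also have "\<dots> = kernel_mass^2 * (?c * (8 * \<epsilon> * sqrt \<kappa> / ?s + 12 * \<epsilon> * (sqrt ?s / ?s) + 2 * \<epsilon>^2 / ?s^2))"
    using s by (simp add: field_simps)
  also have "sqrt ?s / ?s = 1 / sqrt ?s"
    using s by (simp add: real_div_sqrt field_simps)
  finally show ?thesis by simp
qed

end

section \<open>Removing the smoothing\<close>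

lemma gauss_eq_smooth:
  assumes [measurable]: "A \<in> sets borel"
  shows "gauss A = smoothed A 0 0 1 0"
proof -
  have D: "std_bivariate_normal = density lborel (\<lambda>y. ennreal (kernel 0 0 1 y))"
    by (simp add: std_bivariate_normal_def kernel_def split_beta')
  have "(\<integral>y. indicator A y \<partial>density lborel (\<lambda>y. ennreal (kernel 0 0 1 y))) = (\<integral>y. kernel 0 0 1 y * indicator A y \<partial>lborel)"
    by (rule integral_real_density) (auto simp: kernel_def)
  then show ?thesis
    unfolding D smoothed_def by (simp add: mult.commute)
qed

lemma kernel_nonneg: "0 \<le> kernel 0 0 s u"
  by (simp add: kernel_def)

lemma conv_dnormal:
  assumes "0 < s" "0 < c" "s^2 + c^2 = 1"
  shows "integrable lborel (\<lambda>u. dnormal 0 s u * dnormal 0 c (y - u))"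
    "(\<integral>u. dnormal 0 s u * dnormal 0 c (y - u) \<partial>lborel) = dnormal 0 1 y"
proof -
  have "(\<integral>\<^sup>+u. ennreal (normal_density 0 c (y - u) * normal_density 0 s u) \<partial>lborel) = normal_density 0 (sqrt (c\<^sup>2 + s\<^sup>2)) y"
    using fun_cong[OF conv_normal_density_zero_mean[OF assms(2,1)], of y] by simp
  then have "(\<integral>\<^sup>+u. ennreal (dnormal 0 s u * dnormal 0 c (y - u)) \<partial>lborel) = ennreal (dnormal 0 1 y)"
    using assms(3) by (simp add: add.commute mult.commute)
  then have "has_bochner_integral lborel (\<lambda>u. dnormal 0 s u * dnormal 0 c (y - u)) (dnormal 0 1 y)"
    by (intro has_bochner_integral_nn_integral) (auto intro!: AE_I2)
  then show "integrable lborel (\<lambda>u. dnormal 0 s u * dnormal 0 c (y - u))"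
    "(\<integral>u. dnormal 0 s u * dnormal 0 c (y - u) \<partial>lborel) = dnormal 0 1 y"
    by (auto simp: has_bochner_integral_iff)
qed

text \<open>
  The law of \<open>s Z + c Z'\<close> is standard normal when \<open>s\<^sup>2 + c\<^sup>2 = 1\<close>.
\<close>

lemma conv_kernel:
  assumes "0 < s" "0 < c" "s^2 + c^2 = 1"
  shows "(\<integral>\<^sup>+u. ennreal (kernel 0 0 s u * kernel 0 0 c (y - u)) \<partial>lborel) = ennreal (kernel 0 0 1 y)"
proof -
  have e: "kernel 0 0 s u * kernel 0 0 c (y - u) = (dnormal 0 s (fst u) * dnormal 0 c (fst y - fst u)) * (dnormal 0 s (snd u) * dnormal 0 c (snd y - snd u))" for u
    by (simp add: kernel_def)
  note I = product_integral[OF conv_dnormal(1)[OF assms, of "fst y"] conv_dnormal(1)[OF assms, of "snd y"]]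
  have "(\<integral>\<^sup>+u. ennreal (kernel 0 0 s u * kernel 0 0 c (y - u)) \<partial>lborel) = ennreal (\<integral>u. kernel 0 0 s u * kernel 0 0 c (y - u) \<partial>lborel)"
    unfolding e by (rule nn_integral_eq_integral[OF I(1)]) auto
  also have "(\<integral>u. kernel 0 0 s u * kernel 0 0 c (y - u) \<partial>lborel) = kernel 0 0 1 y"
    unfolding e I(2) conv_dnormal(2)[OF assms] by (simp only: kernel_def)
  finally show ?thesis .
qed

lemma gauss_scale:
  assumes [measurable]: "B \<in> sets borel" and c: "0 < c"
  shows "ennreal (gauss {w. c *\<^sub>R w + u \<in> B}) = (\<integral>\<^sup>+y. indicator B y * ennreal (kernel 0 0 c (y - u)) \<partial>lborel)"
proof -
  have sc: "kernel 0 0 c (c *\<^sub>R w) = kernel 0 0 1 w / c^2" for w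
    using dnormal_scale[OF c, of 0 "c * fst w"] dnormal_scale[OF c, of 0 "c * snd w"] c
    by (simp add: kernel_def power2_eq_square)
  have l: "lborel = density (distr lborel borel (\<lambda>x::real\<times>real. u + c *\<^sub>R x)) (\<lambda>_. ennreal (c^2))"
    using lborel_affine[of c u] c by (simp add: power2_eq_square)
  have "(\<integral>\<^sup>+y. indicator B y * ennreal (kernel 0 0 c (y - u)) \<partial>lborel)
    = (\<integral>\<^sup>+y. ennreal (c^2) * (indicator B y * ennreal (kernel 0 0 c (y - u))) \<partial>distr lborel borel (\<lambda>x. u + c *\<^sub>R x))"
    by (subst l, subst nn_integral_density) auto
  also have "\<dots> = (\<integral>\<^sup>+w. ennreal (c^2) * (indicator B (u + c *\<^sub>R w) * ennreal (kernel 0 0 c (u + c *\<^sub>R w - u))) \<partial>lborel)"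
    by (rule nn_integral_distr) auto
  also have "\<dots> = (\<integral>\<^sup>+w. ennreal (kernel 0 0 1 w) * indicator {w. c *\<^sub>R w + u \<in> B} w \<partial>lborel)"
  proof (intro nn_integral_cong)
    fix w
    have "ennreal (c^2) * ennreal (kernel 0 0 c (c *\<^sub>R w)) = ennreal (kernel 0 0 1 w)"
      unfolding sc using c by (subst ennreal_mult[symmetric]) (auto simp: kernel_nonneg)
    then show "ennreal (c^2) * (indicator B (u + c *\<^sub>R w) * ennreal (kernel 0 0 c (u + c *\<^sub>R w - u)))
      = ennreal (kernel 0 0 1 w) * indicator {w. c *\<^sub>R w + u \<in> B} w"
      by (auto simp: indicator_def add.commute)
  qed
  also have "\<dots> = emeasure (density lborel (\<lambda>w. ennreal (kernel 0 0 1 w))) {w. c *\<^sub>R w + u \<in> B}"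
    by (rule emeasure_density[symmetric]) (auto intro!: borel_scale_shift)
  also have "density lborel (\<lambda>w. ennreal (kernel 0 0 1 w)) = std_bivariate_normal"
    by (simp add: std_bivariate_normal_def kernel_def split_beta')
  finally show ?thesis by (simp add: gauss.emeasure_eq_measure)
qed

lemma gauss_measurable_shift:
  assumes [measurable]: "B \<in> sets borel" and c: "0 < c"
  shows "(\<lambda>u. gauss {w. c *\<^sub>R w + u \<in> B}) \<in> borel_measurable borel"
proof -
  have "(\<lambda>u. ennreal (gauss {w. c *\<^sub>R w + u \<in> B})) \<in> borel_measurable borel"
    unfolding gauss_scale[OF assms] by measurable
  then have "(\<lambda>u. enn2real (ennreal (gauss {w. c *\<^sub>R w + u \<in> B}))) \<in> borel_measurable borel"
    by (rule borel_measurable_enn2real)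
  then show ?thesis by simp
qed

lemma gauss_average:
  assumes B[measurable]: "B \<in> sets borel" and sc: "0 < s" "0 < c" "s^2 + c^2 = 1"
  shows "integrable lborel (\<lambda>u. kernel 0 0 s u * gauss {w. c *\<^sub>R w + u \<in> B})"
    "(\<integral>u. kernel 0 0 s u * gauss {w. c *\<^sub>R w + u \<in> B} \<partial>lborel) = gauss B"
proof -
  note [measurable] = gauss_measurable_shift[OF B sc(2)]
  have "(\<integral>\<^sup>+u. ennreal (kernel 0 0 s u * gauss {w. c *\<^sub>R w + u \<in> B}) \<partial>lborel)
     = (\<integral>\<^sup>+u. (\<integral>\<^sup>+y. indicator B y * ennreal (kernel 0 0 s u * kernel 0 0 c (y - u)) \<partial>lborel) \<partial>lborel)"
  proof (intro nn_integral_cong)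
    fix u
    have "ennreal (kernel 0 0 s u * gauss {w. c *\<^sub>R w + u \<in> B}) = ennreal (kernel 0 0 s u) * (\<integral>\<^sup>+y. indicator B y * ennreal (kernel 0 0 c (y - u)) \<partial>lborel)"
      by (subst ennreal_mult) (simp_all add: kernel_nonneg gauss_scale[OF B sc(2)])
    also have "\<dots> = (\<integral>\<^sup>+y. ennreal (kernel 0 0 s u) * (indicator B y * ennreal (kernel 0 0 c (y - u))) \<partial>lborel)"
      by (rule nn_integral_cmult[symmetric]) measurable
    also have "\<dots> = (\<integral>\<^sup>+y. indicator B y * ennreal (kernel 0 0 s u * kernel 0 0 c (y - u)) \<partial>lborel)"
      by (intro nn_integral_cong) (simp add: ennreal_mult kernel_nonneg ac_simps)
    finally show "ennreal (kernel 0 0 s u * gauss {w. c *\<^sub>R w + u \<in> B}) = (\<integral>\<^sup>+y. indicator B y * ennreal (kernel 0 0 s u * kernel 0 0 c (y - u)) \<partial>lborel)" .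
  qed
  also have "\<dots> = (\<integral>\<^sup>+y. (\<integral>\<^sup>+u. indicator B y * ennreal (kernel 0 0 s u * kernel 0 0 c (y - u)) \<partial>lborel) \<partial>lborel)"
    by (rule lborel_pair.Fubini') (simp add: split_beta')
  also have "\<dots> = (\<integral>\<^sup>+y. indicator B y * ennreal (kernel 0 0 1 y) \<partial>lborel)"
    by (intro nn_integral_cong) (simp add: nn_integral_cmult conv_kernel[OF sc])
  also have "\<dots> = (\<integral>\<^sup>+y. ennreal (indicator B (0 + y) * kernel 0 0 1 y) \<partial>lborel)"
    by (intro nn_integral_cong) (simp add: indicator_def)
  also have "\<dots> = ennreal (gauss B)"
    unfolding gauss_eq_smooth[OF B] smoothed_def
    by (rule nn_integral_eq_integral[OF smooth_integrable[OF B]]) (auto simp: kernel_nonneg)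
  finally have "has_bochner_integral lborel (\<lambda>u. kernel 0 0 s u * gauss {w. c *\<^sub>R w + u \<in> B}) (gauss B)"
    by (intro has_bochner_integral_nn_integral) (auto simp: kernel_nonneg)
  then show "integrable lborel (\<lambda>u. kernel 0 0 s u * gauss {w. c *\<^sub>R w + u \<in> B})"
    "(\<integral>u. kernel 0 0 s u * gauss {w. c *\<^sub>R w + u \<in> B} \<partial>lborel) = gauss B"
    by (auto simp: has_bochner_integral_iff)
qed

text \<open>
  Neighbourhoods are balls of the \<open>l\<^sup>1\<close> norm: they have four vertices, so being surrounded by such a ball
  is a condition on four translates only.
\<close>

definition diamond :: "real \<Rightarrow> (real \<times> real) set" where
  "diamond r = {v. \<bar>fst v\<bar> + \<bar>snd v\<bar> \<le> r}"

definition diamond_vertices :: "real \<Rightarrow> (real \<times> real) set" where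
  "diamond_vertices r = {(r, 0), (- r, 0), (0, r), (0, - r)}"

lemma convex_diamond_subset:
  assumes S: "convex S" and y: "\<And>v. v \<in> diamond_vertices r \<Longrightarrow> y + v \<in> S" and z: "z \<in> diamond r"
  shows "y + z \<in> S"
proof -
  obtain z1 z2 where zz: "z = (z1, z2)" by (cases z)
  define t where "t = \<bar>z1\<bar> + \<bar>z2\<bar>"
  have t: "0 \<le> t" "t \<le> r" using z by (auto simp: t_def zz diamond_def)
  have yS: "y \<in> S"
  proof -
    have "(1/2) *\<^sub>R (y + (r, 0)) + (1/2) *\<^sub>R (y + (- r, 0)) \<in> S"
      by (rule convexD[OF S]) (auto intro!: y simp: diamond_vertices_def)
    also have "(1/2) *\<^sub>R (y + (r, 0)) + (1/2) *\<^sub>R (y + (- r, 0)) = y"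
      by (cases y) (simp add: field_simps)
    finally show ?thesis .
  qed
  show ?thesis
  proof (cases "t = 0")
    case True
    then have "z = 0" by (auto simp: t_def zz zero_prod_def)
    then show ?thesis using yS by simp
  next
    case False
    with t have tr: "0 < t" "0 < r" by auto
    let ?P1 = "y + (sgn z1 * r, 0)" and ?P2 = "y + (0, sgn z2 * r)"
    have P1: "?P1 \<in> S" using y[of "(r, 0)"] y[of "(- r, 0)"] yS by (auto simp: sgn_if diamond_vertices_def zero_prod_def[symmetric])
    have P2: "?P2 \<in> S" using y[of "(0, r)"] y[of "(0, - r)"] yS by (auto simp: sgn_if diamond_vertices_def zero_prod_def[symmetric])
    let ?Q = "(\<bar>z1\<bar> / t) *\<^sub>R ?P1 + (\<bar>z2\<bar> / t) *\<^sub>R ?P2"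
    define q where "q = ?Q"
    have Q: "q \<in> S" unfolding q_def
      by (rule convexD[OF S P1 P2]) (use tr in \<open>auto simp: t_def add_divide_distrib[symmetric]\<close>)
    have "(1 - t / r) *\<^sub>R y + (t / r) *\<^sub>R q \<in> S"
      by (rule convexD[OF S yS Q]) (use t tr in \<open>auto simp: field_simps\<close>)
    also have "(1 - t / r) *\<^sub>R y + (t / r) *\<^sub>R q = y + z"
    proof -
      obtain y1 y2 where yy: "y = (y1, y2)" by (cases y)
      have Q1: "fst q = y1 + z1 * r / t"
      proof -
        have "\<bar>z1\<bar> / t * (y1 + sgn z1 * r) + \<bar>z2\<bar> / t * y1 = (\<bar>z1\<bar> + \<bar>z2\<bar>) / t * y1 + (\<bar>z1\<bar> * sgn z1) * r / t"
          using tr by (simp add: divide_simps) (simp add: algebra_simps)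
        then show ?thesis using tr by (simp add: q_def yy t_def[symmetric] abs_mult_sgn)
      qed
      have Q2: "snd q = y2 + z2 * r / t"
      proof -
        have "\<bar>z1\<bar> / t * y2 + \<bar>z2\<bar> / t * (y2 + sgn z2 * r) = (\<bar>z1\<bar> + \<bar>z2\<bar>) / t * y2 + (\<bar>z2\<bar> * sgn z2) * r / t"
          using tr by (simp add: divide_simps) (simp add: algebra_simps)
        then show ?thesis using tr by (simp add: q_def yy t_def[symmetric] abs_mult_sgn)
      qed
      show ?thesis
        by (rule prod_eqI) (use tr in \<open>simp_all only: fst_add snd_add fst_scaleR snd_scaleR Q1 Q2 yy zz fst_conv snd_conv real_scaleR_def\<close>, simp_all add: field_simps)
    qed
    finally show ?thesis .
  qed
qed

text \<open>
  A point of \<open>A\<close> is lost only if one of four translations leads out of \<open>A\<close>.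
\<close>

lemma gauss_inner:
  assumes A[measurable]: "A \<in> sets borel" "convex A" and r: "0 \<le> r"
  shows "gauss A \<le> gauss {w \<in> A. \<forall>v\<in>diamond_vertices r. w + v \<in> A} + 4 * r"
proof -
  let ?I = "{w \<in> A. \<forall>v\<in>diamond_vertices r. w + v \<in> A}" and ?X = "\<lambda>v. {w \<in> A. w + v \<notin> A}"
  have [measurable]: "?X v \<in> sets borel" for v by measurable
  have [measurable]: "?I \<in> sets borel"
    unfolding diamond_vertices_def by simp
  have b: "gauss (?X v) \<le> r" if "v \<in> diamond_vertices r" for v
    using gauss_exit[OF A, of v] that r by (auto simp: diamond_vertices_def)
  have "gauss A \<le> gauss (?I \<union> (?X (r, 0) \<union> (?X (- r, 0) \<union> (?X (0, r) \<union> ?X (0, - r)))))"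
    by (rule gauss.finite_measure_mono) (auto simp: diamond_vertices_def)
  also have "\<dots> \<le> gauss ?I + (gauss (?X (r, 0)) + (gauss (?X (- r, 0)) + (gauss (?X (0, r)) + gauss (?X (0, - r)))))"
    by (intro order_trans[OF measure_Un_le] add_left_mono) (auto intro!: order_trans[OF measure_Un_le] add_left_mono)
  also have "\<dots> \<le> gauss ?I + (r + (r + (r + r)))"
    by (intro add_left_mono add_mono b) (auto simp: diamond_vertices_def)
  finally show ?thesis by simp
qed

lemma compact_diamond: "compact (diamond r)"
proof -
  have "closed (diamond r)"
    unfolding diamond_def by (intro closed_Collect_le continuous_intros)
  moreover have "bounded (diamond r)"
  proof (rule boundedI)
    fix x assume "x \<in> diamond r"
    then have "\<bar>fst x\<bar> + \<bar>snd x\<bar> \<le> r" by (simp add: diamond_def)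
    moreover have "norm x \<le> norm (fst x) + norm (snd x)"
      unfolding norm_prod_def by (rule sqrt_sum_squares_le_sum) auto
    ultimately show "norm x \<le> r" by simp
  qed
  ultimately show ?thesis by (simp add: compact_eq_bounded_closed)
qed

lemma convex_diamond: "convex (diamond r)"
proof (rule convexI)
  fix x y :: "real \<times> real" and a b :: real
  assume *: "x \<in> diamond r" "y \<in> diamond r" "0 \<le> a" "0 \<le> b" "a + b = 1"
  have "\<bar>a * fst x + b * fst y\<bar> + \<bar>a * snd x + b * snd y\<bar> \<le> (a * \<bar>fst x\<bar> + b * \<bar>fst y\<bar>) + (a * \<bar>snd x\<bar> + b * \<bar>snd y\<bar>)"
    using *(3,4) by (intro add_mono order_trans[OF abs_triangle_ineq]) (auto simp: abs_mult)
  also have "\<dots> = a * (\<bar>fst x\<bar> + \<bar>snd x\<bar>) + b * (\<bar>fst y\<bar> + \<bar>snd y\<bar>)" by (simp add: algebra_simps)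
  also have "\<dots> \<le> a * r + b * r" using * by (intro add_mono mult_left_mono) (auto simp: diamond_def)
  also have "\<dots> = r" using *(5) by (simp add: distrib_right[symmetric])
  finally show "a *\<^sub>R x + b *\<^sub>R y \<in> diamond r" by (simp add: diamond_def)
qed

text \<open>
  Thickening \<open>A\<close> by a ball and then shrinking it by a larger one gives nothing outside \<open>A\<close>: a functional that
  separates \<open>w\<close> from \<open>A\<close> attains its minimum over a ball at a vertex, and the vertex of the larger ball outweighs
  both \<open>z\<close> and \<open>u\<close>. Thereby the bound for shrunken sets also serves for thickened ones.
\<close>

lemma thickening_inner:
  fixes A :: "(real \<times> real) set"
  assumes A: "convex A" "compact A" and r: "0 \<le> r" and c: "0 < c" and u: "u \<in> diamond r"
    and w: "\<And>v. v \<in> diamond_vertices (2 * r / c) \<Longrightarrow> \<exists>x\<in>A. \<exists>z\<in>diamond r. c *\<^sub>R (w + v) + u = c *\<^sub>R x + z"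
  shows "w \<in> A"
proof (rule ccontr)
  assume "w \<notin> A"
  then obtain a b where ab: "inner a w < b" "\<And>x. x \<in> A \<Longrightarrow> b < inner a x"
    using separating_hyperplane_closed_point[OF A(1) compact_imp_closed[OF A(2)]] by metis
  obtain a1 a2 where aa: "a = (a1, a2)" by (cases a)
  define m where "m = max \<bar>a1\<bar> \<bar>a2\<bar>"
  have din: "\<bar>inner a z\<bar> \<le> r * m" if "z \<in> diamond r" for z
  proof -
    have "\<bar>inner a z\<bar> \<le> \<bar>a1\<bar> * \<bar>fst z\<bar> + \<bar>a2\<bar> * \<bar>snd z\<bar>"
      by (cases z) (auto simp: aa abs_mult[symmetric])
    also have "\<dots> \<le> m * \<bar>fst z\<bar> + m * \<bar>snd z\<bar>" by (intro add_mono mult_right_mono) (auto simp: m_def)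
    also have "\<dots> = m * (\<bar>fst z\<bar> + \<bar>snd z\<bar>)" by (simp add: algebra_simps)
    also have "\<dots> \<le> m * r" using that by (intro mult_left_mono) (auto simp: m_def diamond_def)
    finally show ?thesis by (simp add: mult.commute)
  qed
  \<comment> \<open>The vertex of the larger ball at which the separating functional is smallest.\<close>
  obtain v where v: "v \<in> diamond_vertices (2 * r / c)" "inner a v = - (2 * r / c * m)"
  proof -
    consider "m = a1" | "m = - a1" | "m = a2" | "m = - a2" unfolding m_def by linarith
    then show ?thesis
    proof cases
      case 1 then show ?thesis by (intro that[of "(- (2 * r / c), 0)"]) (auto simp: aa diamond_vertices_def)
    next
      case 2 then show ?thesis by (intro that[of "(2 * r / c, 0)"]) (auto simp: aa diamond_vertices_def)
    next
      case 3 then show ?thesis by (intro that[of "(0, - (2 * r / c))"]) (auto simp: aa diamond_vertices_def)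
    next
      case 4 then show ?thesis by (intro that[of "(0, 2 * r / c)"]) (auto simp: aa diamond_vertices_def)
    qed
  qed
  from w[OF v(1)] obtain x z where xz: "x \<in> A" "z \<in> diamond r" "c *\<^sub>R (w + v) + u = c *\<^sub>R x + z" by auto
  have "inner a (c *\<^sub>R (w + v) + u) = inner a (c *\<^sub>R x + z)" using xz(3) by simp
  then have "c * inner a w + c * inner a v + inner a u = c * inner a x + inner a z"
    by (simp add: inner_add_right distrib_left)
  moreover have "c * inner a v = - 2 * (r * m)" using c v(2) by simp
  moreover have "c * inner a w < c * inner a x" using ab(1) ab(2)[OF xz(1)] c by simp
  ultimately show False using din[OF u] din[OF xz(2)] by linarith
qed

context stein_coupling
begin

lemma interpolation_bound:
  assumes A: "A \<in> sets borel" "convex A" and t0: "0 < t0" "t0 \<le> pi / 2"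
  shows "\<bar>E (\<lambda>\<omega>. smoothed A 0 0 (sin t0) (cos t0 *\<^sub>R W \<omega>)) - gauss A\<bar>
    \<le> kernel_mass^2 * (8 * \<epsilon> * sqrt \<kappa> * ln (1 / sin t0) + 24 * \<epsilon> + 2 * \<epsilon>^2 * (1 / sin t0))"
proof -
  let ?J = "\<lambda>\<omega> t. indicator {t0..pi/2} t * smooth_velocity A (W \<omega>) t"
  note SI = smooth_interpolation[OF A(1) t0]
  have s0: "0 < sin t0" using sin_pos_halfpi[OF t0(1) order_refl t0(2)] .
  have sum: "(\<Sum>\<omega>\<in>set_pmf D. f \<omega> * pmf D \<omega>) = E f" for f :: "'a \<Rightarrow> real"
    by (rule integral_measure_pmf_real[OF fin, symmetric])
  have "E (\<lambda>\<omega>. smoothed A 0 0 (sin t0) (cos t0 *\<^sub>R W \<omega>)) - gauss A = - E (\<lambda>\<omega>. gauss A - smoothed A 0 0 (sin t0) (cos t0 *\<^sub>R W \<omega>))"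
    by (simp add: Bochner_Integration.integral_diff[OF int int])
  also have "E (\<lambda>\<omega>. gauss A - smoothed A 0 0 (sin t0) (cos t0 *\<^sub>R W \<omega>)) = E (\<lambda>\<omega>. \<integral>t. ?J \<omega> t \<partial>lborel)"
    unfolding gauss_eq_smooth[OF A(1)] SI(2) ..
  also have "\<dots> = (\<integral>t. (\<Sum>\<omega>\<in>set_pmf D. ?J \<omega> t * pmf D \<omega>) \<partial>lborel)"
    unfolding sum[symmetric] by (subst Bochner_Integration.integral_sum) (auto intro!: integrable_mult_left SI(1))
  also have "\<dots> = (\<integral>t. indicator {t0..pi/2} t * E (\<lambda>\<omega>. smooth_velocity A (W \<omega>) t) \<partial>lborel)"
    unfolding sum by (simp only: integral_mult_right_zero)
  finally have EQ: "E (\<lambda>\<omega>. smoothed A 0 0 (sin t0) (cos t0 *\<^sub>R W \<omega>)) - gauss A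
      = - (\<integral>t. indicator {t0..pi/2} t * E (\<lambda>\<omega>. smooth_velocity A (W \<omega>) t) \<partial>lborel)" .
  have iJ: "integrable lborel (\<lambda>t. indicator {t0..pi/2} t * E (\<lambda>\<omega>. smooth_velocity A (W \<omega>) t))"
  proof -
    have "integrable lborel (\<lambda>t. \<Sum>\<omega>\<in>set_pmf D. ?J \<omega> t * pmf D \<omega>)"
      by (intro Bochner_Integration.integrable_sum integrable_mult_left SI(1))
    then show ?thesis unfolding sum by (simp only: integral_mult_right_zero)
  qed
  let ?g = "\<lambda>t. kernel_mass^2 * (indicator {t0..pi/2} t * (cos t * (8 * \<epsilon> * sqrt \<kappa> / sin t + 12 * \<epsilon> / sqrt (sin t) + 2 * \<epsilon>^2 / (sin t)^2)))"
  have g: "has_bochner_integral lborel ?g (kernel_mass^2 * (8 * \<epsilon> * sqrt \<kappa> * ln (1 / sin t0) + 2 * (12 * \<epsilon>) * (1 - sqrt (sin t0)) + 2 * \<epsilon>^2 * (1 / sin t0 - 1)))"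
    by (intro has_bochner_integral_mult_right path_bound_integral t0)
  have "\<bar>\<integral>t. indicator {t0..pi/2} t * E (\<lambda>\<omega>. smooth_velocity A (W \<omega>) t) \<partial>lborel\<bar> \<le> (\<integral>t. ?g t \<partial>lborel)"
  proof (rule integral_abs_bound_integral[OF iJ])
    show "integrable lborel ?g" using g by (simp add: has_bochner_integral_iff)
    fix t :: real
    show "\<bar>indicator {t0..pi/2} t * E (\<lambda>\<omega>. smooth_velocity A (W \<omega>) t)\<bar> \<le> ?g t"
    proof (cases "t \<in> {t0..pi/2}")
      case True
      then have "0 < sin t" "0 \<le> cos t" using t0 by (auto intro: sin_pos_halfpi cos_ge_zero)
      from expectation_smooth_velocity[OF A this] show ?thesis using True by simp
    qed simp
  qed
  also have "(\<integral>t. ?g t \<partial>lborel) = kernel_mass^2 * (8 * \<epsilon> * sqrt \<kappa> * ln (1 / sin t0) + 2 * (12 * \<epsilon>) * (1 - sqrt (sin t0)) + 2 * \<epsilon>^2 * (1 / sin t0 - 1))"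
    using g by (rule has_bochner_integral_integral_eq)
  also have "\<dots> \<le> kernel_mass^2 * (8 * \<epsilon> * sqrt \<kappa> * ln (1 / sin t0) + 24 * \<epsilon> + 2 * \<epsilon>^2 * (1 / sin t0))"
  proof (intro mult_left_mono add_mono order_refl)
    show "2 * (12 * \<epsilon>) * (1 - sqrt (sin t0)) \<le> 24 * \<epsilon>" using eps s0 by simp
  qed (use eps convex_gap_nonneg[of D W] in auto)
  finally show ?thesis unfolding EQ by simp
qed

text \<open>
  With probability at least \<open>3/4\<close> the smoothing noise \<open>u\<close> lies in the diamond, where the gap is at least \<open>y\<close>; elsewhere it is at
  least \<open>- \<kappa>\<close>. Averaging over the noise bounds \<open>3/4 y - 1/4 \<kappa>\<close> by the smoothed gap.
\<close>

lemma smoothed_gap: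
  assumes B[measurable]: "B \<in> sets borel" "convex B" and sc: "0 < s" "0 < c" "s^2 + c^2 = 1"
    and \<eta>: "\<bar>E (\<lambda>\<omega>. smoothed B 0 0 s (c *\<^sub>R W \<omega>)) - gauss B\<bar> \<le> \<eta>" and \<sigma>: "\<sigma> = 1 \<or> \<sigma> = -1"
    and y: "\<And>u. u \<in> diamond (8 * kernel_mass^2 * s) \<Longrightarrow>
      y \<le> \<sigma> * (measure_pmf.prob D {\<omega>. c *\<^sub>R W \<omega> + u \<in> B} - gauss {w. c *\<^sub>R w + u \<in> B})"
  shows "y \<le> (4 * \<eta> + \<kappa>) / 3"
proof (cases "0 \<le> y")
  case False
  have "0 \<le> \<eta>" using \<eta> by linarith
  then show ?thesis using False convex_gap_nonneg[of D W] by simp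
next
  case True
  let ?P = "\<lambda>u. measure_pmf.prob D {\<omega>. c *\<^sub>R W \<omega> + u \<in> B}" and ?g = "\<lambda>u. gauss {w. c *\<^sub>R w + u \<in> B}"
  define \<rho> where "\<rho> = 8 * kernel_mass^2 * s"
  have \<rho>: "0 < \<rho>" using sc kernel_mass_ge(3) by (simp add: \<rho>_def)
  have sum: "(\<Sum>\<omega>\<in>set_pmf D. f \<omega> * pmf D \<omega>) = E f" for f :: "'a \<Rightarrow> real"
    by (rule integral_measure_pmf_real[OF fin, symmetric])
  have KP: "(\<Sum>\<omega>\<in>set_pmf D. (indicator B (c *\<^sub>R W \<omega> + u) * kernel 0 0 s u) * pmf D \<omega>) = kernel 0 0 s u * ?P u" for u
    unfolding sum integral_mult_left_zero pmf_expectation_indicator by (rule mult.commute)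
  have iP: "integrable lborel (\<lambda>u. kernel 0 0 s u * ?P u)"
    unfolding KP[symmetric] by (intro Bochner_Integration.integrable_sum integrable_mult_left smooth_integrable B sc)
  have eP: "(\<integral>u. kernel 0 0 s u * ?P u \<partial>lborel) = E (\<lambda>\<omega>. smoothed B 0 0 s (c *\<^sub>R W \<omega>))"
    unfolding KP[symmetric] sum[symmetric] smoothed_def
    by (subst Bochner_Integration.integral_sum) (auto intro!: integrable_mult_left smooth_integrable B sc)
  note G = gauss_average[OF B(1) sc]
  note M = kernel_moment[OF sc(1), of 0 0, simplified]
  have M': "(\<integral>u. (\<bar>fst u\<bar> + \<bar>snd u\<bar>) * kernel 0 0 s u \<partial>lborel) \<le> 2 * kernel_mass^2 * s" "integrable lborel (\<lambda>u. (\<bar>fst u\<bar> + \<bar>snd u\<bar>) * kernel 0 0 s u)"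
    using M by (simp_all add: kernel_nonneg)
  have "y - (y + \<kappa>) / \<rho> * (2 * kernel_mass^2 * s) \<le> y * 1 - (y + \<kappa>) / \<rho> * (\<integral>u. (\<bar>fst u\<bar> + \<bar>snd u\<bar>) * kernel 0 0 s u \<partial>lborel)"
    using M'(1) True \<rho> convex_gap_nonneg[of D W] by (intro diff_mono mult_left_mono) auto
  also have "\<dots> = (\<integral>u. y * kernel 0 0 s u - (y + \<kappa>) / \<rho> * ((\<bar>fst u\<bar> + \<bar>snd u\<bar>) * kernel 0 0 s u) \<partial>lborel)"
    using kernel_integrable[OF sc(1), of 0 0] kernel_total(1)[OF sc(1)] M'(2) by simp
  also have "\<dots> \<le> (\<integral>u. \<sigma> * (kernel 0 0 s u * ?P u - kernel 0 0 s u * ?g u) \<partial>lborel)"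
  proof (rule integral_mono)
    show "integrable lborel (\<lambda>u. y * kernel 0 0 s u - (y + \<kappa>) / \<rho> * ((\<bar>fst u\<bar> + \<bar>snd u\<bar>) * kernel 0 0 s u))"
      by (intro Bochner_Integration.integrable_diff integrable_mult_right kernel_integrable sc M')
    show "integrable lborel (\<lambda>u. \<sigma> * (kernel 0 0 s u * ?P u - kernel 0 0 s u * ?g u))"
      by (intro Bochner_Integration.integrable_diff integrable_mult_right iP G)
    fix u :: "real \<times> real"
    \<comment> \<open>Markov style: the indicator of the complement of the diamond is at most the \<open>l\<^sup>1\<close> norm divided by \<open>\<rho>\<close>.\<close>
    have "y - (y + \<kappa>) / \<rho> * (\<bar>fst u\<bar> + \<bar>snd u\<bar>) \<le> \<sigma> * (?P u - ?g u)"
    proof (cases "u \<in> diamond \<rho>")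
      case True
      have "0 \<le> (y + \<kappa>) / \<rho> * (\<bar>fst u\<bar> + \<bar>snd u\<bar>)"
        using \<rho> \<open>0 \<le> y\<close> convex_gap_nonneg[of D W] by (intro mult_nonneg_nonneg divide_nonneg_nonneg) auto
      then show ?thesis using y[folded \<rho>_def, OF True] by linarith
    next
      case False
      then have "1 \<le> (\<bar>fst u\<bar> + \<bar>snd u\<bar>) / \<rho>" using \<rho> by (simp add: diamond_def)
      then have "(y + \<kappa>) * 1 \<le> (y + \<kappa>) * ((\<bar>fst u\<bar> + \<bar>snd u\<bar>) / \<rho>)"
        using \<open>0 \<le> y\<close> convex_gap_nonneg[of D W] by (intro mult_left_mono) auto
      then have "y - (y + \<kappa>) / \<rho> * (\<bar>fst u\<bar> + \<bar>snd u\<bar>) \<le> - \<kappa>" by simp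
      moreover have "\<bar>?P u - ?g u\<bar> \<le> \<kappa>"
        using convex_gap_upper[OF borel_scale_shift[OF B(1)] convex_scale_shift[OF B(2)], of D W c u] by simp
      ultimately show ?thesis using \<sigma> by auto
    qed
    then have "kernel 0 0 s u * (y - (y + \<kappa>) / \<rho> * (\<bar>fst u\<bar> + \<bar>snd u\<bar>)) \<le> kernel 0 0 s u * (\<sigma> * (?P u - ?g u))"
      by (rule mult_left_mono) (rule kernel_nonneg)
    then show "y * kernel 0 0 s u - (y + \<kappa>) / \<rho> * ((\<bar>fst u\<bar> + \<bar>snd u\<bar>) * kernel 0 0 s u) \<le> \<sigma> * (kernel 0 0 s u * ?P u - kernel 0 0 s u * ?g u)"
      by (simp only: right_diff_distrib ac_simps)
  qed
  also have "\<dots> = \<sigma> * (E (\<lambda>\<omega>. smoothed B 0 0 s (c *\<^sub>R W \<omega>)) - gauss B)"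
    unfolding integral_mult_right_zero Bochner_Integration.integral_diff[OF iP G(1)] eP G(2) ..
  also have "\<dots> \<le> \<eta>" using \<eta> \<sigma> by auto
  finally have "y - (y + \<kappa>) / \<rho> * (2 * kernel_mass^2 * s) \<le> \<eta>" .
  moreover have "(y + \<kappa>) / \<rho> * (2 * kernel_mass^2 * s) = (y + \<kappa>) / 4"
    using sc kernel_mass_ge(3) by (simp add: \<rho>_def field_simps)
  ultimately show ?thesis by simp
qed

text \<open>
  Here \<open>B\<close> is \<open>c A\<close> thickened by the diamond: if \<open>W \<in> A\<close> and the noise lies in the diamond, then \<open>c W + u \<in> B\<close>.
\<close>

lemma gap_above:
  assumes A: "compact A" "convex A" and sc: "0 < s" "0 < c" "s^2 + c^2 = 1"
    and \<eta>: "\<And>B. B \<in> sets borel \<Longrightarrow> convex B \<Longrightarrow> \<bar>E (\<lambda>\<omega>. smoothed B 0 0 s (c *\<^sub>R W \<omega>)) - gauss B\<bar> \<le> \<eta>"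
  shows "measure_pmf.prob D {\<omega>. W \<omega> \<in> A} - gauss A \<le> (4 * \<eta> + \<kappa>) / 3 + 8 * (8 * kernel_mass^2 * s) / c"
proof -
  define \<rho> where "\<rho> = 8 * kernel_mass^2 * s"
  have \<rho>: "0 \<le> \<rho>" using sc by (simp add: \<rho>_def)
  define B where "B = (\<lambda>(x, z). c *\<^sub>R x + z) ` (A \<times> diamond \<rho>)"
  have "compact B" unfolding B_def
    by (intro compact_continuous_image compact_Times A compact_diamond)
       (auto simp: split_beta' intro!: continuous_intros)
  then have Bb: "B \<in> sets borel" by (simp add: borel_compact)
  have lin: "linear (\<lambda>(x :: real \<times> real, z). c *\<^sub>R x + z)"
    by (rule linearI) (auto simp: algebra_simps)
  have Bc: "convex B" unfolding B_def
    by (intro convex_linear_image lin convex_Times A convex_diamond)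
  have "measure_pmf.prob D {\<omega>. W \<omega> \<in> A} - gauss A - 8 * \<rho> / c \<le> (4 * \<eta> + \<kappa>) / 3"
  proof (rule smoothed_gap[OF Bb Bc sc \<eta>[OF Bb Bc], of 1])
    fix u assume "u \<in> diamond (8 * kernel_mass^2 * s)"
    then have u: "u \<in> diamond \<rho>" by (simp add: \<rho>_def)
    let ?S = "{w. c *\<^sub>R w + u \<in> B}"
    have "measure_pmf.prob D {\<omega>. W \<omega> \<in> A} \<le> measure_pmf.prob D {\<omega>. c *\<^sub>R W \<omega> + u \<in> B}"
      by (rule measure_pmf.finite_measure_mono) (use u in \<open>auto simp: B_def\<close>)
    moreover have "gauss ?S \<le> gauss {w \<in> ?S. \<forall>v\<in>diamond_vertices (2 * \<rho> / c). w + v \<in> ?S} + 4 * (2 * \<rho> / c)"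
      by (rule gauss_inner) (use \<rho> sc Bb Bc in \<open>auto intro: borel_scale_shift convex_scale_shift\<close>)
    moreover have "gauss {w \<in> ?S. \<forall>v\<in>diamond_vertices (2 * \<rho> / c). w + v \<in> ?S} \<le> gauss A"
    proof (rule gauss.finite_measure_mono)
      show "A \<in> sets std_bivariate_normal" using A by (simp add: borel_compact)
      show "{w \<in> ?S. \<forall>v\<in>diamond_vertices (2 * \<rho> / c). w + v \<in> ?S} \<subseteq> A"
      proof
        fix w assume w: "w \<in> {w \<in> ?S. \<forall>v\<in>diamond_vertices (2 * \<rho> / c). w + v \<in> ?S}"
        show "w \<in> A"
        proof (rule thickening_inner[OF A(2,1) \<rho> sc(2) u])
          fix v assume "v \<in> diamond_vertices (2 * \<rho> / c)"
          then have "c *\<^sub>R (w + v) + u \<in> B" using w by blast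
          then show "\<exists>x\<in>A. \<exists>z\<in>diamond \<rho>. c *\<^sub>R (w + v) + u = c *\<^sub>R x + z" by (auto simp: B_def)
        qed
      qed
    qed
    ultimately show "measure_pmf.prob D {\<omega>. W \<omega> \<in> A} - gauss A - 8 * \<rho> / c
      \<le> 1 * (measure_pmf.prob D {\<omega>. c *\<^sub>R W \<omega> + u \<in> B} - gauss ?S)" by simp
  qed simp
  then show ?thesis unfolding \<rho>_def by linarith
qed

text \<open>
  Here \<open>B\<close> is \<open>c A\<close> shrunk by the diamond: if \<open>c W + u \<in> B\<close> and the noise lies in the diamond, then \<open>W \<in> A\<close>.
\<close>

lemma gap_below:
  assumes A[measurable]: "A \<in> sets borel" "convex A" and sc: "0 < s" "0 < c" "s^2 + c^2 = 1"
    and \<eta>: "\<And>B. B \<in> sets borel \<Longrightarrow> convex B \<Longrightarrow> \<bar>E (\<lambda>\<omega>. smoothed B 0 0 s (c *\<^sub>R W \<omega>)) - gauss B\<bar> \<le> \<eta>"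
  shows "gauss A - measure_pmf.prob D {\<omega>. W \<omega> \<in> A} \<le> (4 * \<eta> + \<kappa>) / 3 + 8 * (8 * kernel_mass^2 * s) / c"
proof -
  define \<rho> where "\<rho> = 8 * kernel_mass^2 * s"
  have \<rho>: "0 \<le> \<rho>" using sc by (simp add: \<rho>_def)
  define A' where "A' = {x. (1 / c) *\<^sub>R x + 0 \<in> A}"
  have A'[measurable]: "A' \<in> sets borel" "convex A'"
    unfolding A'_def by (rule borel_scale_shift[OF A(1)], rule convex_scale_shift[OF A(2)])
  define B where "B = (\<Inter>v\<in>diamond_vertices \<rho>. {x. 1 *\<^sub>R x + v \<in> A'})"
  have Bb: "B \<in> sets borel"
    unfolding B_def by (intro sets.countable_INT'' borel_scale_shift A') (auto simp: diamond_vertices_def)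
  have Bc: "convex B" unfolding B_def by (intro convex_INT convex_scale_shift A')
  have "gauss A - measure_pmf.prob D {\<omega>. W \<omega> \<in> A} - 8 * \<rho> / c \<le> (4 * \<eta> + \<kappa>) / 3"
  proof (rule smoothed_gap[OF Bb Bc sc \<eta>[OF Bb Bc], of "-1"])
    fix u assume "u \<in> diamond (8 * kernel_mass^2 * s)"
    then have u: "u \<in> diamond \<rho>" by (simp add: \<rho>_def)
    let ?S = "{w. c *\<^sub>R w + u \<in> B}"
    have mu: "- u \<in> diamond \<rho>" using u by (simp add: diamond_def)
    have "measure_pmf.prob D {\<omega>. c *\<^sub>R W \<omega> + u \<in> B} \<le> measure_pmf.prob D {\<omega>. W \<omega> \<in> A}"
    proof (rule measure_pmf.finite_measure_mono)
      show "{\<omega>. c *\<^sub>R W \<omega> + u \<in> B} \<subseteq> {\<omega>. W \<omega> \<in> A}"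
      proof
        fix \<omega> assume "\<omega> \<in> {\<omega>. c *\<^sub>R W \<omega> + u \<in> B}"
        then have "(c *\<^sub>R W \<omega> + u) + - u \<in> A'"
          by (intro convex_diamond_subset[OF A'(2) _ mu]) (auto simp: B_def)
        then show "\<omega> \<in> {\<omega>. W \<omega> \<in> A}" using sc by (simp add: A'_def)
      qed
    qed simp
    moreover have "gauss A \<le> gauss {w \<in> A. \<forall>v\<in>diamond_vertices (2 * \<rho> / c). w + v \<in> A} + 4 * (2 * \<rho> / c)"
      by (rule gauss_inner) (use \<rho> sc A in auto)
    moreover have "gauss {w \<in> A. \<forall>v\<in>diamond_vertices (2 * \<rho> / c). w + v \<in> A} \<le> gauss ?S"
    proof (rule gauss.finite_measure_mono)
      show "?S \<in> sets std_bivariate_normal" using Bb by (simp add: borel_scale_shift)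
      show "{w \<in> A. \<forall>v\<in>diamond_vertices (2 * \<rho> / c). w + v \<in> A} \<subseteq> ?S"
      proof
        fix w assume w: "w \<in> {w \<in> A. \<forall>v\<in>diamond_vertices (2 * \<rho> / c). w + v \<in> A}"
        have "c *\<^sub>R w + u + v \<in> A'" if v: "v \<in> diamond_vertices \<rho>" for v
        proof -
          have "\<bar>fst u + fst v\<bar> + \<bar>snd u + snd v\<bar> \<le> 2 * \<rho>"
            using u v by (auto simp: diamond_def diamond_vertices_def)
          then have "\<bar>fst ((1 / c) *\<^sub>R (u + v))\<bar> + \<bar>snd ((1 / c) *\<^sub>R (u + v))\<bar> \<le> 2 * \<rho> / c"
            using sc by (simp add: abs_mult add_divide_distrib[symmetric] divide_right_mono)
          then have d: "(1 / c) *\<^sub>R (u + v) \<in> diamond (2 * \<rho> / c)" by (simp only: diamond_def mem_Collect_eq)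
          have "w + (1 / c) *\<^sub>R (u + v) \<in> A"
            by (rule convex_diamond_subset[OF A(2) _ d]) (use w in blast)
          moreover have "(1 / c) *\<^sub>R (c *\<^sub>R w + u + v) = w + (1 / c) *\<^sub>R (u + v)"
            using sc by (simp add: scaleR_add_right)
          ultimately show ?thesis by (simp add: A'_def)
        qed
        then show "w \<in> ?S" by (simp add: B_def)
      qed
    qed
    ultimately show "gauss A - measure_pmf.prob D {\<omega>. W \<omega> \<in> A} - 8 * \<rho> / c
      \<le> - 1 * (measure_pmf.prob D {\<omega>. c *\<^sub>R W \<omega> + u \<in> B} - gauss ?S)" by simp
  qed simp
  then show ?thesis unfolding \<rho>_def by linarith
qed

lemma smoothing_inequality:
  assumes sc: "0 < s" "0 < c" "s^2 + c^2 = 1"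
    and \<eta>: "\<And>B. B \<in> sets borel \<Longrightarrow> convex B \<Longrightarrow> \<bar>E (\<lambda>\<omega>. smoothed B 0 0 s (c *\<^sub>R W \<omega>)) - gauss B\<bar> \<le> \<eta>"
  shows "\<kappa> \<le> 2 * \<eta> + 96 * kernel_mass^2 * s / c"
proof -
  have "\<kappa> \<le> (4 * \<eta> + \<kappa>) / 3 + 8 * (8 * kernel_mass^2 * s) / c"
  proof (rule convex_gap_least)
    fix A :: "(real \<times> real) set" assume A: "A \<in> sets borel" "convex A"
    let ?H = "convex hull (A \<inter> W ` set_pmf D)"
    have H: "?H \<subseteq> A" by (rule hull_minimal) (use A in auto)
    have "compact ?H" using fin by (intro finite_imp_compact_convex_hull) auto
    then have "measure_pmf.prob D {\<omega>. W \<omega> \<in> ?H} - gauss ?H \<le> (4 * \<eta> + \<kappa>) / 3 + 8 * (8 * kernel_mass^2 * s) / c"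
      by (rule gap_above[OF _ convex_convex_hull sc \<eta>])
    moreover have "gauss ?H \<le> gauss A"
      by (rule gauss.finite_measure_mono[OF H]) (use A in simp)
    moreover have "measure_pmf.prob D {\<omega>. W \<omega> \<in> A} \<le> measure_pmf.prob D {\<omega>. W \<omega> \<in> ?H}"
      by (rule prob_le_prob_hull)
    ultimately have "measure_pmf.prob D {\<omega>. W \<omega> \<in> A} - gauss A \<le> (4 * \<eta> + \<kappa>) / 3 + 8 * (8 * kernel_mass^2 * s) / c"
      by linarith
    then show "\<bar>measure_pmf.prob D {\<omega>. W \<omega> \<in> A} - gauss A\<bar> \<le> (4 * \<eta> + \<kappa>) / 3 + 8 * (8 * kernel_mass^2 * s) / c"
      using gap_below[OF A sc \<eta>] by linarith
  qed
  moreover define q where "q = kernel_mass^2 * s / c"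
  ultimately have "\<kappa> \<le> (4 * \<eta> + \<kappa>) / 3 + 64 * q" by simp
  moreover have "k \<le> 2 * \<eta> + 96 * q" if "k \<le> (4 * \<eta> + k) / 3 + 64 * q" for k :: real
    using that by (simp add: field_simps)
  ultimately have "\<kappa> \<le> 2 * \<eta> + 96 * q" by blast
  then show ?thesis by (simp add: q_def)
qed

text \<open>
  Taking \<open>s = \<epsilon>\<close> yields \<open>\<kappa> \<le> C \<epsilon> (1 + sqrt \<kappa> ln (1/\<epsilon>))\<close>. The product with \<open>sqrt \<kappa>\<close> is split into \<open>\<kappa> / 2\<close> and a multiple of
  \<open>\<epsilon>\<^sup>2 (ln (1/\<epsilon>))\<^sup>2\<close>, which is at most a multiple of \<open>\<epsilon>\<close>; so the logarithm disappears.
\<close>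

theorem convex_gap_le: "\<kappa> \<le> (2 + 488 * kernel_mass^2 + 1024 * kernel_mass^4) * \<epsilon>"
proof (cases "\<epsilon> \<le> 1 / 2")
  case False
  have "\<kappa> \<le> 1"
  proof (rule convex_gap_least)
    fix A
    have "0 \<le> measure_pmf.prob D {\<omega>. W \<omega> \<in> A}" "measure_pmf.prob D {\<omega>. W \<omega> \<in> A} \<le> 1" "0 \<le> gauss A" "gauss A \<le> 1"
      by auto
    then show "\<bar>measure_pmf.prob D {\<omega>. W \<omega> \<in> A} - gauss A\<bar> \<le> 1" by linarith
  qed
  also have "1 \<le> 2 * \<epsilon>" using False by simp
  also have "\<dots> \<le> (2 + 488 * kernel_mass^2 + 1024 * kernel_mass^4) * \<epsilon>"
    using eps by (intro mult_right_mono) auto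
  finally show ?thesis .
next
  case True
  \<comment> \<open>The path is stopped at noise level \<open>\<epsilon>\<close>, where the cost of removing the noise matches the rate.\<close>
  define t0 where "t0 = arcsin \<epsilon>"
  have st: "sin t0 = \<epsilon>" using True eps by (simp add: t0_def)
  have t0: "0 < t0" "t0 \<le> pi / 2"
    using arcsin_less_arcsin[of 0 \<epsilon>] arcsin_bounded[of \<epsilon>] True eps by (auto simp: t0_def)
  have sc: "\<epsilon>^2 + (cos t0)^2 = 1" using sin_cos_squared_add[of t0] by (simp add: st)
  have c0: "0 \<le> cos t0" using t0 by (intro cos_ge_zero) auto
  have "\<epsilon>^2 \<le> (1/2)^2" using True eps by (intro power_mono) auto
  then have "(1/2)^2 \<le> (cos t0)^2" using sc by (simp add: power2_eq_square)
  then have c: "1 / 2 \<le> cos t0" by (rule power2_le_imp_le) (rule c0)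
  define L where "L = ln (1 / \<epsilon>)"
  define g where "g = kernel_mass^2"
  have g: "1 \<le> g" unfolding g_def using kernel_mass_ge(3) by (rule one_le_power)
  have L: "0 \<le> L" unfolding L_def using True eps by (intro ln_ge_zero) simp
  \<comment> \<open>From \<open>ln x \<le> x - 1\<close> at \<open>x = 1 / sqrt \<epsilon>\<close>.\<close>
  have L2: "\<epsilon> * L^2 \<le> 4"
  proof -
    have "L = 2 * ln (1 / sqrt \<epsilon>)" unfolding L_def using eps by (simp add: ln_div ln_sqrt)
    also have "\<dots> \<le> 2 * (1 / sqrt \<epsilon> - 1)" using eps by (intro mult_left_mono ln_le_minus_one) auto
    also have "\<dots> \<le> 2 / sqrt \<epsilon>" by simp
    finally have "L^2 \<le> (2 / sqrt \<epsilon>)^2" using L by (intro power_mono) auto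
    also have "\<dots> = 4 / \<epsilon>" using eps by (simp add: power_divide)
    finally show ?thesis using eps by (simp add: field_simps)
  qed
  have "\<kappa> \<le> 2 * (g * (8 * \<epsilon> * sqrt \<kappa> * L + 24 * \<epsilon> + 2 * \<epsilon>^2 * (1 / \<epsilon>))) + 96 * g * \<epsilon> / cos t0"
    unfolding g_def L_def
    by (rule smoothing_inequality[OF eps _ sc]) (use interpolation_bound[OF _ _ t0] c in \<open>auto simp: st\<close>)
  also have "96 * g * \<epsilon> / cos t0 \<le> 96 * g * \<epsilon> / (1 / 2)"
    using c g eps by (intro divide_left_mono mult_nonneg_nonneg mult_pos_pos) auto
  finally have "\<kappa> \<le> 244 * g * \<epsilon> + 16 * (g * \<epsilon> * L) * sqrt \<kappa>"
    using eps by (simp add: power2_eq_square algebra_simps)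
  moreover have "16 * (g * \<epsilon> * L) * sqrt \<kappa> \<le> \<kappa> / 2 + 128 * (g * \<epsilon> * L)^2"
  proof -
    define z where "z = g * \<epsilon> * L"
    have "0 \<le> (sqrt \<kappa> - 16 * z)^2" by simp
    also have "\<dots> = \<kappa> - 2 * (16 * z * sqrt \<kappa>) + 256 * z^2"
      using convex_gap_nonneg[of D W] by (simp add: power2_diff power_mult_distrib)
    finally show ?thesis unfolding z_def[symmetric] by linarith
  qed
  moreover have "(g * \<epsilon> * L)^2 \<le> 4 * g^2 * \<epsilon>"
  proof -
    have "(g * \<epsilon> * L)^2 = (g^2 * \<epsilon>) * (\<epsilon> * L^2)" by (simp add: power_mult_distrib power2_eq_square)
    also have "\<dots> \<le> (g^2 * \<epsilon>) * 4" using L2 eps by (intro mult_left_mono) auto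
    finally show ?thesis by simp
  qed
  ultimately have "\<kappa> \<le> 488 * g * \<epsilon> + 1024 * g^2 * \<epsilon>" by linarith
  also have "\<dots> \<le> (2 + 488 * kernel_mass^2 + 1024 * kernel_mass^4) * \<epsilon>"
  proof -
    have "g^2 = kernel_mass^4" by (simp add: g_def power_mult[symmetric])
    then show ?thesis using eps unfolding g_def[symmetric] by (simp add: distrib_right)
  qed
  finally show ?thesis .
qed

end

abbreviation bern :: "'e set \<Rightarrow> real \<Rightarrow> ('e \<Rightarrow> bool) pmf" where
  "bern E p \<equiv> Pi_pmf E False (\<lambda>_. bernoulli_pmf p)"

abbreviation Ebern :: "'e set \<Rightarrow> real \<Rightarrow> (('e \<Rightarrow> bool) \<Rightarrow> real) \<Rightarrow> real" where
  "Ebern E p f \<equiv> measure_pmf.expectation (bern E p) f"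

section \<open>Independent coins\<close>

definition flip_diff :: "'e \<Rightarrow> (('e \<Rightarrow> bool) \<Rightarrow> real) \<Rightarrow> ('e \<Rightarrow> bool) \<Rightarrow> real" where
  "flip_diff e f X = f (X(e := True)) - f (X(e := False))"

lemma finite_bern: "finite E \<Longrightarrow> finite (set_pmf (bern E p))"
  by (rule finite_subset[OF set_Pi_pmf_subset'])
     (auto intro!: finite_PiE_dflt finite_subset[OF subset_UNIV[of "set_pmf (bernoulli_pmf p)"]])

lemma bern_integrable[simp, intro]:
  fixes f :: "_ \<Rightarrow> real"
  shows "finite E \<Longrightarrow> integrable (bern E p) f"
  by (intro integrable_measure_pmf_finite finite_bern)

lemma Ebern_insert:
  assumes "finite A" "e \<notin> A" "0 \<le> p" "p \<le> 1"
  shows "Ebern (insert e A) p f = p * Ebern A p (\<lambda>X. f (X(e := True))) + (1 - p) * Ebern A p (\<lambda>X. f (X(e := False)))"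
proof -
  have b: "bern (insert e A) p = bernoulli_pmf p \<bind> (\<lambda>b. map_pmf (\<lambda>X. X(e := b)) (bern A p))"
    unfolding Pi_pmf_insert'[OF assms(1,2)] map_pmf_def ..
  have "Ebern (insert e A) p f
      = (\<Sum>b\<in>UNIV. pmf (bernoulli_pmf p) b *\<^sub>R measure_pmf.expectation (map_pmf (\<lambda>X. X(e := b)) (bern A p)) f)"
    unfolding b by (rule pmf_expectation_bind) (auto simp: finite_bern assms)
  also have "\<dots> = p * Ebern A p (\<lambda>X. f (X(e := True))) + (1 - p) * Ebern A p (\<lambda>X. f (X(e := False)))"
    using assms by (simp add: UNIV_bool)
  finally show ?thesis .
qed

lemma Ebern_cond:
  assumes "finite E" "e \<in> E" "0 \<le> p" "p \<le> 1"
  shows "Ebern E p f = p * Ebern E p (\<lambda>X. f (X(e := True))) + (1 - p) * Ebern E p (\<lambda>X. f (X(e := False)))"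
proof -
  obtain A where A: "E = insert e A" "e \<notin> A" "finite A"
    using assms by (metis Set.set_insert finite_insert)
  show ?thesis
    unfolding A(1) Ebern_insert[OF A(3,2) assms(3,4)] by simp algebra
qed

lemma Ebern_mono: "finite E \<Longrightarrow> (\<And>X. f X \<le> g X) \<Longrightarrow> Ebern E p f \<le> Ebern E p g"
  by (intro integral_mono) auto

lemma Ebern_square: "finite E \<Longrightarrow> (Ebern E p f)^2 \<le> Ebern E p (\<lambda>X. (f X)^2)"
proof -
  assume fin: "finite E"
  define m where "m = Ebern E p f"
  have "0 \<le> Ebern E p (\<lambda>X. (f X - m)^2)" by (rule integral_nonneg_AE) simp
  also have "(\<lambda>X. (f X - m)^2) = (\<lambda>X. (f X)^2 - 2 * m * f X + m^2)"
    by (auto simp: power2_diff algebra_simps)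
  also have "Ebern E p \<dots> = Ebern E p (\<lambda>X. (f X)^2) - 2 * m * m + m^2"
    using fin by (simp add: m_def)
  finally show ?thesis by (simp add: m_def power2_eq_square)
qed

lemma Ebern_centered:
  assumes "finite E" "e \<in> E" "0 \<le> p" "p \<le> 1"
    and g: "\<And>X b. g (X(e := b)) = g X"
  shows "Ebern E p (\<lambda>X. (of_bool (X e) - p) * g X) = 0"
  by (subst Ebern_cond[OF assms(1-4)]) (simp add: g assms(1) algebra_simps)

lemma Ebern_centered_square:
  assumes "finite E" "e \<in> E" "0 \<le> p" "p \<le> 1"
    and g: "\<And>X b. g (X(e := b)) = g X"
  shows "Ebern E p (\<lambda>X. (of_bool (X e) - p)^2 * g X) = p * (1 - p) * Ebern E p g"
  by (subst Ebern_cond[OF assms(1-4)]) (simp add: g assms(1) power2_eq_square algebra_simps)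

text \<open>
  The Efron-Stein inequality for coins, by induction on the number of coins: the variance splits into the
  mean of the conditional variances and the variance over the last coin, and \<open>p (1 - p) \<le> 1/4\<close>.
\<close>

lemma poincare:
  assumes "finite E" "0 \<le> p" "p \<le> 1"
  shows "Ebern E p (\<lambda>X. (f X)^2) - (Ebern E p f)^2 \<le> (\<Sum>e\<in>E. Ebern E p (\<lambda>X. (flip_diff e f X)^2)) / 4"
  using assms(1)
proof (induction E arbitrary: f rule: finite_induct)
  case empty
  show ?case by simp
next
  case (insert e A)
  note [simp] = insert.hyps(1)
  let ?f1 = "\<lambda>X. f (X(e := True))" and ?f0 = "\<lambda>X. f (X(e := False))"
  have q: "p * (1 - p) \<le> 1 / 4"
  proof -
    have "0 \<le> (p - 1/2)^2" by simp
    then show ?thesis by (simp add: power2_eq_square algebra_simps)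
  qed
  note ins = Ebern_insert[OF insert.hyps assms(2,3)]
  define V1 V0 where "V1 = Ebern A p (\<lambda>X. (?f1 X)^2) - (Ebern A p ?f1)^2" and "V0 = Ebern A p (\<lambda>X. (?f0 X)^2) - (Ebern A p ?f0)^2"
  define S where "S = Ebern A p (\<lambda>X. (?f1 X - ?f0 X)^2)"
  have "Ebern (insert e A) p (\<lambda>X. (f X)^2) - (Ebern (insert e A) p f)^2
    = p * V1 + (1 - p) * V0 + p * (1 - p) * (Ebern A p ?f1 - Ebern A p ?f0)^2"
    unfolding ins V1_def V0_def by (simp add: power2_eq_square algebra_simps)
  also have "\<dots> \<le> p * V1 + (1 - p) * V0 + 1/4 * S"
  proof -
    have "Ebern A p ?f1 - Ebern A p ?f0 = Ebern A p (\<lambda>X. ?f1 X - ?f0 X)" by simp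
    then have "(Ebern A p ?f1 - Ebern A p ?f0)^2 \<le> S"
      unfolding S_def using Ebern_square[of A p "\<lambda>X. ?f1 X - ?f0 X"] by simp
    then have "p * (1 - p) * (Ebern A p ?f1 - Ebern A p ?f0)^2 \<le> 1/4 * S"
      using q assms by (intro mult_mono) auto
    then show ?thesis by simp
  qed
  also have "\<dots> \<le> p * ((\<Sum>d\<in>A. Ebern A p (\<lambda>X. (flip_diff d ?f1 X)^2)) / 4) + (1 - p) * ((\<Sum>d\<in>A. Ebern A p (\<lambda>X. (flip_diff d ?f0 X)^2)) / 4) + 1/4 * S"
    unfolding V1_def V0_def using assms by (intro add_mono mult_left_mono insert.IH) auto
  also have "\<dots> = (\<Sum>d\<in>insert e A. Ebern (insert e A) p (\<lambda>X. (flip_diff d f X)^2)) / 4"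
  proof -
    have 1: "Ebern (insert e A) p (\<lambda>X. (flip_diff e f X)^2) = S"
      unfolding ins S_def by (simp add: flip_diff_def algebra_simps)
    have 2: "Ebern (insert e A) p (\<lambda>X. (flip_diff d f X)^2) = p * Ebern A p (\<lambda>X. (flip_diff d ?f1 X)^2) + (1 - p) * Ebern A p (\<lambda>X. (flip_diff d ?f0 X)^2)"
      if "d \<in> A" for d
    proof -
      have "d \<noteq> e" using that insert.hyps by auto
      then show ?thesis unfolding ins flip_diff_def by (simp add: fun_upd_twist)
    qed
    have "(\<Sum>d\<in>insert e A. Ebern (insert e A) p (\<lambda>X. (flip_diff d f X)^2)) = S + (\<Sum>d\<in>A. p * Ebern A p (\<lambda>X. (flip_diff d ?f1 X)^2) + (1 - p) * Ebern A p (\<lambda>X. (flip_diff d ?f0 X)^2))"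
      using insert.hyps by (simp add: 1 2)
    then show ?thesis
      by (simp add: sum.distrib sum_distrib_left[symmetric] add_divide_distrib)
  qed
  finally show ?case .
qed

lemma Ebern_sum: "finite E \<Longrightarrow> Ebern E p (\<lambda>X. \<Sum>k\<in>I. f k X) = (\<Sum>k\<in>I. Ebern E p (f k))"
  by (rule Bochner_Integration.integral_sum) auto

text \<open>
  Since \<open>X \<mapsto> W X - \<Delta> k X\<close> is the average of \<open>W\<close> over the coin \<open>\<epsilon> k\<close>, it is independent of that coin, and so is \<open>U k\<close>;
  subtracting \<open>\<psi> (W X - \<Delta> k X)\<close> therefore does not change the expectation.
\<close>

lemma coordinate_coupling:
  fixes W :: "('e \<Rightarrow> bool) \<Rightarrow> real \<times> real"
  assumes E: "finite E" "0 \<le> p" "p \<le> 1" and I: "\<And>k. k \<in> I \<Longrightarrow> \<epsilon> k \<in> E"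
    and F: "\<And>X. F X = (\<Sum>k\<in>I. (of_bool (X (\<epsilon> k)) - p) * U k X)"
    and U: "\<And>k X b. k \<in> I \<Longrightarrow> U k (X(\<epsilon> k := b)) = U k X"
    and \<Delta>: "\<And>k X. k \<in> I \<Longrightarrow> \<Delta> k X = (of_bool (X (\<epsilon> k)) - p) *\<^sub>R (W (X(\<epsilon> k := True)) - W (X(\<epsilon> k := False)))"
  shows "Ebern E p (\<lambda>X. F X * \<psi> (W X))
     = (\<Sum>k\<in>I. Ebern E p (\<lambda>X. ((of_bool (X (\<epsilon> k)) - p) * U k X) * (\<psi> (W X) - \<psi> (W X - \<Delta> k X))))"
proof -
  have "Ebern E p (\<lambda>X. F X * \<psi> (W X)) = (\<Sum>k\<in>I. Ebern E p (\<lambda>X. ((of_bool (X (\<epsilon> k)) - p) * U k X) * \<psi> (W X)))"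
    unfolding F sum_distrib_right using E(1) by (rule Ebern_sum)
  also have "\<dots> = (\<Sum>k\<in>I. Ebern E p (\<lambda>X. ((of_bool (X (\<epsilon> k)) - p) * U k X) * (\<psi> (W X) - \<psi> (W X - \<Delta> k X))))"
  proof (rule sum.cong[OF refl])
    fix k assume k: "k \<in> I"
    have inv: "W (X(\<epsilon> k := b)) - \<Delta> k (X(\<epsilon> k := b)) = W X - \<Delta> k X" for X b
    proof -
      have *: "W Y - \<Delta> k Y = p *\<^sub>R W (Y(\<epsilon> k := True)) + (1 - p) *\<^sub>R W (Y(\<epsilon> k := False))" for Y
      proof (cases "Y (\<epsilon> k)")
        case True
        then have "Y = Y(\<epsilon> k := True)" by (simp add: fun_eq_iff)
        then show ?thesis using True by (simp add: \<Delta>[OF k] algebra_simps)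
      next
        case False
        then have "Y = Y(\<epsilon> k := False)" by (simp add: fun_eq_iff)
        then show ?thesis using False by (simp add: \<Delta>[OF k] algebra_simps)
      qed
      show ?thesis unfolding * by simp
    qed
    have "Ebern E p (\<lambda>X. (of_bool (X (\<epsilon> k)) - p) * (U k X * \<psi> (W X - \<Delta> k X))) = 0"
      by (rule Ebern_centered[OF E(1) I[OF k] E(2,3)]) (simp add: U[OF k] inv)
    then show "Ebern E p (\<lambda>X. ((of_bool (X (\<epsilon> k)) - p) * U k X) * \<psi> (W X))
      = Ebern E p (\<lambda>X. ((of_bool (X (\<epsilon> k)) - p) * U k X) * (\<psi> (W X) - \<psi> (W X - \<Delta> k X)))"
      using E(1) by (simp add: right_diff_distrib mult.assoc)
  qed
  finally show ?thesis .
qed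

section \<open>Functions on the arcs of the complete graph\<close>

lemma weighted_cauchy_schwarz:
  fixes w v :: "'a \<Rightarrow> real"
  assumes "\<And>k. k \<in> I \<Longrightarrow> 0 \<le> w k"
  shows "(\<Sum>k\<in>I. w k * v k)^2 \<le> (\<Sum>k\<in>I. w k) * (\<Sum>k\<in>I. w k * (v k)^2)"
proof -
  have "(\<Sum>k\<in>I. w k * v k)^2 = (\<Sum>k\<in>I. sqrt (w k) * (sqrt (w k) * v k))^2"
    using assms by (intro arg_cong[of _ _ "\<lambda>x. x^2"] sum.cong) (auto simp flip: mult.assoc)
  also have "\<dots> \<le> (\<Sum>k\<in>I. (sqrt (w k))^2) * (\<Sum>k\<in>I. (sqrt (w k) * v k)^2)"
    by (rule Cauchy_Schwarz_ineq_sum)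
  also have "\<dots> = (\<Sum>k\<in>I. w k) * (\<Sum>k\<in>I. w k * (v k)^2)"
    using assms by (intro arg_cong2[of _ _ _ _ "(*)"] sum.cong) (auto simp: power_mult_distrib)
  finally show ?thesis .
qed

lemma finite_vertex_pairs[simp]: "finite (vertex_pairs n)"
  by (rule finite_subset[of _ "Pow {..<n}"]) (auto simp: vertex_pairs_def)

text \<open>
  Sums over pairs of vertices are taken over ordered pairs, each edge being counted twice: the
  number of paths between \<open>a\<close> and \<open>b\<close> is a sum over ordered pairs of inner vertices.
\<close>

definition arcs :: "nat \<Rightarrow> (nat \<times> nat) set" where
  "arcs n = {(a, b). a < n \<and> b < n \<and> a \<noteq> b}"

definition edge :: "nat \<times> nat \<Rightarrow> nat set" where
  "edge k = {fst k, snd k}"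

lemma finite_arcs[simp]: "finite (arcs n)"
  by (rule finite_subset[of _ "{..<n} \<times> {..<n}"]) (auto simp: arcs_def)

lemma edge_in: "k \<in> arcs n \<Longrightarrow> edge k \<in> vertex_pairs n"
  by (auto simp: arcs_def edge_def vertex_pairs_def)

lemma vertex_pairsE:
  assumes "e \<in> vertex_pairs n"
  obtains u v where "e = {u, v}" "u \<noteq> v" "u < n" "v < n"
  using assms by (auto simp: vertex_pairs_def card_2_iff)

lemma card_arcs: "real (card (arcs n)) = real n * (real n - 1)"
proof -
  have "arcs n = {..<n} \<times> {..<n} - (\<lambda>a. (a, a)) ` {..<n}" by (auto simp: arcs_def)
  then have "card (arcs n) = card ({..<n} \<times> {..<n}) - card ((\<lambda>a. (a, a)) ` {..<n})"
    by (simp only:) (rule card_Diff_subset, auto)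
  also have "\<dots> = n * n - n" by (simp add: card_image inj_on_def)
  finally show ?thesis by (cases n) (simp_all add: algebra_simps)
qed

lemma sum_arcs_edge:
  assumes e: "e \<in> vertex_pairs n"
  shows "(\<Sum>k\<in>arcs n. of_bool (edge k = e) * f k) = (\<Sum>k | k \<in> arcs n \<and> edge k = e. f k :: real)"
    "card {k \<in> arcs n. edge k = e} = 2"
proof -
  show "(\<Sum>k\<in>arcs n. of_bool (edge k = e) * f k) = (\<Sum>k | k \<in> arcs n \<and> edge k = e. f k)"
    by (rule sum.mono_neutral_cong_right) auto
  obtain u v where uv: "e = {u, v}" "u \<noteq> v" "u < n" "v < n" using e by (rule vertex_pairsE)
  have "{k \<in> arcs n. edge k = e} = {(u, v), (v, u)}"
    using uv by (auto simp: arcs_def edge_def doubleton_eq_iff)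
  then show "card {k \<in> arcs n. edge k = e} = 2" using uv by simp
qed

lemma two_choose_two: "2 * real (n choose 2) = real n * (real n - 1)"
proof -
  have "2 * (n choose 2) = n * (n - 1)"
    unfolding choose_two by (rule dvd_mult_div_cancel) (simp, blast)
  then have "2 * real (n choose 2) = real (n * (n - 1))" by (metis of_nat_mult of_nat_numeral)
  then show ?thesis by (cases n) (simp_all add: algebra_simps)
qed

lemma card_vertex_pairs: "card (vertex_pairs n) = n choose 2"
  using n_subsets[of "{..<n}" 2] by (simp add: vertex_pairs_def)

text \<open>
  The scale of the influence of the coin \<open>e\<close> on a count of paths of length three between the end points of \<open>k\<close>: if \<open>e\<close> is the
  first or last step, one inner vertex remains free; if it is the middle step, only its direction is.
\<close>

definition \<beta> :: "nat \<Rightarrow> nat set \<Rightarrow> nat \<times> nat \<Rightarrow> real" where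
  "\<beta> n e k = real n * (of_bool (fst k \<in> e) + of_bool (snd k \<in> e)) + 2"

lemma \<beta>_pos: "0 < \<beta> n e k"
  by (simp add: \<beta>_def add_nonneg_pos)

locale gnp =
  fixes n :: nat and p :: real
  assumes n4: "4 \<le> n" and p0: "0 < p" and p1: "p < 1"
begin

abbreviation V where "V \<equiv> vertex_pairs n"
abbreviation Ex :: "((nat set \<Rightarrow> bool) \<Rightarrow> real) \<Rightarrow> real" where "Ex f \<equiv> Ebern V p f"
abbreviation N :: real where "N \<equiv> real n"

lemma N4: "4 \<le> N" using n4 by simp

lemma card_V_le: "real (card V) \<le> N^2"
  using two_choose_two[of n, folded card_vertex_pairs] N4 by (simp add: power2_eq_square algebra_simps)

lemma card_arcs_le: "real (card (arcs n)) \<le> N^2"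
  using card_arcs[of n] N4 by (simp add: power2_eq_square algebra_simps)

lemma \<beta>_sq_le: "(\<beta> n e k)^2 \<le> 5 * N^3"
proof -
  have "\<beta> n e k \<le> 2 * N + 2" by (auto simp: \<beta>_def)
  also have "\<dots> \<le> 3 * N" using N4 by simp
  finally have "(\<beta> n e k)^2 \<le> (3 * N)^2" using \<beta>_pos[of n e k] by (intro power_mono) auto
  also have "\<dots> = 9 * N^2" by (simp add: power2_eq_square)
  also have "\<dots> \<le> 5 * (N * N^2)" using N4 by (simp add: mult_right_mono)
  finally show ?thesis by (simp add: power3_eq_cube power2_eq_square)
qed

lemma sum_vertex_incidence:
  assumes "a < n"
  shows "(\<Sum>e\<in>V. of_bool (a \<in> e) :: real) \<le> N"
proof -
  have "(\<Sum>e\<in>V. of_bool (a \<in> e) :: real) = real (card {e \<in> V. a \<in> e})"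
    by (simp add: Int_def)
  also have "card {e \<in> V. a \<in> e} \<le> card ((\<lambda>b. {a, b}) ` {..<n})"
  proof (rule card_mono)
    show "{e \<in> V. a \<in> e} \<subseteq> (\<lambda>b. {a, b}) ` {..<n}"
    proof
      fix e assume e: "e \<in> {e \<in> V. a \<in> e}"
      then obtain u v where uv: "e = {u, v}" "u \<noteq> v" "u < n" "v < n" by (auto elim: vertex_pairsE)
      with e show "e \<in> (\<lambda>b. {a, b}) ` {..<n}" by (auto simp: image_iff doubleton_eq_iff)
    qed
  qed simp
  also have "\<dots> \<le> n" by (rule order_trans[OF card_image_le]) auto
  finally show ?thesis by simp
qed

lemma sum_\<beta>_sq: 
  assumes k: "k \<in> arcs n"
  shows "(\<Sum>e\<in>V. (\<beta> n e k)^2) \<le> 16 * N^3"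
proof -
  have "(\<Sum>e\<in>V. (\<beta> n e k)^2) \<le> (\<Sum>e\<in>V. 4 * N^2 * (of_bool (fst k \<in> e) + of_bool (snd k \<in> e)) + 8)"
  proof (rule sum_mono)
    fix e
    show "(\<beta> n e k)^2 \<le> 4 * N^2 * (of_bool (fst k \<in> e) + of_bool (snd k \<in> e)) + 8"
    proof -
      have "(N + 2)^2 \<le> 4 * N^2 + 8" "(N * 2 + 2)^2 \<le> 8 * N^2 + 8"
        using sum_squares_bound[of N 2] sum_squares_bound[of "2 * N" 2] by (simp_all add: power2_eq_square algebra_simps)
      then show ?thesis by (auto simp: \<beta>_def)
    qed
  qed
  also have "\<dots> = 4 * N^2 * ((\<Sum>e\<in>V. of_bool (fst k \<in> e)) + (\<Sum>e\<in>V. of_bool (snd k \<in> e))) + 8 * real (card V)"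
    by (simp add: sum.distrib sum_distrib_left[symmetric])
  also have "\<dots> \<le> 4 * N^2 * (N + N) + 8 * N^2"
    using k by (intro add_mono mult_left_mono sum_vertex_incidence card_V_le) (auto simp: arcs_def)
  also have "\<dots> \<le> 16 * N^3"
  proof -
    have "8 * N^2 \<le> 8 * (N * N^2)" using N4 by (simp add: mult_right_mono)
    then show ?thesis by (simp add: power3_eq_cube power2_eq_square)
  qed
  finally show ?thesis .
qed

lemma sum_\<beta>_arcs:
  assumes e: "e \<in> V"
  shows "(\<Sum>k\<in>arcs n. \<beta> n e k) \<le> 6 * N^2"
proof -
  obtain u v where uv: "e = {u, v}" "u \<noteq> v" "u < n" "v < n" using e by (rule vertex_pairsE)
  have i: "(\<Sum>a<n. of_bool (a \<in> e) :: real) = 2"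
  proof -
    have "(\<Sum>a<n. of_bool (a \<in> e) :: real) = real (card ({..<n} \<inter> {a. a \<in> e}))" by simp
    also have "{..<n} \<inter> {a. a \<in> e} = {u, v}" using uv by auto
    finally show ?thesis using uv by simp
  qed
  have "(\<Sum>k\<in>arcs n. \<beta> n e k) \<le> (\<Sum>k\<in>{..<n} \<times> {..<n}. \<beta> n e k)"
    by (rule sum_mono2) (auto simp: arcs_def less_imp_le[OF \<beta>_pos])
  also have "\<dots> = (\<Sum>a<n. \<Sum>b<n. N * of_bool (a \<in> e) + (N * of_bool (b \<in> e) + 2))"
    by (simp add: sum.cartesian_product' \<beta>_def distrib_left add.assoc)
  also have "\<dots> = 6 * N^2"
    by (simp only: sum.distrib sum_distrib_left[symmetric] i sum_constant) (simp add: sum_distrib_left[symmetric] sum_distrib_right[symmetric] i power2_eq_square algebra_simps)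
  finally show ?thesis .
qed

text \<open>
  The normalisation is such that the second moment of \<open>H k\<close> is of order \<open>\<theta>\<^sup>2 n\<^sup>3\<close>; the last condition
  asks the mean not to exceed this order.
\<close>

definition arc_field :: "real \<Rightarrow> (nat \<times> nat \<Rightarrow> (nat set \<Rightarrow> bool) \<Rightarrow> real) \<Rightarrow> bool" where
  "arc_field \<theta> H \<longleftrightarrow> 0 \<le> \<theta>
    \<and> (\<forall>k\<in>arcs n. \<forall>X b. H k (X(edge k := b)) = H k X)
    \<and> (\<forall>k\<in>arcs n. \<forall>e\<in>V. \<forall>X. \<bar>flip_diff e (H k) X\<bar> \<le> \<theta> * \<beta> n e k)
    \<and> (\<forall>k\<in>arcs n. \<bar>Ex (H k)\<bar> \<le> \<theta> * (N * sqrt N))"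

lemma Ex_add: "Ex (\<lambda>X. f X + g X) = Ex f + Ex g"
  by (intro Bochner_Integration.integral_add bern_integrable finite_vertex_pairs)

lemma Ex_diff: "Ex (\<lambda>X. f X - g X) = Ex f - Ex g"
  by (intro Bochner_Integration.integral_diff bern_integrable finite_vertex_pairs)

lemma Ex_cmult: "Ex (\<lambda>X. c * f X) = c * Ex f"
  by (rule integral_mult_right_zero)

lemma Ex_mono: "(\<And>X. f X \<le> g X) \<Longrightarrow> Ex f \<le> Ex g"
  by (rule Ebern_mono) simp_all

lemma poincare_V: "Ex (\<lambda>X. (f X)^2) - (Ex f)^2 \<le> (\<Sum>e\<in>V. Ex (\<lambda>X. (flip_diff e f X)^2)) / 4"
  using p0 p1 by (intro poincare) auto

lemma arc_field_moment2:
  assumes H: "arc_field \<theta> H" and k: "k \<in> arcs n"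
  shows "Ex (\<lambda>X. (H k X)^2) \<le> 5 * \<theta>^2 * N^3"
proof -
  have "Ex (\<lambda>X. (H k X)^2) \<le> (Ex (H k))^2 + (\<Sum>e\<in>V. Ex (\<lambda>X. (flip_diff e (H k) X)^2)) / 4"
    using poincare_V[of "H k"] by simp
  also have "\<dots> \<le> (\<theta> * (N * sqrt N))^2 + (\<Sum>e\<in>V. (\<theta> * \<beta> n e k)^2) / 4"
  proof (intro add_mono divide_right_mono sum_mono)
    show "(Ex (H k))^2 \<le> (\<theta> * (N * sqrt N))^2"
      using H k unfolding arc_field_def by (intro power2_le_iff_abs_le[THEN iffD2]) auto
    fix e assume e: "e \<in> V"
    have "Ex (\<lambda>X. (flip_diff e (H k) X)^2) \<le> Ex (\<lambda>X. (\<theta> * \<beta> n e k)^2)"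
    proof (rule Ex_mono)
      show "(flip_diff e (H k) X)^2 \<le> (\<theta> * \<beta> n e k)^2" for X
        using H k e \<beta>_pos[of n e k] unfolding arc_field_def by (intro power2_le_iff_abs_le[THEN iffD2]) auto
    qed
    then show "Ex (\<lambda>X. (flip_diff e (H k) X)^2) \<le> (\<theta> * \<beta> n e k)^2" by simp
  qed auto
  also have "\<dots> = \<theta>^2 * N^3 + \<theta>^2 * (\<Sum>e\<in>V. (\<beta> n e k)^2) / 4"
  proof -
    have "N^2 * (sqrt N)^2 = N^3" by (simp add: power3_eq_cube power2_eq_square)
    then show ?thesis by (simp only: power_mult_distrib sum_distrib_left)
  qed
  also have "\<dots> \<le> \<theta>^2 * N^3 + \<theta>^2 * (16 * N^3) / 4"
    by (intro add_left_mono divide_right_mono mult_left_mono sum_\<beta>_sq k) auto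
  finally show ?thesis by simp
qed

lemma flip_diff_product_le:
  assumes "\<bar>flip_diff e f X\<bar> \<le> d" "\<bar>flip_diff e g X\<bar> \<le> d"
  shows "\<bar>flip_diff e (\<lambda>X. f X * g X) X\<bar> \<le> d * (\<bar>f X\<bar> + \<bar>g X\<bar> + 2 * d)"
proof -
  define f1 f0 g1 g0 where "f1 = f (X(e := True))" and "f0 = f (X(e := False))" and "g1 = g (X(e := True))" and "g0 = g (X(e := False))"
  have X: "X = X(e := True) \<or> X = X(e := False)" by (cases "X e") (auto simp: fun_eq_iff)
  have d: "\<bar>f1 - f0\<bar> \<le> d" "\<bar>g1 - g0\<bar> \<le> d" "0 \<le> d"
    using assms by (auto simp: flip_diff_def f1_def f0_def g1_def g0_def)
  have fx: "f X = f1 \<or> f X = f0" and gx: "g X = g1 \<or> g X = g0"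
    using X unfolding f1_def f0_def g1_def g0_def by metis+
  have b: "\<bar>f0\<bar> \<le> \<bar>f X\<bar> + d" "\<bar>g1\<bar> \<le> \<bar>g X\<bar> + d" using fx gx d by auto
  have "\<bar>f1 * g1 - f0 * g0\<bar> = \<bar>(f1 - f0) * g1 + f0 * (g1 - g0)\<bar>" by (simp add: algebra_simps)
  also have "\<dots> \<le> \<bar>f1 - f0\<bar> * \<bar>g1\<bar> + \<bar>f0\<bar> * \<bar>g1 - g0\<bar>" unfolding abs_mult[symmetric] by (rule abs_triangle_ineq)
  also have "\<dots> \<le> d * (\<bar>g X\<bar> + d) + (\<bar>f X\<bar> + d) * d" using b d by (intro add_mono mult_mono) auto
  also have "\<dots> = d * (\<bar>f X\<bar> + \<bar>g X\<bar> + 2 * d)" by (simp add: algebra_simps)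
  finally show ?thesis by (simp add: flip_diff_def f1_def f0_def g1_def g0_def)
qed

text \<open>
  The Poincare inequality applied to the square of \<open>H k\<close>, whose differences are controlled by the
  differences of \<open>H k\<close> and its second moment.
\<close>

lemma arc_field_moment4:
  assumes H: "arc_field \<theta> H" and k: "k \<in> arcs n"
  shows "Ex (\<lambda>X. (H k X)^4) \<le> 400 * \<theta>^4 * N^6"
proof -
  note m2 = arc_field_moment2[OF H k]
  have D: "Ex (\<lambda>X. (flip_diff e (\<lambda>X. H k X * H k X) X)^2) \<le> (\<theta>^2 * (\<beta> n e k)^2) * (80 * \<theta>^2 * N^3)" if e: "e \<in> V" for e
  proof -
    define d where "d = \<theta> * \<beta> n e k"
    have d2: "d^2 \<le> 5 * \<theta>^2 * N^3"
      unfolding d_def power_mult_distrib using mult_left_mono[OF \<beta>_sq_le[of e k], of "\<theta>^2"] by (simp add: ac_simps)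
    have "Ex (\<lambda>X. (flip_diff e (\<lambda>X. H k X * H k X) X)^2) \<le> Ex (\<lambda>X. 8 * d^2 * (H k X)^2 + 8 * d^2 * d^2)"
    proof (rule Ex_mono)
      fix X
      have dd: "\<bar>flip_diff e (H k) X\<bar> \<le> d" using H k e unfolding arc_field_def d_def by auto
      have "(flip_diff e (\<lambda>X. H k X * H k X) X)^2 \<le> (d * (\<bar>H k X\<bar> + \<bar>H k X\<bar> + 2 * d))^2"
        using flip_diff_product_le[OF dd dd] by (rule abs_le_square_iff[THEN iffD1, OF order_trans[OF _ abs_ge_self]])
      also have "\<dots> = 4 * d^2 * (\<bar>H k X\<bar> + d)^2" by (simp add: power2_eq_square algebra_simps)
      also have "\<dots> \<le> 4 * d^2 * (2 * \<bar>H k X\<bar>^2 + 2 * d^2)"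
        using sum_squares_bound[of "\<bar>H k X\<bar>" d] by (intro mult_left_mono) (auto simp: power2_sum)
      finally show "(flip_diff e (\<lambda>X. H k X * H k X) X)^2 \<le> 8 * d^2 * (H k X)^2 + 8 * d^2 * d^2"
        by (simp add: algebra_simps)
    qed
    also have "\<dots> = 8 * d^2 * (Ex (\<lambda>X. (H k X)^2) + d^2)"
      unfolding Ex_add Ex_cmult by (simp add: algebra_simps)
    also have "\<dots> \<le> 8 * d^2 * (5 * \<theta>^2 * N^3 + 5 * \<theta>^2 * N^3)"
      by (intro mult_left_mono add_mono m2 d2) auto
    also have "\<dots> = (\<theta>^2 * (\<beta> n e k)^2) * (80 * \<theta>^2 * N^3)"
      by (simp add: d_def power_mult_distrib)
    finally show ?thesis .
  qed
  have "Ex (\<lambda>X. (H k X)^4) = Ex (\<lambda>X. (H k X * H k X)^2)" by (simp add: power4_eq_xxxx power2_eq_square mult.assoc)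
  also have "\<dots> \<le> (Ex (\<lambda>X. H k X * H k X))^2 + (\<Sum>e\<in>V. Ex (\<lambda>X. (flip_diff e (\<lambda>X. H k X * H k X) X)^2)) / 4"
    using poincare_V[of "\<lambda>X. H k X * H k X"] by simp
  also have "\<dots> \<le> (5 * \<theta>^2 * N^3)^2 + (\<Sum>e\<in>V. (\<theta>^2 * (\<beta> n e k)^2) * (80 * \<theta>^2 * N^3)) / 4"
    using m2 by (intro add_mono divide_right_mono sum_mono D power_mono)
       (auto simp: power2_eq_square intro!: integral_nonneg_AE)
  also have "(\<Sum>e\<in>V. (\<theta>^2 * (\<beta> n e k)^2) * (80 * \<theta>^2 * N^3)) = (80 * \<theta>^4 * N^3) * (\<Sum>e\<in>V. (\<beta> n e k)^2)"
    by (simp add: sum_distrib_left power4_eq_xxxx power2_eq_square mult_ac)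
  also have "\<dots> \<le> (80 * \<theta>^4 * N^3) * (16 * N^3)"
    using H by (intro mult_left_mono sum_\<beta>_sq k) (auto simp: arc_field_def)
  also have "(5 * \<theta>^2 * N^3)^2 + (80 * \<theta>^4 * N^3) * (16 * N^3) / 4 = 345 * (\<theta>^4 * N^6)"
    by (simp add: eval_nat_numeral)
  also have "\<dots> \<le> 400 * (\<theta>^4 * N^6)" by (intro mult_right_mono) auto
  finally show ?thesis by (simp add: divide_right_mono)
qed

lemma arc_field_same_edge:
  assumes "arc_field \<theta> H" "k \<in> arcs n" "edge k = e"
  shows "H k (X(e := b)) = H k X"
  using assms unfolding arc_field_def by auto

lemma Ex_sum: "Ex (\<lambda>X. \<Sum>k\<in>I. f k X) = (\<Sum>k\<in>I. Ex (f k))"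
  by (rule Ebern_sum) simp

text \<open>
  The entries of the random covariance matrix (the carre du champ): \<open>H\<close> is the coefficient in the decoupled representation of
  one component of \<open>W\<close> and \<open>H'\<close> the discrete derivative of another.
\<close>

definition carre :: "(nat \<times> nat \<Rightarrow> (nat set \<Rightarrow> bool) \<Rightarrow> real) \<Rightarrow> (nat \<times> nat \<Rightarrow> (nat set \<Rightarrow> bool) \<Rightarrow> real) \<Rightarrow> (nat set \<Rightarrow> bool) \<Rightarrow> real" where
  "carre H H' X = (\<Sum>k\<in>arcs n. (of_bool (X (edge k)) - p)^2 * (H k X * H' k X))"

text \<open>
  A coin \<open>e\<close> enters the summand of an arc \<open>k\<close> either through the factor \<open>Y\<^sub>e\<^sup>2\<close>, for the two arcs over \<open>e\<close>, or through \<open>H k\<close> and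
  \<open>H' k\<close>. In the second case the Cauchy-Schwarz inequality with weights \<open>\<beta>\<close> is used, whose sum over all arcs is
  only of order \<open>n\<^sup>2\<close>.
\<close>

lemma carre_difference:
  assumes H: "arc_field \<theta> H" and H': "arc_field \<theta> H'" and e: "e \<in> V"
  shows "(flip_diff e (carre H H') X)^2
    \<le> 4 * (\<Sum>k\<in>arcs n. of_bool (edge k = e) * (H k X * H' k X)^2)
      + 12 * N^2 * \<theta>^2 * (\<Sum>k\<in>arcs n. \<beta> n e k * (\<bar>H k X\<bar> + \<bar>H' k X\<bar> + 2 * (\<theta> * \<beta> n e k))^2)"
proof -
  have th: "0 \<le> \<theta>" using H by (simp add: arc_field_def)
  let ?z = "\<lambda>k. \<bar>H k X\<bar> + \<bar>H' k X\<bar> + 2 * (\<theta> * \<beta> n e k)"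
  let ?i = "\<lambda>k. of_bool (edge k = e) :: real"
  let ?t = "\<lambda>k X. (of_bool (X (edge k)) - p)^2 * (H k X * H' k X)"
  have z: "0 \<le> ?z k" for k using th \<beta>_pos[of n e k] by simp
  have tm: "\<bar>flip_diff e (?t k) X\<bar> \<le> ?i k * \<bar>H k X * H' k X\<bar> + (\<theta> * \<beta> n e k) * ?z k" if k: "k \<in> arcs n" for k
  proof (cases "edge k = e")
    case True
    have "flip_diff e (?t k) X = ((1 - p)^2 - p^2) * (H k X * H' k X)"
      unfolding flip_diff_def arc_field_same_edge[OF H k True] arc_field_same_edge[OF H' k True] using True
      by (simp add: left_diff_distrib)
    also have "\<bar>\<dots>\<bar> = \<bar>1 - 2 * p\<bar> * \<bar>H k X * H' k X\<bar>"
    proof -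
      have "(1 - p)^2 - p^2 = 1 - 2 * p" by (simp add: power2_eq_square algebra_simps)
      then show ?thesis by (simp only: abs_mult)
    qed
    also have "\<dots> \<le> 1 * \<bar>H k X * H' k X\<bar>" using p0 p1 by (intro mult_right_mono) auto
    finally show ?thesis
      using True z[of k] th \<beta>_pos[of n e k] by (simp add: add_increasing2)
  next
    case False
    have "flip_diff e (?t k) X = (of_bool (X (edge k)) - p)^2 * flip_diff e (\<lambda>X. H k X * H' k X) X"
      using False by (simp add: flip_diff_def right_diff_distrib)
    then have "\<bar>flip_diff e (?t k) X\<bar> = (of_bool (X (edge k)) - p)^2 * \<bar>flip_diff e (\<lambda>X. H k X * H' k X) X\<bar>"
      by (simp add: abs_mult)
    also have "\<dots> \<le> 1 * ((\<theta> * \<beta> n e k) * ?z k)"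
    proof (intro mult_mono flip_diff_product_le)
      show "(of_bool (X (edge k)) - p)^2 \<le> 1"
        using p0 p1 by (auto simp: abs_square_le_1)
      show "\<bar>flip_diff e (H k) X\<bar> \<le> \<theta> * \<beta> n e k" "\<bar>flip_diff e (H' k) X\<bar> \<le> \<theta> * \<beta> n e k"
        using H H' k e by (auto simp: arc_field_def)
    qed auto
    finally show ?thesis using False by simp
  qed
  have "flip_diff e (carre H H') X = (\<Sum>k\<in>arcs n. flip_diff e (?t k) X)"
    unfolding flip_diff_def carre_def by (rule sum_subtractf[symmetric])
  then have "\<bar>flip_diff e (carre H H') X\<bar> \<le> (\<Sum>k\<in>arcs n. \<bar>flip_diff e (?t k) X\<bar>)"
    by (simp only: sum_abs)
  also have "\<dots> \<le> (\<Sum>k\<in>arcs n. ?i k * \<bar>H k X * H' k X\<bar> + (\<theta> * \<beta> n e k) * ?z k)"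
    by (intro sum_mono tm)
  also have "\<dots> = (\<Sum>k\<in>arcs n. ?i k * \<bar>H k X * H' k X\<bar>) + \<theta> * (\<Sum>k\<in>arcs n. \<beta> n e k * ?z k)" (is "_ = ?a + \<theta> * ?b")
    by (simp add: sum.distrib sum_distrib_left mult.assoc)
  finally have "\<bar>flip_diff e (carre H H') X\<bar> \<le> ?a + \<theta> * ?b" .
  then have "(flip_diff e (carre H H') X)^2 \<le> (?a + \<theta> * ?b)^2"
    by (rule abs_le_square_iff[THEN iffD1, OF order_trans[OF _ abs_ge_self]])
  also have "\<dots> \<le> 2 * ?a^2 + 2 * \<theta>^2 * ?b^2"
    using sum_squares_bound[of ?a "\<theta> * ?b"] by (simp add: power2_sum power_mult_distrib)
  also have "\<dots> \<le> 2 * (2 * (\<Sum>k\<in>arcs n. ?i k * \<bar>H k X * H' k X\<bar>^2)) + 2 * \<theta>^2 * (6 * N^2 * (\<Sum>k\<in>arcs n. \<beta> n e k * (?z k)^2))"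
  proof (intro add_mono mult_left_mono)
    have "?a^2 \<le> (\<Sum>k\<in>arcs n. ?i k) * (\<Sum>k\<in>arcs n. ?i k * \<bar>H k X * H' k X\<bar>^2)"
      by (rule weighted_cauchy_schwarz) simp
    moreover have "(\<Sum>k\<in>arcs n. ?i k) = 2"
      using sum_arcs_edge(1)[OF e, of "\<lambda>_. 1"] sum_arcs_edge(2)[OF e] by simp
    ultimately show "?a^2 \<le> 2 * (\<Sum>k\<in>arcs n. ?i k * \<bar>H k X * H' k X\<bar>^2)" by simp
    have "?b^2 \<le> (\<Sum>k\<in>arcs n. \<beta> n e k) * (\<Sum>k\<in>arcs n. \<beta> n e k * (?z k)^2)"
      by (rule weighted_cauchy_schwarz) (rule less_imp_le[OF \<beta>_pos])
    also have "\<dots> \<le> 6 * N^2 * (\<Sum>k\<in>arcs n. \<beta> n e k * (?z k)^2)"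
      by (intro mult_right_mono sum_\<beta>_arcs e sum_nonneg mult_nonneg_nonneg less_imp_le[OF \<beta>_pos]) auto
    finally show "?b^2 \<le> 6 * N^2 * (\<Sum>k\<in>arcs n. \<beta> n e k * (?z k)^2)" .
  qed auto
  finally show ?thesis by (simp add: ac_simps)
qed

text \<open>
  The mean is of order \<open>\<theta>\<^sup>2 n\<^sup>5\<close>, so the relative fluctuation is of order \<open>n\<^sup>-\<^sup>1\<^sup>/\<^sup>2\<close>.
\<close>

lemma carre_variance:
  assumes H: "arc_field \<theta> H" and H': "arc_field \<theta> H'"
  shows "Ex (\<lambda>X. (carre H H' X - Ex (carre H H'))^2) \<le> 2000 * \<theta>^4 * N^9"
proof -
  let ?T = "carre H H'"
  have th: "0 \<le> \<theta>" using H by (simp add: arc_field_def)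
  let ?z = "\<lambda>e k X. \<bar>H k X\<bar> + \<bar>H' k X\<bar> + 2 * (\<theta> * \<beta> n e k)"
  have mz: "Ex (\<lambda>X. (?z e k X)^2) \<le> 90 * \<theta>^2 * N^3" if k: "k \<in> arcs n" for e k
  proof -
    have d2: "(\<theta> * \<beta> n e k)^2 \<le> 5 * \<theta>^2 * N^3"
      unfolding power_mult_distrib using mult_left_mono[OF \<beta>_sq_le[of e k], of "\<theta>^2"] by (simp add: ac_simps)
    have "Ex (\<lambda>X. (?z e k X)^2) \<le> Ex (\<lambda>X. 3 * (H k X)^2 + (3 * (H' k X)^2 + 12 * (\<theta> * \<beta> n e k)^2))"
    proof (rule Ex_mono)
      fix X
      have "(a + b + 2 * c)^2 \<le> 3 * a^2 + (3 * b^2 + 12 * c^2)" for a b c :: real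
      proof -
        have "0 \<le> (a - b)^2 + (a - 2 * c)^2 + (b - 2 * c)^2" by simp
        then show ?thesis by (simp add: power2_eq_square algebra_simps)
      qed
      from this[of "\<bar>H k X\<bar>" "\<bar>H' k X\<bar>" "\<theta> * \<beta> n e k"]
      show "(?z e k X)^2 \<le> 3 * (H k X)^2 + (3 * (H' k X)^2 + 12 * (\<theta> * \<beta> n e k)^2)" by simp
    qed
    also have "\<dots> = 3 * Ex (\<lambda>X. (H k X)^2) + (3 * Ex (\<lambda>X. (H' k X)^2) + 12 * (\<theta> * \<beta> n e k)^2)"
      unfolding Ex_add Ex_cmult by simp
    also have "\<dots> \<le> 3 * (5 * \<theta>^2 * N^3) + (3 * (5 * \<theta>^2 * N^3) + 12 * (5 * \<theta>^2 * N^3))"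
      by (intro add_mono mult_left_mono arc_field_moment2 H H' k d2) auto
    finally show ?thesis by simp
  qed
  have mp: "Ex (\<lambda>X. (H k X * H' k X)^2) \<le> 400 * \<theta>^4 * N^6" if k: "k \<in> arcs n" for k
  proof -
    have "Ex (\<lambda>X. (H k X * H' k X)^2) \<le> Ex (\<lambda>X. 1/2 * (H k X)^4 + 1/2 * (H' k X)^4)"
    proof (rule Ex_mono)
      fix X
      have "2 * (H k X)^2 * (H' k X)^2 \<le> ((H k X)^2)^2 + ((H' k X)^2)^2" by (rule sum_squares_bound)
      then show "(H k X * H' k X)^2 \<le> 1/2 * (H k X)^4 + 1/2 * (H' k X)^4"
        by (simp add: power_mult_distrib power_mult[symmetric])
    qed
    also have "\<dots> \<le> 1/2 * (400 * \<theta>^4 * N^6) + 1/2 * (400 * \<theta>^4 * N^6)"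
      unfolding Ex_add Ex_cmult by (intro add_mono mult_left_mono arc_field_moment4 H H' k) auto
    finally show ?thesis by simp
  qed
  have De: "Ex (\<lambda>X. (flip_diff e ?T X)^2) \<le> 7280 * \<theta>^4 * N^7" if e: "e \<in> V" for e
  proof -
    have "Ex (\<lambda>X. (flip_diff e ?T X)^2) \<le> Ex (\<lambda>X. 4 * (\<Sum>k\<in>arcs n. of_bool (edge k = e) * (H k X * H' k X)^2)
      + 12 * N^2 * \<theta>^2 * (\<Sum>k\<in>arcs n. \<beta> n e k * (?z e k X)^2))"
      by (rule Ex_mono) (rule carre_difference[OF H H' e])
    also have "\<dots> = 4 * (\<Sum>k\<in>arcs n. of_bool (edge k = e) * Ex (\<lambda>X. (H k X * H' k X)^2))
      + 12 * N^2 * \<theta>^2 * (\<Sum>k\<in>arcs n. \<beta> n e k * Ex (\<lambda>X. (?z e k X)^2))"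
      unfolding Ex_add Ex_cmult Ex_sum ..
    also have "\<dots> \<le> 4 * (\<Sum>k\<in>arcs n. of_bool (edge k = e) * (400 * \<theta>^4 * N^6))
      + 12 * N^2 * \<theta>^2 * (\<Sum>k\<in>arcs n. \<beta> n e k * (90 * \<theta>^2 * N^3))"
      by (intro add_mono mult_left_mono sum_mono mz mp less_imp_le[OF \<beta>_pos]) auto
    also have "\<dots> = 4 * (2 * (400 * \<theta>^4 * N^6)) + 12 * N^2 * \<theta>^2 * ((\<Sum>k\<in>arcs n. \<beta> n e k) * (90 * \<theta>^2 * N^3))"
      unfolding sum_arcs_edge(1)[OF e] using sum_arcs_edge(2)[OF e] by (simp add: sum_distrib_right)
    also have "\<dots> \<le> 4 * (2 * (400 * \<theta>^4 * N^6)) + 12 * N^2 * \<theta>^2 * ((6 * N^2) * (90 * \<theta>^2 * N^3))"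
      by (intro add_left_mono mult_left_mono mult_right_mono sum_\<beta>_arcs e) auto
    also have "\<dots> = 800 * \<theta>^4 * (4 * N^6) + 6480 * \<theta>^4 * N^7"
      by (simp add: eval_nat_numeral)
    also have "\<dots> \<le> 800 * \<theta>^4 * (N * N^6) + 6480 * \<theta>^4 * N^7"
      using N4 th by (intro add_right_mono mult_left_mono mult_right_mono) auto
    also have "\<dots> = 7280 * \<theta>^4 * N^7" by (simp add: eval_nat_numeral)
    finally show ?thesis .
  qed
  have "Ex (\<lambda>X. (?T X - Ex ?T)^2) = Ex (\<lambda>X. (?T X)^2) - (Ex ?T)^2"
  proof -
    have "(\<lambda>X. (?T X - Ex ?T)^2) = (\<lambda>X. (?T X)^2 + ((- 2 * Ex ?T) * ?T X + (Ex ?T)^2))"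
      by (auto simp: power2_diff algebra_simps)
    then show ?thesis by (simp only: Ex_add Ex_cmult) (simp add: power2_eq_square)
  qed
  also have "\<dots> \<le> (\<Sum>e\<in>V. Ex (\<lambda>X. (flip_diff e ?T X)^2)) / 4" by (rule poincare_V)
  also have "\<dots> \<le> (\<Sum>e\<in>V. 7280 * \<theta>^4 * N^7) / 4"
    by (intro divide_right_mono sum_mono De) auto
  also have "\<dots> = real (card V) * (1820 * \<theta>^4 * N^7)" by simp
  also have "\<dots> \<le> N^2 * (2000 * \<theta>^4 * N^7)"
    using th by (intro mult_mono card_V_le mult_right_mono) auto
  also have "\<dots> = 2000 * \<theta>^4 * N^9" by (simp add: eval_nat_numeral)
  finally show ?thesis .
qed

lemma carre_expectation:
  assumes H: "arc_field \<theta> H" and H': "arc_field \<theta>' H'"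
  shows "Ex (carre H H') = p * (1 - p) * (\<Sum>k\<in>arcs n. Ex (\<lambda>X. H k X * H' k X))"
proof -
  have "Ex (\<lambda>X. (of_bool (X (edge k)) - p)^2 * (H k X * H' k X)) = p * (1 - p) * Ex (\<lambda>X. H k X * H' k X)"
    if k: "k \<in> arcs n" for k
  proof -
    have g: "H k (X(edge k := b)) * H' k (X(edge k := b)) = H k X * H' k X" for X b
      using arc_field_same_edge[OF H k refl] arc_field_same_edge[OF H' k refl] by metis
    have "0 \<le> p" "p \<le> 1" using p0 p1 by auto
    from Ebern_centered_square[OF finite_vertex_pairs edge_in[OF k] this, of "\<lambda>X. H k X * H' k X", OF g]
    show ?thesis .
  qed
  then show ?thesis unfolding carre_def Ex_sum by (simp add: sum_distrib_left)
qed

text \<open>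
  Each factor is of order \<open>s = \<theta> n\<^sup>3\<^sup>/\<^sup>2\<close>; after division by \<open>s\<close> the cubic expression is at most \<open>1\<close> plus fourth powers.
\<close>

lemma third_moment_sum:
  assumes H: "arc_field \<theta> H" and H': "arc_field \<theta> H'" and H'': "arc_field \<theta> H''" and th: "0 < \<theta>"
  shows "(\<Sum>k\<in>arcs n. Ex (\<lambda>X. \<bar>H k X\<bar> * (\<bar>H' k X\<bar> + \<bar>H'' k X\<bar>)^2)) \<le> 7000 * \<theta>^3 * N^6 * sqrt N"
proof -
  define s where "s = \<theta> * (N * sqrt N)"
  have s: "0 < s" using th N4 by (simp add: s_def)
  have s4: "s^4 = \<theta>^4 * N^6"
  proof -
    have "(sqrt N)^4 = N^2" using power_mult[of "sqrt N" 2 2] by simp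
    then show ?thesis by (simp add: s_def power_mult_distrib; simp add: eval_nat_numeral)
  qed
  have "Ex (\<lambda>X. \<bar>H k X\<bar> * (\<bar>H' k X\<bar> + \<bar>H'' k X\<bar>)^2) \<le> 7000 * s^3" if k: "k \<in> arcs n" for k
  proof -
    have ineq: "x * (y + z)^2 \<le> 1 + (x^4 + (8 * y^4 + 8 * z^4))" if "0 \<le> x" "0 \<le> y" "0 \<le> z" for x y z :: real
    proof -
      let ?w = "y + z"
      have sq: "(a + b)^2 \<le> 2 * (a^2 + b^2)" for a b :: real
        using sum_squares_bound[of a b] by (simp add: power2_sum)
      have "?w^4 = (?w^2)^2" by (simp add: power_mult[symmetric])
      also have "\<dots> \<le> (2 * (y^2 + z^2))^2" by (intro power_mono sq) auto
      also have "\<dots> = 4 * (y^2 + z^2)^2" by (simp only: power_mult_distrib) simp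
      also have "\<dots> \<le> 4 * (2 * ((y^2)^2 + (z^2)^2))" by (intro mult_left_mono sq) simp
      finally have w4: "?w^4 \<le> 8 * y^4 + 8 * z^4" by (simp add: power_mult[symmetric])
      define m where "m = max x ?w"
      have m: "0 \<le> m" "x \<le> m" "?w \<le> m" using that by (auto simp: m_def)
      have "x * ?w^2 \<le> m * m^2" using that m by (intro mult_mono power_mono) auto
      also have "m * m^2 \<le> 1 + m^4"
      proof (cases "m \<le> 1")
        case True
        then have "m * m^2 \<le> 1" using m power_le_one[of m 3] by (simp add: eval_nat_numeral)
        then show ?thesis using m by (simp add: add_increasing2)
      next
        case False
        then have "m^3 \<le> m^4" by (intro power_increasing) auto
        then show ?thesis by (simp add: eval_nat_numeral)
      qed
      also have "m^4 \<le> x^4 + ?w^4" using that by (auto simp: m_def max_def)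
      finally show ?thesis using w4 by simp
    qed
    have "Ex (\<lambda>X. \<bar>H k X\<bar> * (\<bar>H' k X\<bar> + \<bar>H'' k X\<bar>)^2)
      \<le> Ex (\<lambda>X. s^3 + (1 / s * (H k X)^4 + (8 / s * (H' k X)^4 + 8 / s * (H'' k X)^4)))"
    proof (rule Ex_mono)
      fix X
      have "(\<bar>H k X\<bar> / s) * (\<bar>H' k X\<bar> / s + \<bar>H'' k X\<bar> / s)^2
        \<le> 1 + ((\<bar>H k X\<bar> / s)^4 + (8 * (\<bar>H' k X\<bar> / s)^4 + 8 * (\<bar>H'' k X\<bar> / s)^4))"
        using s by (intro ineq) auto
      then have "s^3 * ((\<bar>H k X\<bar> / s) * (\<bar>H' k X\<bar> / s + \<bar>H'' k X\<bar> / s)^2)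
        \<le> s^3 * (1 + ((\<bar>H k X\<bar> / s)^4 + (8 * (\<bar>H' k X\<bar> / s)^4 + 8 * (\<bar>H'' k X\<bar> / s)^4)))"
        using s by (intro mult_left_mono) auto
      also have "s^3 * ((\<bar>H k X\<bar> / s) * (\<bar>H' k X\<bar> / s + \<bar>H'' k X\<bar> / s)^2) = \<bar>H k X\<bar> * (\<bar>H' k X\<bar> + \<bar>H'' k X\<bar>)^2"
        using s by (simp add: add_divide_distrib[symmetric] power_divide eval_nat_numeral)
      also have "s^3 * (1 + ((\<bar>H k X\<bar> / s)^4 + (8 * (\<bar>H' k X\<bar> / s)^4 + 8 * (\<bar>H'' k X\<bar> / s)^4)))
        = s^3 + (1 / s * (H k X)^4 + (8 / s * (H' k X)^4 + 8 / s * (H'' k X)^4))"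
        using s by (simp add: power_divide distrib_left; simp add: eval_nat_numeral)
      finally show "\<bar>H k X\<bar> * (\<bar>H' k X\<bar> + \<bar>H'' k X\<bar>)^2 \<le> s^3 + (1 / s * (H k X)^4 + (8 / s * (H' k X)^4 + 8 / s * (H'' k X)^4))" .
    qed
    also have "\<dots> = s^3 + (1 / s * Ex (\<lambda>X. (H k X)^4) + (8 / s * Ex (\<lambda>X. (H' k X)^4) + 8 / s * Ex (\<lambda>X. (H'' k X)^4)))"
      unfolding Ex_add Ex_cmult by simp
    also have "\<dots> \<le> s^3 + (1 / s * (400 * \<theta>^4 * N^6) + (8 / s * (400 * \<theta>^4 * N^6) + 8 / s * (400 * \<theta>^4 * N^6)))"
      using s by (intro add_mono mult_left_mono arc_field_moment4 H H' H'' k) auto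
    also have "\<dots> = 6801 * s^3" using s unfolding mult.assoc[of 400] s4[symmetric] by (simp add: eval_nat_numeral)
    also have "\<dots> \<le> 7000 * s^3" using s by simp
    finally show ?thesis .
  qed
  then have "(\<Sum>k\<in>arcs n. Ex (\<lambda>X. \<bar>H k X\<bar> * (\<bar>H' k X\<bar> + \<bar>H'' k X\<bar>)^2)) \<le> real (card (arcs n)) * (7000 * s^3)"
    by (rule sum_bounded_above)
  also have "\<dots> \<le> N^2 * (7000 * s^3)" using s by (intro mult_right_mono card_arcs_le) auto
  also have "\<dots> = 7000 * \<theta>^3 * N^6 * sqrt N"
  proof -
    have "(sqrt N)^3 = N * sqrt N" by (simp add: power3_eq_cube)
    then show ?thesis by (simp add: s_def power_mult_distrib; simp add: eval_nat_numeral)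
  qed
  finally show ?thesis .
qed

end

section \<open>Four-cycles\<close>

lemma choose_four: "24 * real (n choose 4) = real n * (real n - 1) * (real n - 2) * (real n - 3)"
proof -
  have "real (n choose 4) = real n gchoose 4" by (simp add: binomial_gbinomial)
  also have "\<dots> = (\<Prod>i = 0..<4. real n - real i) / 24"
    by (simp add: gbinomial_prod_rev fact_numeral)
  also have "(\<Prod>i = 0..<4. real n - real i) = real n * (real n - 1) * (real n - 2) * (real n - 3)"
    by (simp add: eval_nat_numeral)
  finally show ?thesis by simp
qed

definition quads :: "nat \<Rightarrow> (nat \<times> nat \<times> nat \<times> nat) set" where
  "quads n = {(a, b, c, d). a < n \<and> b < n \<and> c < n \<and> d < n \<and> distinct [a, b, c, d]}"

text \<open>
  The possible inner vertices \<open>m = (c, d)\<close> of a path \<open>b, c, d, a\<close> that closes the arc \<open>k = (a, b)\<close> to a four-cycle.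
\<close>

definition tails :: "nat \<Rightarrow> nat \<times> nat \<Rightarrow> (nat \<times> nat) set" where
  "tails n k = {m. fst m < n \<and> snd m < n \<and> distinct [fst k, snd k, fst m, snd m]}"

lemma finite_tails[simp]: "finite (tails n k)"
  by (rule finite_subset[of _ "{..<n} \<times> {..<n}"]) (auto simp: tails_def)

lemma finite_quads[simp]: "finite (quads n)"
  by (rule finite_subset[of _ "{..<n} \<times> {..<n} \<times> {..<n} \<times> {..<n}"]) (auto simp: quads_def)

lemma sum_quads:
  "(\<Sum>(a, b, c, d)\<in>quads n. f a b c d) = (\<Sum>k\<in>arcs n. \<Sum>m\<in>tails n k. f (fst k) (snd k) (fst m) (snd m))"
proof -
  have "(\<Sum>k\<in>arcs n. \<Sum>m\<in>tails n k. f (fst k) (snd k) (fst m) (snd m))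
      = (\<Sum>(k, m)\<in>Sigma (arcs n) (tails n). f (fst k) (snd k) (fst m) (snd m))"
    by (rule sum.Sigma) auto
  also have "\<dots> = (\<Sum>(a, b, c, d)\<in>quads n. f a b c d)"
    by (rule sum.reindex_bij_witness[of _ "\<lambda>(a, b, c, d). ((a, b), (c, d))" "\<lambda>(k, m). (fst k, snd k, fst m, snd m)"])
       (auto simp: quads_def arcs_def tails_def)
  finally show ?thesis by simp
qed

lemma sum_quads_rotate:
  "(\<Sum>(a, b, c, d)\<in>quads n. f b c d a) = (\<Sum>(a, b, c, d)\<in>quads n. f a b c d)"
  by (rule sum.reindex_bij_witness[of _ "\<lambda>(a, b, c, d). (d, a, b, c)" "\<lambda>(a, b, c, d). (b, c, d, a)"])
     (auto simp: quads_def)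

lemma card_tails:
  assumes k: "k \<in> arcs n"
  shows "real (card (tails n k)) = (real n - 2) * (real n - 3)"
proof -
  let ?R = "{..<n} - {fst k, snd k}"
  have k2: "card {fst k, snd k} = 2" "{fst k, snd k} \<subseteq> {..<n}" using k by (auto simp: arcs_def)
  have n2: "2 \<le> n" using card_mono[OF _ k2(2)] k2(1) by simp
  have R: "card ?R = n - 2" using k2 by (simp add: card_Diff_subset)
  have "tails n k = ?R \<times> ?R - (\<lambda>a. (a, a)) ` ?R" using k by (auto simp: tails_def arcs_def)
  then have "card (tails n k) = card (?R \<times> ?R) - card ((\<lambda>a. (a, a)) ` ?R)"
    by (simp only:) (rule card_Diff_subset, auto)
  also have "\<dots> = (n - 2) * (n - 2) - (n - 2)" by (simp only: card_cartesian_product R) (simp add: card_image inj_on_def R)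
  also have "\<dots> = (n - 2) * (n - 2 - 1)" by (simp add: diff_mult_distrib2)
  finally have c: "card (tails n k) = (n - 2) * (n - 2 - 1)" .
  show ?thesis
  proof (cases "n = 2")
    case True then show ?thesis using c by simp
  next
    case False
    then have "3 \<le> n" using n2 by simp
    then show ?thesis unfolding c by (simp add: of_nat_diff)
  qed
qed

lemma T2_eq_sum_quads:
  "8 * T2 n G = (\<Sum>(a, b, c, d)\<in>quads n. of_bool ({a, b} \<in> G \<and> {b, c} \<in> G \<and> {c, d} \<in> G \<and> {d, a} \<in> G))"
proof -
  let ?Q = "{(a, b, c, d). (a, b, c, d) \<in> quads n \<and> {a, b} \<in> G \<and> {b, c} \<in> G \<and> {c, d} \<in> G \<and> {d, a} \<in> G}"
  have l4: "{..<4::nat} = {0, 1, 2, 3}" by auto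
  have "bij_betw (\<lambda>f. (f 0, f 1, f 2, f 3)) (inj_graph_homs {..<4} C4_edges {..<n} G) ?Q"
  proof (rule bij_betw_byWitness[where f' = "\<lambda>(a, b, c, d). (\<lambda>i\<in>{..<4}. [a, b, c, d] ! i)"])
    show "\<forall>f\<in>inj_graph_homs {..<4} C4_edges {..<n} G. (case (f 0, f 1, f 2, f 3) of (a, b, c, d) \<Rightarrow> \<lambda>i\<in>{..<4}. [a, b, c, d] ! i) = f"
    proof
      fix f assume "f \<in> inj_graph_homs {..<4} C4_edges {..<n} G"
      then have ext: "f i = undefined" if "i \<notin> {..<4}" for i
        using that by (auto simp: inj_graph_homs_def PiE_def extensional_def)
      show "(case (f 0, f 1, f 2, f 3) of (a, b, c, d) \<Rightarrow> \<lambda>i\<in>{..<4}. [a, b, c, d] ! i) = f"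
      proof
        fix i :: nat
        show "(case (f 0, f 1, f 2, f 3) of (a, b, c, d) \<Rightarrow> \<lambda>i\<in>{..<4}. [a, b, c, d] ! i) i = f i"
        proof (cases "i \<in> {..<4}")
          case True
          then have "i = 0 \<or> i = 1 \<or> i = 2 \<or> i = 3" by auto
          then show ?thesis by (auto simp: numeral_2_eq_2 numeral_3_eq_3)
        next
          case False
          then show ?thesis using ext[OF False] by simp
        qed
      qed
    qed
    show "\<forall>q\<in>?Q. (\<lambda>f. (f 0, f 1, f 2, f 3)) (case q of (a, b, c, d) \<Rightarrow> \<lambda>i\<in>{..<4}. [a, b, c, d] ! i) = q"
      by (auto simp: numeral_2_eq_2 numeral_3_eq_3)
    show "(\<lambda>f. (f 0, f 1, f 2, f 3)) ` inj_graph_homs {..<4} C4_edges {..<n} G \<subseteq> ?Q"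
    proof
      fix q assume "q \<in> (\<lambda>f. (f 0, f 1, f 2, f 3)) ` inj_graph_homs {..<4} C4_edges {..<n} G"
      then obtain f where f: "f \<in> {..<4} \<rightarrow>\<^sub>E {..<n}" "inj_on f {..<4}" "\<forall>e\<in>C4_edges. f ` e \<in> G" and q: "q = (f 0, f 1, f 2, f 3)"
        by (auto simp: inj_graph_homs_def)
      have "f i < n" if "i < 4" for i using f(1) that by (auto simp: PiE_def Pi_def)
      moreover have "distinct [f 0, f 1, f 2, f 3]"
        by (simp add: inj_on_eq_iff[OF f(2)])
      ultimately show "q \<in> ?Q" using f(3) by (simp add: q quads_def C4_edges_def)
    qed
    show "(\<lambda>(a, b, c, d). (\<lambda>i\<in>{..<4}. [a, b, c, d] ! i)) ` ?Q \<subseteq> inj_graph_homs {..<4} C4_edges {..<n} G"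
    proof
      fix f assume "f \<in> (\<lambda>(a, b, c, d). (\<lambda>i\<in>{..<4}. [a, b, c, d] ! i)) ` ?Q"
      then obtain a b c d where q: "(a, b, c, d) \<in> ?Q" and f: "f = (\<lambda>i\<in>{..<4}. [a, b, c, d] ! i)" by auto
      have fv: "f 0 = a" "f 1 = b" "f 2 = c" "f 3 = d" by (auto simp: f numeral_2_eq_2 numeral_3_eq_3)
      have "f \<in> {..<4} \<rightarrow>\<^sub>E {..<n}"
      proof (rule PiE_I)
        fix i :: nat assume "i \<in> {..<4}"
        then have "i = 0 \<or> i = 1 \<or> i = 2 \<or> i = 3" by auto
        then show "f i \<in> {..<n}" using q fv by (auto simp: quads_def)
      qed (simp add: f)
      moreover have "inj_on f {..<4}" unfolding l4 using q fv by (auto simp: inj_on_def quads_def)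
      moreover have "\<forall>e\<in>C4_edges. f ` e \<in> G" using q fv by (simp add: C4_edges_def)
      ultimately show "f \<in> inj_graph_homs {..<4} C4_edges {..<n} G" by (simp add: inj_graph_homs_def)
    qed
  qed
  then have "8 * T2 n G = real (card ?Q)" unfolding T2_def using bij_betw_same_card by force
  also have "\<dots> = (\<Sum>q\<in>?Q. 1)" by simp
  also have "\<dots> = (\<Sum>(a, b, c, d)\<in>quads n. of_bool ({a, b} \<in> G \<and> {b, c} \<in> G \<and> {c, d} \<in> G \<and> {d, a} \<in> G))"
    by (rule sum.mono_neutral_cong_left) auto
  finally show ?thesis .
qed

definition present :: "nat set set \<Rightarrow> (nat set \<Rightarrow> bool) \<Rightarrow> real" where
  "present S X = of_bool (\<forall>e\<in>S. X e)"

text \<open>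
  The first \<open>i\<close> edges of the path \<open>b, c, d, a\<close>, where \<open>k = (a, b)\<close> and \<open>m = (c, d)\<close>.
\<close>

definition path_edges :: "nat \<Rightarrow> nat \<times> nat \<Rightarrow> nat \<times> nat \<Rightarrow> nat set set" where
  "path_edges i k m = set (take i [{snd k, fst m}, {fst m, snd m}, {snd m, fst k}])"

lemma path_edges_simps:
  "path_edges (Suc 0) k m = {{snd k, fst m}}"
  "path_edges 2 k m = {{snd k, fst m}, {fst m, snd m}}"
  "path_edges 3 k m = {{snd k, fst m}, {fst m, snd m}, {snd m, fst k}}"
  by (auto simp: path_edges_def numeral_2_eq_2 numeral_3_eq_3)

lemma path_edges_subset: "path_edges i k m \<subseteq> {{snd k, fst m}, {fst m, snd m}, {snd m, fst k}}"
  unfolding path_edges_def by (rule order_trans[OF set_take_subset]) simp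

lemma present_mult: "present S X * present S' X = present (S \<union> S') X"
  by (auto simp: present_def)

lemma flip_diff_present: "\<bar>flip_diff e (present S) X\<bar> \<le> of_bool (e \<in> S)"
  by (auto simp: flip_diff_def present_def)

lemma present_update: "e \<notin> S \<Longrightarrow> present S (X(e := b)) = present S X"
  by (auto simp: present_def)

lemma path_avoids_edge: "k \<in> arcs n \<Longrightarrow> m \<in> tails n k \<Longrightarrow> edge k \<notin> path_edges i k m"
  using path_edges_subset[of i k m] by (auto simp: arcs_def tails_def edge_def doubleton_eq_iff dest!: subsetD)

lemma path_edges_in: "k \<in> arcs n \<Longrightarrow> m \<in> tails n k \<Longrightarrow> path_edges i k m \<subseteq> vertex_pairs n"
  by (rule order_trans[OF path_edges_subset]) (auto simp: arcs_def tails_def vertex_pairs_def)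

lemma card_path_edges:
  assumes "k \<in> arcs n" "m \<in> tails n k"
  shows "card (path_edges (Suc 0) k m) = 1" "card (path_edges 2 k m) = 2" "card (path_edges 3 k m) = 3"
  using assms by (auto simp: path_edges_simps arcs_def tails_def doubleton_eq_iff card_insert_if)

lemma path_incidence:
  assumes k: "k \<in> arcs n" and e: "e \<in> vertex_pairs n"
  shows "(\<Sum>m\<in>tails n k. of_bool (e \<in> path_edges i k m)) \<le> \<beta> n e k"
proof -
  have 1: "(\<Sum>m\<in>tails n k. of_bool (e = {snd k, fst m}) :: real) \<le> real n * of_bool (snd k \<in> e)"
  proof (cases "snd k \<in> e")
    case True
    have "card (tails n k \<inter> {m. e = {snd k, fst m}}) \<le> card {..<n}"
      by (rule card_inj_on_le[where f = snd]) (auto simp: tails_def inj_on_def doubleton_eq_iff)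
    then show ?thesis using True by simp
  qed (auto intro: sum_nonpos)
  have 3: "(\<Sum>m\<in>tails n k. of_bool (e = {snd m, fst k}) :: real) \<le> real n * of_bool (fst k \<in> e)"
  proof (cases "fst k \<in> e")
    case True
    have "card (tails n k \<inter> {m. e = {snd m, fst k}}) \<le> card {..<n}"
      by (rule card_inj_on_le[where f = fst]) (auto simp: tails_def inj_on_def doubleton_eq_iff)
    then show ?thesis using True by simp
  qed (auto intro: sum_nonpos)
  have 2: "(\<Sum>m\<in>tails n k. of_bool (e = {fst m, snd m}) :: real) \<le> 2"
  proof -
    have "tails n k \<inter> {m. e = {fst m, snd m}} \<subseteq> {m \<in> arcs n. edge m = e}"
      by (auto simp: tails_def arcs_def edge_def)
    from card_mono[OF _ this] have "card (tails n k \<inter> {m. e = {fst m, snd m}}) \<le> 2"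
      using sum_arcs_edge(2)[OF e] by simp
    then show ?thesis by simp
  qed
  have "(\<Sum>m\<in>tails n k. of_bool (e \<in> path_edges i k m) :: real)
    \<le> (\<Sum>m\<in>tails n k. of_bool (e = {snd k, fst m}) + (of_bool (e = {fst m, snd m}) + of_bool (e = {snd m, fst k})))"
  proof (rule sum_mono)
    fix m
    show "of_bool (e \<in> path_edges i k m) \<le> (of_bool (e = {snd k, fst m}) + (of_bool (e = {fst m, snd m}) + of_bool (e = {snd m, fst k})) :: real)"
      using path_edges_subset[of i k m] by auto
  qed
  also have "\<dots> \<le> real n * of_bool (snd k \<in> e) + (2 + real n * of_bool (fst k \<in> e))"
    unfolding sum.distrib by (intro add_mono 1 2 3)
  also have "\<dots> = \<beta> n e k" by (simp add: \<beta>_def algebra_simps)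
  finally show ?thesis .
qed

context gnp
begin

text \<open>
  The discrete derivative of the numerator of \<open>W\<^sub>2\<close> in the direction of the edge under \<open>k\<close>; see \<open>flip_diff_W2num\<close>.
\<close>

definition C4_gradient :: "nat \<times> nat \<Rightarrow> (nat set \<Rightarrow> bool) \<Rightarrow> real" where
  "C4_gradient k X = (\<Sum>m\<in>tails n k. present (path_edges 3 k m) X - p^3)"

text \<open>
  The coefficient of \<open>Y\<^sub>e\<close> in the telescoping expansion
  \<open>X\<^sub>1 X\<^sub>2 X\<^sub>3 X\<^sub>4 - p\<^sup>4 = Y\<^sub>1 X\<^sub>2 X\<^sub>3 X\<^sub>4 + p Y\<^sub>2 X\<^sub>3 X\<^sub>4 + p\<^sup>2 Y\<^sub>3 X\<^sub>4 + p\<^sup>3 Y\<^sub>4\<close>,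
  summed over all four-cycles and rotated so that each term starts with the arc \<open>k\<close>. The constants remove the linear
  part, and \<open>8\<close> is the number of symmetries of the four-cycle.
\<close>

definition C4_decoupler :: "nat \<times> nat \<Rightarrow> (nat set \<Rightarrow> bool) \<Rightarrow> real" where
  "C4_decoupler k X = (\<Sum>m\<in>tails n k. (present (path_edges 3 k m) X - p^3) + p * (present (path_edges 2 k m) X - p^2)
     + p^2 * (present (path_edges 1 k m) X - p^1)) / 8"

lemma Ex_present: "S \<subseteq> V \<Longrightarrow> Ex (present S) = p ^ card S"
proof -
  assume S: "S \<subseteq> V"
  then have "finite S" by (rule finite_subset) simp
  then show ?thesis using S
  proof (induction S rule: finite_induct)
    case empty
    then show ?case by (simp add: present_def)
  next
    case (insert e S)
    have e: "e \<in> V" using insert.prems by auto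
    have "Ex (present (insert e S)) = p * Ex (\<lambda>X. present (insert e S) (X(e := True))) + (1 - p) * Ex (\<lambda>X. present (insert e S) (X(e := False)))"
      using p0 p1 by (intro Ebern_cond e) auto
    also have "(\<lambda>X. present (insert e S) (X(e := False))) = (\<lambda>X. 0)" by (simp add: present_def)
    also have "(\<lambda>X. present (insert e S) (X(e := True))) = present S"
      using insert.hyps(2) by (auto simp: present_def fun_eq_iff)
    finally show ?case using insert by simp
  qed
qed

lemma Ex_const: "Ex (\<lambda>X. c) = c" by simp

lemma Ex_path: "k \<in> arcs n \<Longrightarrow> m \<in> tails n k \<Longrightarrow> Ex (present (path_edges i k m)) = p ^ card (path_edges i k m)"
  by (intro Ex_present path_edges_in)

lemma C4_gradient_mean: "k \<in> arcs n \<Longrightarrow> Ex (C4_gradient k) = 0"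
  unfolding C4_gradient_def[abs_def] Ex_sum Ex_diff by (simp add: Ex_path card_path_edges)

lemma C4_decoupler_mean: "k \<in> arcs n \<Longrightarrow> Ex (C4_decoupler k) = 0"
  unfolding C4_decoupler_def[abs_def] integral_divide_zero Ex_sum Ex_add Ex_diff Ex_cmult by (simp add: Ex_path card_path_edges)

lemma arc_field_C4_gradient: "arc_field 1 C4_gradient"
  unfolding arc_field_def
proof (intro conjI ballI allI)
  fix k X b assume k: "k \<in> arcs n"
  show "C4_gradient k (X(edge k := b)) = C4_gradient k X"
    unfolding C4_gradient_def by (intro sum.cong refl) (simp add: present_update path_avoids_edge[OF k])
next
  fix k e X assume k: "k \<in> arcs n" and e: "e \<in> V"
  have "flip_diff e (C4_gradient k) X = (\<Sum>m\<in>tails n k. flip_diff e (present (path_edges 3 k m)) X)"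
    unfolding flip_diff_def C4_gradient_def sum_subtractf[symmetric] by simp
  also have "\<bar>\<dots>\<bar> \<le> (\<Sum>m\<in>tails n k. of_bool (e \<in> path_edges 3 k m))"
    by (intro order_trans[OF sum_abs] sum_mono flip_diff_present)
  also have "\<dots> \<le> \<beta> n e k" by (rule path_incidence[OF k e])
  finally show "\<bar>flip_diff e (C4_gradient k) X\<bar> \<le> 1 * \<beta> n e k" by simp
qed (use N4 in \<open>auto simp: C4_gradient_mean\<close>)

lemma arc_field_C4_decoupler: "arc_field 1 C4_decoupler"
  unfolding arc_field_def
proof (intro conjI ballI allI)
  fix k X b assume k: "k \<in> arcs n"
  show "C4_decoupler k (X(edge k := b)) = C4_decoupler k X"
    unfolding C4_decoupler_def by (intro arg_cong[of _ _ "\<lambda>x. x / 8"] sum.cong refl) (simp add: present_update path_avoids_edge[OF k])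
next
  fix k e X assume k: "k \<in> arcs n" and e: "e \<in> V"
  let ?d = "\<lambda>i m. flip_diff e (present (path_edges i k m)) X"
  have D: "flip_diff e (C4_decoupler k) X = (\<Sum>m\<in>tails n k. ?d 3 m + p * ?d 2 m + p^2 * ?d 1 m) / 8"
    unfolding flip_diff_def C4_decoupler_def diff_divide_distrib[symmetric] sum_subtractf[symmetric]
    by (intro arg_cong[of _ _ "\<lambda>x. x / 8"] sum.cong refl) (simp add: algebra_simps)
  have "\<bar>\<Sum>m\<in>tails n k. ?d 3 m + p * ?d 2 m + p^2 * ?d 1 m\<bar>
    \<le> (\<Sum>m\<in>tails n k. of_bool (e \<in> path_edges 3 k m) + (of_bool (e \<in> path_edges 2 k m) + of_bool (e \<in> path_edges 1 k m)))"
  proof (intro order_trans[OF sum_abs] sum_mono)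
    fix m
    have "\<bar>p * ?d 2 m\<bar> \<le> 1 * of_bool (e \<in> path_edges 2 k m)"
      unfolding abs_mult using p0 p1 by (intro mult_mono flip_diff_present) auto
    moreover have "\<bar>p^2 * ?d 1 m\<bar> \<le> 1 * of_bool (e \<in> path_edges 1 k m)"
      unfolding abs_mult using p0 p1 by (intro mult_mono flip_diff_present) (auto simp: power_le_one)
    moreover have "\<bar>?d 3 m\<bar> \<le> of_bool (e \<in> path_edges 3 k m)" by (rule flip_diff_present)
    ultimately show "\<bar>?d 3 m + p * ?d 2 m + p^2 * ?d 1 m\<bar>
      \<le> of_bool (e \<in> path_edges 3 k m) + (of_bool (e \<in> path_edges 2 k m) + of_bool (e \<in> path_edges 1 k m))"
      by linarith
  qed
  also have "\<dots> \<le> \<beta> n e k + (\<beta> n e k + \<beta> n e k)"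
    unfolding sum.distrib by (intro add_mono path_incidence k e)
  finally show "\<bar>flip_diff e (C4_decoupler k) X\<bar> \<le> 1 * \<beta> n e k"
    unfolding D using \<beta>_pos[of n e k] by simp
qed (use N4 in \<open>auto simp: C4_decoupler_mean\<close>)

end

lemma sum_arcs_by_edge: "(\<Sum>e\<in>vertex_pairs n. \<Sum>k | k \<in> arcs n \<and> edge k = e. f k :: real) = (\<Sum>k\<in>arcs n. f k)"
  by (rule sum.group) (auto intro: edge_in)

context gnp
begin

definition graph :: "(nat set \<Rightarrow> bool) \<Rightarrow> nat set set" where
  "graph X = {e \<in> V. X e}"

lemma T1_graph: "2 * T1 (graph X) = (\<Sum>k\<in>arcs n. of_bool (X (edge k)))"
proof -
  have "T1 (graph X) = (\<Sum>e\<in>V. of_bool (X e))"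
    by (simp add: T1_def graph_def Int_def)
  moreover have "(\<Sum>k\<in>arcs n. of_bool (X (edge k)) :: real) = (\<Sum>e\<in>V. 2 * of_bool (X e))"
    unfolding sum_arcs_by_edge[symmetric]
  proof (rule sum.cong[OF refl])
    fix e assume e: "e \<in> V"
    have "(\<Sum>k | k \<in> arcs n \<and> edge k = e. of_bool (X (edge k)) :: real) = (\<Sum>k | k \<in> arcs n \<and> edge k = e. of_bool (X e))"
      by (rule sum.cong) auto
    then show "(\<Sum>k | k \<in> arcs n \<and> edge k = e. of_bool (X (edge k)) :: real) = 2 * of_bool (X e)"
      using sum_arcs_edge(2)[OF e] by simp
  qed
  ultimately show ?thesis by (simp add: sum_distrib_left)
qed

abbreviation xe :: "nat \<Rightarrow> nat \<Rightarrow> (nat set \<Rightarrow> bool) \<Rightarrow> real" where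
  "xe a b X \<equiv> of_bool (X {a, b})"

lemma T2_graph: "8 * T2 n (graph X) = (\<Sum>(a, b, c, d)\<in>quads n. xe a b X * xe b c X * xe c d X * xe d a X)"
  unfolding T2_eq_sum_quads
  by (intro sum.cong refl) (auto simp: quads_def graph_def vertex_pairs_def)

lemma sum_quads_arcs: "(\<Sum>(a, b, c, d)\<in>quads n. h {a, b} :: real) = (N - 2) * (N - 3) * (\<Sum>k\<in>arcs n. h (edge k))"
  unfolding sum_quads by (simp add: card_tails edge_def sum_distrib_left)

lemma choose_two_shift: "2 * real ((n - 2) choose 2) = (N - 2) * (N - 3)"
proof -
  have "real (n - 2) = N - 2" using n4 by (simp add: of_nat_diff)
  then show ?thesis using two_choose_two[of "n - 2"] by simp
qed

definition W2num :: "(nat set \<Rightarrow> bool) \<Rightarrow> real" where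
  "W2num X = T2 n (graph X) - 2 * real ((n - 2) choose 2) * p ^ 3 * T1 (graph X) + 9 * real (n choose 4) * p ^ 4"

lemma sum_quads_add: "(\<Sum>(a, b, c, d)\<in>quads n. f a b c d + g a b c d :: real) = (\<Sum>(a, b, c, d)\<in>quads n. f a b c d) + (\<Sum>(a, b, c, d)\<in>quads n. g a b c d)"
  by (simp add: split_def sum.distrib)

lemma present_path:
  "present (path_edges 3 k m) X = xe (snd k) (fst m) X * xe (fst m) (snd m) X * xe (snd m) (fst k) X"
  "present (path_edges 2 k m) X = xe (snd k) (fst m) X * xe (fst m) (snd m) X"
  "present (path_edges 1 k m) X = xe (snd k) (fst m) X"
  by (simp_all add: path_edges_simps present_def)

text \<open>
  The products are telescoped one edge at a time and then rotated so that the centred edge comes first.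
\<close>

lemma W2num_decoupled:
  "W2num X = (\<Sum>k\<in>arcs n. (of_bool (X (edge k)) - p) * C4_decoupler k X)"
proof -
  let ?y = "\<lambda>a b. xe a b X - p"
  have "8 * T2 n (graph X) = (\<Sum>(a, b, c, d)\<in>quads n. ?y a b * (xe b c X * xe c d X * xe d a X) + (p * (?y b c * (xe c d X * xe d a X))
      + (p^2 * (?y c d * xe d a X) + (p^3 * ?y d a + p^4))))"
    unfolding T2_graph by (intro sum.cong refl) (auto simp: algebra_simps power2_eq_square power3_eq_cube power4_eq_xxxx)
  also have "\<dots> = (\<Sum>(a, b, c, d)\<in>quads n. ?y a b * (xe b c X * xe c d X * xe d a X)) + ((\<Sum>(a, b, c, d)\<in>quads n. p * (?y b c * (xe c d X * xe d a X)))
      + ((\<Sum>(a, b, c, d)\<in>quads n. p^2 * (?y c d * xe d a X)) + ((\<Sum>(a, b, c, d)\<in>quads n. p^3 * ?y d a) + (\<Sum>(a, b, c, d)\<in>quads n. p^4))))"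
    by (simp only: sum_quads_add)
  also have "(\<Sum>(a, b, c, d)\<in>quads n. p * (?y b c * (xe c d X * xe d a X))) = (\<Sum>(a, b, c, d)\<in>quads n. p * (?y a b * (xe b c X * xe c d X)))"
    by (rule sum_quads_rotate)
  also have "(\<Sum>(a, b, c, d)\<in>quads n. p^2 * (?y c d * xe d a X)) = (\<Sum>(a, b, c, d)\<in>quads n. p^2 * (?y b c * xe c d X))"
    by (rule sum_quads_rotate)
  also have "\<dots> = (\<Sum>(a, b, c, d)\<in>quads n. p^2 * (?y a b * xe b c X))"
    by (rule sum_quads_rotate)
  also have "(\<Sum>(a, b, c, d)\<in>quads n. p^3 * ?y d a) = (\<Sum>(a, b, c, d)\<in>quads n. p^3 * ?y c d)"
    by (rule sum_quads_rotate)
  also have "\<dots> = (\<Sum>(a, b, c, d)\<in>quads n. p^3 * ?y b c)"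
    by (rule sum_quads_rotate)
  also have "\<dots> = (\<Sum>(a, b, c, d)\<in>quads n. p^3 * ?y a b)"
    by (rule sum_quads_rotate)
  finally have T: "8 * T2 n (graph X) = (\<Sum>(a, b, c, d)\<in>quads n. ?y a b * (xe b c X * xe c d X * xe d a X)) + ((\<Sum>(a, b, c, d)\<in>quads n. p * (?y a b * (xe b c X * xe c d X)))
      + ((\<Sum>(a, b, c, d)\<in>quads n. p^2 * (?y a b * xe b c X)) + ((\<Sum>(a, b, c, d)\<in>quads n. p^3 * ?y a b) + (\<Sum>(a, b, c, d)\<in>quads n. p^4))))" .
  have "8 * (\<Sum>k\<in>arcs n. (of_bool (X (edge k)) - p) * C4_decoupler k X)
    = (\<Sum>k\<in>arcs n. \<Sum>m\<in>tails n k. ?y (fst k) (snd k) * ((xe (snd k) (fst m) X * xe (fst m) (snd m) X * xe (snd m) (fst k) X - p^3)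
        + p * (xe (snd k) (fst m) X * xe (fst m) (snd m) X - p^2) + p^2 * (xe (snd k) (fst m) X - p)))"
    unfolding sum_distrib_left[of 8]
  proof (rule sum.cong[OF refl])
    fix k
    have r: "8 * (y * (z / 8)) = y * z" for y z :: real by simp
    show "8 * ((of_bool (X (edge k)) - p) * C4_decoupler k X) = (\<Sum>m\<in>tails n k. ?y (fst k) (snd k) * ((xe (snd k) (fst m) X * xe (fst m) (snd m) X * xe (snd m) (fst k) X - p^3)
        + p * (xe (snd k) (fst m) X * xe (fst m) (snd m) X - p^2) + p^2 * (xe (snd k) (fst m) X - p)))"
      unfolding C4_decoupler_def edge_def present_path r sum_distrib_left power_one_right ..
  qed
  also have "\<dots> = (\<Sum>(a, b, c, d)\<in>quads n. ?y a b * ((xe b c X * xe c d X * xe d a X - p^3) + p * (xe b c X * xe c d X - p^2) + p^2 * (xe b c X - p)))"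
    by (rule sum_quads[symmetric])
  also have "\<dots> = (\<Sum>(a, b, c, d)\<in>quads n. ?y a b * (xe b c X * xe c d X * xe d a X) + (p * (?y a b * (xe b c X * xe c d X))
      + (p^2 * (?y a b * xe b c X) + (- 3) * (p^3 * ?y a b))))"
    by (intro sum.cong refl) (auto simp: algebra_simps power2_eq_square power3_eq_cube)
  also have "\<dots> = (\<Sum>(a, b, c, d)\<in>quads n. ?y a b * (xe b c X * xe c d X * xe d a X)) + ((\<Sum>(a, b, c, d)\<in>quads n. p * (?y a b * (xe b c X * xe c d X)))
      + ((\<Sum>(a, b, c, d)\<in>quads n. p^2 * (?y a b * xe b c X)) + (\<Sum>(a, b, c, d)\<in>quads n. (- 3) * (p^3 * ?y a b))))"
    by (simp only: sum_quads_add)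
  finally have U: "8 * (\<Sum>k\<in>arcs n. (of_bool (X (edge k)) - p) * C4_decoupler k X) = \<dots>" .
  have s3: "(\<Sum>(a, b, c, d)\<in>quads n. p^3 * ?y a b) = (N - 2) * (N - 3) * (p^3 * (2 * T1 (graph X) - N * (N - 1) * p))"
  proof -
    have "(\<Sum>(a, b, c, d)\<in>quads n. p^3 * ?y a b) = (N - 2) * (N - 3) * (\<Sum>k\<in>arcs n. p^3 * (of_bool (X (edge k)) - p))"
      by (rule sum_quads_arcs[of "\<lambda>e. p^3 * (of_bool (X e) - p)"])
    also have "(\<Sum>k\<in>arcs n. p^3 * (of_bool (X (edge k)) - p)) = p^3 * ((\<Sum>k\<in>arcs n. of_bool (X (edge k))) - (\<Sum>k\<in>arcs n. p))"
      by (simp only: sum_distrib_left[symmetric] sum_subtractf)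
    also have "\<dots> = p^3 * (2 * T1 (graph X) - N * (N - 1) * p)"
      unfolding T1_graph by (simp add: card_arcs)
    finally show ?thesis .
  qed
  have s3': "(\<Sum>(a, b, c, d)\<in>quads n. (- 3) * (p^3 * ?y a b)) = (- 3) * (\<Sum>(a, b, c, d)\<in>quads n. p^3 * ?y a b)"
    by (simp add: sum_distrib_left split_def)
  have s4: "(\<Sum>(a, b, c, d)\<in>quads n. p^4) = N * (N - 1) * (N - 2) * (N - 3) * p^4"
  proof -
    have "(\<Sum>(a, b, c, d)\<in>quads n. p^4) = (N - 2) * (N - 3) * (\<Sum>k\<in>arcs n. p^4)"
      by (rule sum_quads_arcs[of "\<lambda>_. p^4"])
    then show ?thesis by (simp only: sum_constant card_arcs ac_simps)
  qed
  have c4: "N * (N - 1) * (N - 2) * (N - 3) = 24 * real (n choose 4)" by (rule choose_four[symmetric])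
  have "8 * (\<Sum>k\<in>arcs n. (of_bool (X (edge k)) - p) * C4_decoupler k X)
    = 8 * T2 n (graph X) - 4 * ((N - 2) * (N - 3) * (p^3 * (2 * T1 (graph X) - N * (N - 1) * p))) - N * (N - 1) * (N - 2) * (N - 3) * p^4"
    using T U s3 s3' s4 by linarith
  also have "\<dots> = 8 * T2 n (graph X) - 8 * ((N - 2) * (N - 3) * p^3 * T1 (graph X)) + 3 * (N * (N - 1) * (N - 2) * (N - 3)) * p^4"
    by (simp add: power3_eq_cube power4_eq_xxxx algebra_simps)
  also have "\<dots> = 8 * W2num X"
    unfolding c4 W2num_def choose_two_shift[symmetric] by (simp add: algebra_simps)
  finally show ?thesis by simp
qed

lemma flip_diff_four:
  assumes "distinct [e1, e2, e3, e4]"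
  shows "flip_diff e (\<lambda>X. of_bool (X e1) * of_bool (X e2) * of_bool (X e3) * of_bool (X e4)) X =
    of_bool (e = e1) * (of_bool (X e2) * of_bool (X e3) * of_bool (X e4)) + (of_bool (e = e2) * (of_bool (X e3) * of_bool (X e4) * of_bool (X e1))
    + (of_bool (e = e3) * (of_bool (X e4) * of_bool (X e1) * of_bool (X e2)) + of_bool (e = e4) * (of_bool (X e1) * of_bool (X e2) * of_bool (X e3))))"
  using assms by (auto simp: flip_diff_def)

lemma flip_diff_W2num:
  assumes k: "k \<in> arcs n"
  shows "flip_diff (edge k) W2num X = C4_gradient k X"
proof -
  let ?e = "edge k"
  let ?P = "\<lambda>a b c d. of_bool (?e = {a, b}) * (xe b c X * xe c d X * xe d a X)"
  have "8 * flip_diff ?e (\<lambda>X. T2 n (graph X)) X = flip_diff ?e (\<lambda>X. 8 * T2 n (graph X)) X"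
    by (simp add: flip_diff_def)
  also have "\<dots> = (\<Sum>(a, b, c, d)\<in>quads n. flip_diff ?e (\<lambda>X. xe a b X * xe b c X * xe c d X * xe d a X) X)"
    unfolding T2_graph flip_diff_def by (simp only: sum_subtractf[symmetric] split_def)
  also have "\<dots> = (\<Sum>(a, b, c, d)\<in>quads n. ?P a b c d + (?P b c d a + (?P c d a b + ?P d a b c)))"
  proof (intro sum.cong refl, clarify)
    fix a b c d assume q: "(a, b, c, d) \<in> quads n"
    have "distinct [{a, b}, {b, c}, {c, d}, {d, a}]" using q by (auto simp: quads_def doubleton_eq_iff)
    from flip_diff_four[OF this] show "flip_diff ?e (\<lambda>X. xe a b X * xe b c X * xe c d X * xe d a X) X = ?P a b c d + (?P b c d a + (?P c d a b + ?P d a b c))" .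
  qed
  also have "\<dots> = (\<Sum>(a, b, c, d)\<in>quads n. ?P a b c d) + ((\<Sum>(a, b, c, d)\<in>quads n. ?P b c d a) + ((\<Sum>(a, b, c, d)\<in>quads n. ?P c d a b) + (\<Sum>(a, b, c, d)\<in>quads n. ?P d a b c)))"
    by (simp only: sum_quads_add)
  also have "(\<Sum>(a, b, c, d)\<in>quads n. ?P d a b c) = (\<Sum>(a, b, c, d)\<in>quads n. ?P c d a b)" by (rule sum_quads_rotate)
  also have "(\<Sum>(a, b, c, d)\<in>quads n. ?P c d a b) = (\<Sum>(a, b, c, d)\<in>quads n. ?P b c d a)" by (rule sum_quads_rotate)
  also have "(\<Sum>(a, b, c, d)\<in>quads n. ?P b c d a) = (\<Sum>(a, b, c, d)\<in>quads n. ?P a b c d)" by (rule sum_quads_rotate)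
  finally have D1: "2 * flip_diff ?e (\<lambda>X. T2 n (graph X)) X = (\<Sum>(a, b, c, d)\<in>quads n. ?P a b c d)" by simp
  let ?h = "\<lambda>k'. \<Sum>m\<in>tails n k'. present (path_edges 3 k' m) X"
  have "(\<Sum>(a, b, c, d)\<in>quads n. ?P a b c d) = (\<Sum>k'\<in>arcs n. of_bool (edge k' = ?e) * ?h k')"
    unfolding sum_quads sum_distrib_left
    by (intro sum.cong refl) (auto simp: edge_def path_edges_simps present_def)
  also have "\<dots> = (\<Sum>k' | k' \<in> arcs n \<and> edge k' = ?e. ?h k')"
    by (rule sum_arcs_edge(1)[OF edge_in[OF k]])
  also have "{k'. k' \<in> arcs n \<and> edge k' = ?e} = {k, (snd k, fst k)}"
    using k by (auto simp: arcs_def edge_def doubleton_eq_iff)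
  also have "(\<Sum>k'\<in>{k, (snd k, fst k)}. ?h k') = ?h k + ?h (snd k, fst k)"
    using k by (auto simp: arcs_def)
  also have "?h (snd k, fst k) = ?h k"
    by (rule sum.reindex_bij_witness[of _ "\<lambda>m. (snd m, fst m)" "\<lambda>m. (snd m, fst m)"])
       (auto simp: tails_def path_edges_simps present_def insert_commute)
  finally have D2: "flip_diff ?e (\<lambda>X. T2 n (graph X)) X = ?h k" using D1 by simp
  have D3: "flip_diff ?e (\<lambda>X. T1 (graph X)) X = 1"
  proof -
    have "2 * flip_diff ?e (\<lambda>X. T1 (graph X)) X = flip_diff ?e (\<lambda>X. 2 * T1 (graph X)) X" by (simp add: flip_diff_def)
    also have "\<dots> = (\<Sum>k'\<in>arcs n. of_bool (edge k' = ?e) * 1)"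
      unfolding T1_graph flip_diff_def sum_subtractf[symmetric] by (intro sum.cong refl) auto
    also have "\<dots> = 2"
      unfolding sum_arcs_edge(1)[OF edge_in[OF k]] using sum_arcs_edge(2)[OF edge_in[OF k]] by simp
    finally show ?thesis by simp
  qed
  have "flip_diff ?e W2num X = flip_diff ?e (\<lambda>X. T2 n (graph X)) X - 2 * real ((n - 2) choose 2) * p ^ 3 * flip_diff ?e (\<lambda>X. T1 (graph X)) X"
    by (simp add: flip_diff_def W2num_def algebra_simps)
  also have "\<dots> = C4_gradient k X"
    unfolding D2 D3 choose_two_shift C4_gradient_def by (simp add: sum_subtractf card_tails[OF k])
  finally show ?thesis .
qed

text \<open>
  The covariance of the events that the first \<open>i\<close> edges of the path of \<open>m\<close>, and all edges of the path of \<open>m'\<close>, are present.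
\<close>

definition excess :: "nat \<Rightarrow> nat \<times> nat \<Rightarrow> nat \<times> nat \<Rightarrow> nat \<times> nat \<Rightarrow> real" where
  "excess i k m m' = p ^ card (path_edges i k m \<union> path_edges 3 k m') - p ^ (i + 3)"

lemma path_covariance:
  assumes k: "k \<in> arcs n" and m: "m \<in> tails n k" "m' \<in> tails n k" and i: "i \<in> {1, 2, 3}"
  shows "Ex (\<lambda>X. (present (path_edges i k m) X - p ^ i) * (present (path_edges 3 k m') X - p ^ 3)) = excess i k m m'"
proof -
  have c: "card (path_edges i k m) = i" using card_path_edges[OF k m(1)] i by auto
  have "(\<lambda>X. (present (path_edges i k m) X - p ^ i) * (present (path_edges 3 k m') X - p ^ 3))
    = (\<lambda>X. present (path_edges i k m \<union> path_edges 3 k m') X + ((- (p ^ 3)) * present (path_edges i k m) X + ((- (p ^ i)) * present (path_edges 3 k m') X + p ^ (i + 3))))"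
    by (rule ext) (simp add: present_mult[symmetric] power_add algebra_simps)
  then have "Ex (\<lambda>X. (present (path_edges i k m) X - p ^ i) * (present (path_edges 3 k m') X - p ^ 3))
    = Ex (present (path_edges i k m \<union> path_edges 3 k m')) + ((- (p ^ 3)) * Ex (present (path_edges i k m)) + ((- (p ^ i)) * Ex (present (path_edges 3 k m')) + p ^ (i + 3)))"
    by (simp only: Ex_add Ex_cmult Ex_const)
  also have "\<dots> = p ^ card (path_edges i k m \<union> path_edges 3 k m') + ((- (p ^ 3)) * p ^ i + ((- (p ^ i)) * p ^ 3 + p ^ (i + 3)))"
    using m k by (simp only: Ex_path card_path_edges(3) c) (simp add: Ex_present path_edges_in)
  also have "\<dots> = excess i k m m'" by (simp add: excess_def power_add)
  finally show ?thesis .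
qed

definition gain :: "nat \<times> nat \<Rightarrow> nat \<times> nat \<Rightarrow> nat \<times> nat \<Rightarrow> real" where
  "gain k m m' = excess 3 k m m' + p * excess 2 k m m' + p^2 * excess 1 k m m'"

lemma card_path_overlap:
  assumes a: "distinct [a, b, c, d]"
  shows "card (path_edges 3 (a, b) (c, d) \<union> path_edges 3 (a, b) (c, d)) = 3"
    "card (path_edges 2 (a, b) (c, d) \<union> path_edges 3 (a, b) (c, d)) = 3"
    "card (path_edges (Suc 0) (a, b) (c, d) \<union> path_edges 3 (a, b) (c, d)) = 3"
    "card (path_edges 3 (a, b) (c, d) \<union> path_edges 3 (a, b) (d, c)) = 5"
    "card (path_edges 2 (a, b) (c, d) \<union> path_edges 3 (a, b) (d, c)) = 4"
    "card (path_edges (Suc 0) (a, b) (c, d) \<union> path_edges 3 (a, b) (d, c)) = 4"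
    "f \<notin> {a, b, c, d} \<Longrightarrow> card (path_edges 3 (a, b) (c, d) \<union> path_edges 3 (a, b) (c, f)) = 5"
    "f \<notin> {a, b, c, d} \<Longrightarrow> card (path_edges 2 (a, b) (c, d) \<union> path_edges 3 (a, b) (c, f)) = 4"
    "f \<notin> {a, b, c, d} \<Longrightarrow> card (path_edges (Suc 0) (a, b) (c, d) \<union> path_edges 3 (a, b) (c, f)) = 3"
    "f \<notin> {a, b, c, d} \<Longrightarrow> card (path_edges 3 (a, b) (c, d) \<union> path_edges 3 (a, b) (f, d)) = 5"
    "f \<notin> {a, b, c, d} \<Longrightarrow> card (path_edges 2 (a, b) (c, d) \<union> path_edges 3 (a, b) (f, d)) = 5"
    "f \<notin> {a, b, c, d} \<Longrightarrow> card (path_edges (Suc 0) (a, b) (c, d) \<union> path_edges 3 (a, b) (f, d)) = 4"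
  using a by (auto simp: path_edges_simps doubleton_eq_iff card_insert_if)

lemma gain_disjoint:
  assumes "distinct [a, b, c, d]" "distinct [a, b, c', d']" "c' \<noteq> c" "d' \<noteq> d" "(c', d') \<noteq> (d, c)"
  shows "gain (a, b) (c, d) (c', d') = 0"
proof -
  have "card (path_edges 3 (a, b) (c, d) \<union> path_edges 3 (a, b) (c', d')) = 6"
    "card (path_edges 2 (a, b) (c, d) \<union> path_edges 3 (a, b) (c', d')) = 5"
    "card (path_edges (Suc 0) (a, b) (c, d) \<union> path_edges 3 (a, b) (c', d')) = 4"
    using assms by (auto simp: path_edges_simps doubleton_eq_iff card_insert_if)
  then show ?thesis by (simp add: gain_def excess_def)
qed

text \<open>
  Only paths that share an edge with the path of \<open>m = (c, d)\<close> contribute: \<open>(c, d)\<close> itself, its reversal \<open>(d, c)\<close>,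
  which shares the middle edge, and the \<open>n - 4\<close> paths \<open>(c, f)\<close> and \<open>(f, d)\<close> each, which share the first or last edge.
\<close>

lemma sum_gain:
  assumes k: "k \<in> arcs n" and m: "m \<in> tails n k"
  shows "(\<Sum>m'\<in>tails n k. gain k m m') = p^3 * (1 - p) * (1 + 2 * p + (4 * N - 11) * p^2)"
proof -
  obtain a b c d where kk: "k = (a, b)" and mm: "m = (c, d)" by (cases k, cases m) auto
  have dist: "distinct [a, b, c, d]" and lt: "a < n" "b < n" "c < n" "d < n"
    using k m by (auto simp: kk mm arcs_def tails_def)
  let ?R = "{..<n} - {a, b, c, d}"
  let ?g = "gain (a, b) (c, d)"
  have "card {a, b, c, d} = 4" using dist by simp
  moreover have "{a, b, c, d} \<subseteq> {..<n}" using lt by auto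
  ultimately have "card ?R = n - 4" by (subst card_Diff_subset) auto
  then have R: "real (card ?R) = N - 4" using n4 by (simp add: of_nat_diff)
  let ?A = "{(c, d)} \<union> ({(d, c)} \<union> (Pair c ` ?R \<union> (\<lambda>f. (f, d)) ` ?R))"
  have sub: "?A \<subseteq> tails n k" using dist lt by (auto simp: tails_def kk)
  have "(\<Sum>m'\<in>tails n k. ?g m') = (\<Sum>m'\<in>?A. ?g m')"
  proof (rule sum.mono_neutral_right[OF finite_tails sub], rule ballI)
    fix m' assume m': "m' \<in> tails n k - ?A"
    obtain c' d' where mm': "m' = (c', d')" by (cases m')
    show "?g m' = 0" unfolding mm'
      by (rule gain_disjoint) (use m' dist in \<open>auto simp: mm' tails_def kk\<close>)
  qed
  also have "\<dots> = ?g (c, d) + (?g (d, c) + ((\<Sum>f\<in>?R. ?g (c, f)) + (\<Sum>f\<in>?R. ?g (f, d))))"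
  proof -
    have "(\<Sum>m'\<in>Pair c ` ?R. ?g m') = (\<Sum>f\<in>?R. ?g (c, f))" by (subst sum.reindex) (auto simp: inj_on_def)
    moreover have "(\<Sum>m'\<in>(\<lambda>f. (f, d)) ` ?R. ?g m') = (\<Sum>f\<in>?R. ?g (f, d))" by (subst sum.reindex) (auto simp: inj_on_def)
    moreover have "(\<Sum>m'\<in>?A. ?g m') = ?g (c, d) + (\<Sum>m'\<in>{(d, c)} \<union> (Pair c ` ?R \<union> (\<lambda>f. (f, d)) ` ?R). ?g m')"
      by (subst sum.union_disjoint) (use dist in auto)
    moreover have "(\<Sum>m'\<in>{(d, c)} \<union> (Pair c ` ?R \<union> (\<lambda>f. (f, d)) ` ?R). ?g m') = ?g (d, c) + (\<Sum>m'\<in>Pair c ` ?R \<union> (\<lambda>f. (f, d)) ` ?R. ?g m')"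
      by (subst sum.union_disjoint) (use dist in auto)
    moreover have "(\<Sum>m'\<in>Pair c ` ?R \<union> (\<lambda>f. (f, d)) ` ?R. ?g m') = (\<Sum>m'\<in>Pair c ` ?R. ?g m') + (\<Sum>m'\<in>(\<lambda>f. (f, d)) ` ?R. ?g m')"
      by (rule sum.union_disjoint) (use dist in auto)
    ultimately show ?thesis by simp
  qed
  also have "?g (c, d) = (p^3 - p^6) + p * (p^3 - p^5) + p^2 * (p^3 - p^4)"
    using card_path_overlap(1)[OF dist] by (simp add: gain_def excess_def card_path_overlap[OF dist])
  also have "?g (d, c) = (p^5 - p^6) + p * (p^4 - p^5)"
    by (simp add: gain_def excess_def card_path_overlap[OF dist])
  also have "(\<Sum>f\<in>?R. ?g (c, f)) = (\<Sum>f\<in>?R. (p^5 - p^6) + p * (p^4 - p^5) + p^2 * (p^3 - p^4))"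
    by (intro sum.cong refl) (simp add: gain_def excess_def card_path_overlap[OF dist])
  also have "(\<Sum>f\<in>?R. ?g (f, d)) = (\<Sum>f\<in>?R. p^5 - p^6)"
    by (intro sum.cong refl) (simp add: gain_def excess_def card_path_overlap[OF dist])
  also have "(p^3 - p^6) + p * (p^3 - p^5) + p^2 * (p^3 - p^4) + ((p^5 - p^6) + p * (p^4 - p^5) +
      ((\<Sum>f\<in>?R. (p^5 - p^6) + p * (p^4 - p^5) + p^2 * (p^3 - p^4)) + (\<Sum>f\<in>?R. p^5 - p^6)))
    = p^3 * (1 - p) * (1 + 2 * p + (4 * N - 11) * p^2)"
    unfolding sum_constant R by (simp add: eval_nat_numeral algebra_simps)
  finally show ?thesis by (simp add: kk mm)
qed

lemma C4_decoupler_gradient_expectation: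
  assumes k: "k \<in> arcs n"
  shows "Ex (\<lambda>X. C4_decoupler k X * C4_gradient k X) = (N - 2) * (N - 3) * (p^3 * (1 - p) * (1 + 2 * p + (4 * N - 11) * p^2)) / 8"
proof -
  let ?i = "\<lambda>i m X. present (path_edges i k m) X - p ^ i"
  have "(\<lambda>X. C4_decoupler k X * C4_gradient k X) = (\<lambda>X. (1 / 8) * (\<Sum>m\<in>tails n k. \<Sum>m'\<in>tails n k.
      ?i 3 m X * ?i 3 m' X + (p * (?i 2 m X * ?i 3 m' X) + p^2 * (?i 1 m X * ?i 3 m' X))))"
  proof
    fix X
    have "C4_decoupler k X * C4_gradient k X = (1 / 8) * ((\<Sum>m\<in>tails n k. ?i 3 m X + p * ?i 2 m X + p^2 * ?i 1 m X) * (\<Sum>m'\<in>tails n k. ?i 3 m' X))"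
      by (simp add: C4_decoupler_def C4_gradient_def)
    also have "\<dots> = (1 / 8) * (\<Sum>m\<in>tails n k. \<Sum>m'\<in>tails n k.
      ?i 3 m X * ?i 3 m' X + (p * (?i 2 m X * ?i 3 m' X) + p^2 * (?i 1 m X * ?i 3 m' X)))"
      unfolding sum_product by (intro arg_cong[of _ _ "\<lambda>x. 1 / 8 * x"] sum.cong refl) (simp add: algebra_simps)
    finally show "C4_decoupler k X * C4_gradient k X = (1 / 8) * (\<Sum>m\<in>tails n k. \<Sum>m'\<in>tails n k.
      ?i 3 m X * ?i 3 m' X + (p * (?i 2 m X * ?i 3 m' X) + p^2 * (?i 1 m X * ?i 3 m' X)))" .
  qed
  then have "Ex (\<lambda>X. C4_decoupler k X * C4_gradient k X) = (1 / 8) * (\<Sum>m\<in>tails n k. \<Sum>m'\<in>tails n k.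
      Ex (\<lambda>X. ?i 3 m X * ?i 3 m' X) + (p * Ex (\<lambda>X. ?i 2 m X * ?i 3 m' X) + p^2 * Ex (\<lambda>X. ?i 1 m X * ?i 3 m' X)))"
    by (simp only: Ex_cmult Ex_sum Ex_add)
  also have "\<dots> = (1 / 8) * (\<Sum>m\<in>tails n k. \<Sum>m'\<in>tails n k. gain k m m')"
  proof (intro arg_cong[of _ _ "\<lambda>x. 1 / 8 * x"] sum.cong refl)
    fix m m' assume m: "m \<in> tails n k" "m' \<in> tails n k"
    have i: "1 \<in> {1, 2, 3::nat}" "2 \<in> {1, 2, 3::nat}" "3 \<in> {1, 2, 3::nat}" by auto
    show "Ex (\<lambda>X. ?i 3 m X * ?i 3 m' X) + (p * Ex (\<lambda>X. ?i 2 m X * ?i 3 m' X) + p^2 * Ex (\<lambda>X. ?i 1 m X * ?i 3 m' X)) = gain k m m'"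
      unfolding path_covariance[OF k m i(1)] path_covariance[OF k m i(2)] path_covariance[OF k m i(3)] gain_def
      by (rule add.assoc[symmetric])
  qed
  also have "\<dots> = (1 / 8) * (real (card (tails n k)) * (p^3 * (1 - p) * (1 + 2 * p + (4 * N - 11) * p^2)))"
    by (simp add: sum_gain[OF k])
  finally show ?thesis unfolding card_tails[OF k] by simp
qed

end

section \<open>The distance bound for the random graph\<close>

lemma frontier_null: 
  fixes A :: "(real \<times> real) set"
  assumes "convex A"
  shows "gauss (frontier A) = 0"
proof -
  have "negligible (frontier A)"
    using assms by (rule negligible_convex_frontier)
  then have "frontier A \<in> null_sets lborel"
    by (simp add: negligible_iff_null_sets null_sets_completion_iff)
  moreover have "absolutely_continuous lborel std_bivariate_normal"
    unfolding std_bivariate_normal_def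
    by (rule absolutely_continuousI_density) (simp add: lborel_prod[symmetric])
  ultimately have "frontier A \<in> null_sets std_bivariate_normal"
    by (auto simp: absolutely_continuous_def)
  then show ?thesis by (auto simp: measure_def)
qed

text \<open>
  The frontier of a convex set is a null set, so from below the set may be replaced by its interior and from above
  by the hull of the atoms of \<open>W\<close> in it; both are Borel.
\<close>

lemma completion_gap_le:
  fixes W :: "'a \<Rightarrow> real \<times> real"
  assumes fin: "finite (set_pmf D)" and A: "convex A"
  shows "\<bar>measure_pmf.prob D {\<omega>. W \<omega> \<in> A} - measure (completion std_bivariate_normal) A\<bar> \<le> convex_gap D W"
proof -
  interpret C: prob_space "completion std_bivariate_normal"
    by (rule gauss.prob_space_completion)
  let ?c = "measure (completion std_bivariate_normal)"
  have AC: "A \<in> sets (completion std_bivariate_normal)"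
    using A by (rule sets_completion_std_bivariate_normal)
  have bor: "?c B = gauss B" "B \<in> sets (completion std_bivariate_normal)" if "B \<in> sets borel" for B
    using that by simp_all
  let ?H = "convex hull (A \<inter> W ` set_pmf D)"
  have "compact ?H" using fin by (intro finite_imp_compact_convex_hull) auto
  then have Hb: "?H \<in> sets borel" by (simp add: borel_compact)
  have "?H \<subseteq> A" by (rule hull_minimal) (use A in auto)
  then have 1: "gauss ?H \<le> ?c A"
    using C.finite_measure_mono[OF _ AC] bor(1)[OF Hb] by metis
  have 2: "measure_pmf.prob D {\<omega>. W \<omega> \<in> A} \<le> measure_pmf.prob D {\<omega>. W \<omega> \<in> ?H}"
    by (rule prob_le_prob_hull)
  have 3: "?c A \<le> gauss (interior A)"
  proof -
    have "A \<subseteq> interior A \<union> frontier A" using closure_subset[of A] by (auto simp: frontier_def)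
    then have "?c A \<le> ?c (interior A \<union> frontier A)"
      by (rule C.finite_measure_mono) (auto intro!: bor(2))
    also have "\<dots> = gauss (interior A \<union> frontier A)" by (rule bor(1)) auto
    also have "\<dots> \<le> gauss (interior A) + gauss (frontier A)" by (rule measure_Un_le) auto
    finally show ?thesis using frontier_null[OF A] by simp
  qed
  have 4: "measure_pmf.prob D {\<omega>. W \<omega> \<in> interior A} \<le> measure_pmf.prob D {\<omega>. W \<omega> \<in> A}"
    by (rule measure_pmf.finite_measure_mono) (use interior_subset[of A] in auto)
  have "\<bar>measure_pmf.prob D {\<omega>. W \<omega> \<in> ?H} - gauss ?H\<bar> \<le> convex_gap D W"
    by (rule convex_gap_upper[OF Hb convex_convex_hull])
  moreover have "\<bar>measure_pmf.prob D {\<omega>. W \<omega> \<in> interior A} - gauss (interior A)\<bar> \<le> convex_gap D W"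
    by (rule convex_gap_upper) (auto intro: convex_interior A)
  ultimately show ?thesis using 1 2 3 4 by linarith
qed

lemma convex_dist_le_gap:
  assumes fin: "finite (set_pmf D)"
  shows "convex_dist (measure_pmf (map_pmf W D)) std_bivariate_normal \<le> convex_gap D W"
  unfolding convex_dist_def
proof (rule cSUP_least)
  fix A :: "(real \<times> real) set" assume "A \<in> {A. convex A}"
  moreover have "measure (completion (measure_pmf (map_pmf W D))) A = measure_pmf.prob D {\<omega>. W \<omega> \<in> A}"
    by (simp add: vimage_def)
  ultimately show "\<bar>measure (completion (measure_pmf (map_pmf W D))) A - measure (completion std_bivariate_normal) A\<bar> \<le> convex_gap D W"
    using completion_gap_le[OF fin] by simp
qed (auto intro: convex_empty)

context gnp
begin

text \<open>
  The loss in \<open>p\<close>; it comes from \<open>\<sigma>\<^sub>2\<^sup>2 \<ge> n\<^sup>5 / (10 L)\<^sup>2\<close>.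
\<close>

definition L :: real where "L = 1 / (p ^ 3 * (1 - p))"

text \<open>
  The common scale of the four functions on arcs \<open>U1\<close>, \<open>D1\<close>, \<open>U2\<close>, \<open>D2\<close>; it dominates \<open>1 / \<sigma>\<^sub>2\<close>, and \<open>\<theta> n\<^sup>3\<^sup>/\<^sup>2\<close> dominates \<open>1 / \<sigma>\<^sub>1\<close>.
\<close>

definition \<theta> :: real where "\<theta> = 10 * L / (N^2 * sqrt N)"

lemma q_pos: "0 < p ^ 3 * (1 - p)" "p ^ 3 * (1 - p) \<le> 1"
proof -
  have "p ^ 3 * (1 - p) \<le> 1 * 1"
    using p0 p1 by (intro mult_mono power_le_one) auto
  then show "p ^ 3 * (1 - p) \<le> 1" by simp
qed (use p0 p1 in simp)

lemma L_ge: "1 \<le> L"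
  unfolding L_def using q_pos by simp

lemma \<theta>_pos: "0 < \<theta>"
  unfolding \<theta>_def using L_ge N4 by simp

abbreviation s1 where "s1 \<equiv> sigma1 n p"
abbreviation s2 where "s2 \<equiv> sigma2 n p"

lemma s1_sq: "s1^2 = N * (N - 1) * (p * (1 - p)) / 2"
proof -
  have "0 \<le> real (n choose 2) * p * (1 - p)" using p0 p1 by simp
  then have "s1^2 = real (n choose 2) * p * (1 - p)" by (simp add: sigma1_def)
  moreover have "real (n choose 2) = N * (N - 1) / 2" using two_choose_two[of n] by simp
  ultimately show ?thesis by simp
qed

lemma s2_sq: "s2^2 = N * (N - 1) * (N - 2) * (N - 3) / 8 * (p ^ 4 * (1 - p)^2 * (1 + 2 * p + (4 * N - 11) * p^2))"
proof -
  have "0 \<le> 3 * real (n choose 4) * p ^ 4 * (1 - p)^2 * (1 + 2 * p + (4 * N - 11) * p^2)"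
    using p0 N4 by (intro mult_nonneg_nonneg add_nonneg_nonneg) auto
  then have "s2^2 = 3 * real (n choose 4) * p ^ 4 * (1 - p)^2 * (1 + 2 * p + (4 * N - 11) * p^2)" by (simp add: sigma2_def)
  then show ?thesis using choose_four[of n] by simp
qed

lemma s1_bounds: "0 < s1" "1 / s1 \<le> \<theta> * (N * sqrt N)"
proof -
  have tn: "\<theta> * (N * sqrt N) = 10 * L / N"
    unfolding \<theta>_def using N4 by (simp add: field_simps power2_eq_square)
  have pos: "0 < s1^2" unfolding s1_sq using p0 p1 N4 by simp
  moreover have "0 \<le> s1" by (simp add: sigma1_def p0 p1 less_imp_le)
  ultimately show s1: "0 < s1" by (simp add: zero_less_power2)
  have "(N / (10 * L))^2 \<le> s1^2"
  proof -
    have a: "(p ^ 3 * (1 - p))^2 \<le> p * (1 - p)"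
    proof -
      have "(p ^ 3 * (1 - p)) * (p ^ 3 * (1 - p)) \<le> 1 * (p ^ 1 * (1 - p))"
        using q_pos p0 p1 by (intro mult_mono mult_right_mono power_decreasing) auto
      then show ?thesis by (simp add: power2_eq_square)
    qed
    have b: "N^2 / 100 \<le> N * (N - 1) / 2" using N4 by (simp add: power2_eq_square)
    have "N / (10 * L) = N * (p ^ 3 * (1 - p)) / 10" by (simp add: L_def)
    then have "(N / (10 * L))^2 = N^2 / 100 * (p ^ 3 * (1 - p))^2"
      by (simp only: power_divide power_mult_distrib[of N]) simp
    also have "\<dots> \<le> N * (N - 1) / 2 * (p * (1 - p))"
      using a b N4 by (intro mult_mono) auto
    finally show ?thesis unfolding s1_sq by simp
  qed
  then have "N / (10 * L) \<le> s1" by (rule power2_le_imp_le) (use s1 in simp)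
  then show "1 / s1 \<le> \<theta> * (N * sqrt N)"
    unfolding tn using s1 N4 L_ge by (simp add: field_simps)
qed

lemma s2_bounds: "0 < s2" "1 / s2 \<le> \<theta>"
proof -
  have lower: "(N^2 * sqrt N / (10 * L))^2 \<le> s2^2"
  proof -
    have c1: "N^4 / 12 \<le> N * (N - 1) * (N - 2) * (N - 3)"
    proof -
      have "N * (3/4 * N) * (1/2 * N) * (1/4 * N) \<le> N * (N - 1) * (N - 2) * (N - 3)"
        using N4 by (intro mult_mono) auto
      moreover have "N^4 / 12 \<le> N * (3/4 * N) * (1/2 * N) * (1/4 * N)"
        by (simp add: power4_eq_xxxx)
      ultimately show ?thesis by linarith
    qed
    \<comment> \<open>Only the part of the bracket in \<open>\<sigma>\<^sub>2\<^sup>2\<close> that grows with \<open>n\<close> is kept.\<close>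
    have c2: "N * p^2 \<le> 1 + 2 * p + (4 * N - 11) * p^2"
    proof -
      have "N * p^2 \<le> (4 * N - 11) * p^2" using N4 by (intro mult_right_mono) auto
      then show ?thesis using p0 by linarith
    qed
    have "N^2 * sqrt N / (10 * L) = N^2 * sqrt N * (p ^ 3 * (1 - p)) / 10" by (simp add: L_def)
    then have "(N^2 * sqrt N / (10 * L))^2 = N^4 * N / 100 * (p ^ 3 * (1 - p))^2"
      by (simp only: power_divide power_mult_distrib[of "N^2 * sqrt N"] power_mult_distrib[of "N^2"]) simp
    also have "\<dots> = N^4 / 100 * (p ^ 4 * (1 - p)^2 * (N * p^2))"
      by (simp add: power_mult_distrib power_mult[symmetric] eval_nat_numeral)
    also have "\<dots> \<le> N * (N - 1) * (N - 2) * (N - 3) / 8 * (p ^ 4 * (1 - p)^2 * (1 + 2 * p + (4 * N - 11) * p^2))"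
    proof (intro mult_mono mult_left_mono c2)
      show "N^4 / 100 \<le> N * (N - 1) * (N - 2) * (N - 3) / 8" using c1 zero_le_power[of N 4] by linarith
    qed (use N4 p0 in auto)
    finally show ?thesis unfolding s2_sq .
  qed
  have p: "0 < N^2 * sqrt N / (10 * L)" using N4 L_ge by simp
  have "0 \<le> 3 * real (n choose 4) * p ^ 4 * (1 - p)^2 * (1 + 2 * p + (4 * N - 11) * p^2)"
    using p0 N4 by (intro mult_nonneg_nonneg add_nonneg_nonneg) auto
  then have "0 \<le> s2" by (simp add: sigma2_def)
  with lower have le: "N^2 * sqrt N / (10 * L) \<le> s2" by (rule power2_le_imp_le)
  then show "0 < s2" using p by linarith
  with le show "1 / s2 \<le> \<theta>"
    unfolding \<theta>_def using p N4 L_ge by (simp add: field_simps)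
qed

lemma arc_field_cmult:
  assumes H: "arc_field 1 H" and c: "0 \<le> c" "c \<le> \<theta>"
  shows "arc_field \<theta> (\<lambda>k X. c * H k X)"
  unfolding arc_field_def
proof (intro conjI ballI allI)
  fix k e X assume k: "k \<in> arcs n" and e: "e \<in> V"
  have "flip_diff e (\<lambda>X. c * H k X) X = c * flip_diff e (H k) X" by (simp add: flip_diff_def algebra_simps)
  then have "\<bar>flip_diff e (\<lambda>X. c * H k X) X\<bar> = c * \<bar>flip_diff e (H k) X\<bar>" using c by (simp add: abs_mult)
  also have "\<dots> \<le> \<theta> * \<beta> n e k" using H k e c unfolding arc_field_def by (intro mult_mono) auto
  finally show "\<bar>flip_diff e (\<lambda>X. c * H k X) X\<bar> \<le> \<theta> * \<beta> n e k" .
next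
  fix k assume k: "k \<in> arcs n"
  have "\<bar>Ex (\<lambda>X. c * H k X)\<bar> = c * \<bar>Ex (H k)\<bar>" unfolding Ex_cmult using c by (simp add: abs_mult)
  also have "\<dots> \<le> \<theta> * (N * sqrt N)" using H k c unfolding arc_field_def by (intro mult_mono) auto
  finally show "\<bar>Ex (\<lambda>X. c * H k X)\<bar> \<le> \<theta> * (N * sqrt N)" .
qed (use H \<theta>_pos in \<open>auto simp: arc_field_def\<close>)

lemma arc_field_const:
  assumes "0 \<le> c" "c \<le> \<theta> * (N * sqrt N)"
  shows "arc_field \<theta> (\<lambda>k X. c)"
  using assms \<theta>_pos less_imp_le[OF \<beta>_pos] by (auto simp: arc_field_def flip_diff_def)

definition W_vec :: "(nat set \<Rightarrow> bool) \<Rightarrow> real \<times> real" where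
  "W_vec X = (W1 n p (graph X), W2 n p (graph X))"

abbreviation "U1 \<equiv> (\<lambda>k X. 1 / (2 * s1)) :: nat \<times> nat \<Rightarrow> (nat set \<Rightarrow> bool) \<Rightarrow> real"
abbreviation "D1 \<equiv> (\<lambda>k X. 1 / s1) :: nat \<times> nat \<Rightarrow> (nat set \<Rightarrow> bool) \<Rightarrow> real"
abbreviation "U2 \<equiv> \<lambda>k X. 1 / s2 * C4_decoupler k X"
abbreviation "D2 \<equiv> \<lambda>k X. 1 / s2 * C4_gradient k X"

lemma arc_fields: "arc_field \<theta> U1" "arc_field \<theta> D1" "arc_field \<theta> U2" "arc_field \<theta> D2"
proof -
  show "arc_field \<theta> U1"
  proof (rule arc_field_const)
    show "1 / (2 * s1) \<le> \<theta> * (N * sqrt N)" using s1_bounds by (simp add: field_simps)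
  qed (use s1_bounds in simp)
  show "arc_field \<theta> D1" by (rule arc_field_const) (use s1_bounds in auto)
  show "arc_field \<theta> U2" "arc_field \<theta> D2"
    using arc_field_cmult[OF arc_field_C4_decoupler _ s2_bounds(2)] arc_field_cmult[OF arc_field_C4_gradient _ s2_bounds(2)] s2_bounds(1) by simp_all
qed

lemma W1_decoupled: "fst (W_vec X) = (\<Sum>k\<in>arcs n. (of_bool (X (edge k)) - p) * U1 k X)"
proof -
  have "(\<Sum>k\<in>arcs n. (of_bool (X (edge k)) - p) * U1 k X) = ((\<Sum>k\<in>arcs n. of_bool (X (edge k))) - (\<Sum>k\<in>arcs n. p)) * (1 / (2 * s1))"
    by (simp only: sum_distrib_right[symmetric] sum_subtractf)
  also have "\<dots> = (2 * T1 (graph X) - 2 * real (n choose 2) * p) * (1 / (2 * s1))"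
    unfolding T1_graph two_choose_two by (simp add: card_arcs)
  also have "\<dots> = fst (W_vec X)"
    using s1_bounds(1) by (simp add: W_vec_def W1_def field_simps)
  finally show ?thesis by simp
qed

lemma W2_eq: "snd (W_vec X) = 1 / s2 * W2num X"
  by (simp add: W_vec_def W2_def W2num_def)

lemma W2_decoupled: "snd (W_vec X) = (\<Sum>k\<in>arcs n. (of_bool (X (edge k)) - p) * U2 k X)"
  unfolding W2_eq W2num_decoupled by (simp add: sum_distrib_left mult_ac)

lemma W_vec_difference:
  assumes k: "k \<in> arcs n"
  shows "W_vec (X(edge k := True)) - W_vec (X(edge k := False)) = (D1 k X, D2 k X)"
proof (rule prod_eqI)
  have d: "flip_diff (edge k) (\<lambda>X. 2 * T1 (graph X)) X = 2"
  proof -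
    have "flip_diff (edge k) (\<lambda>X. 2 * T1 (graph X)) X = (\<Sum>k'\<in>arcs n. of_bool (edge k' = edge k) * 1)"
      unfolding T1_graph flip_diff_def sum_subtractf[symmetric] by (intro sum.cong refl) auto
    also have "\<dots> = 2"
      unfolding sum_arcs_edge(1)[OF edge_in[OF k]] using sum_arcs_edge(2)[OF edge_in[OF k]] by simp
    finally show ?thesis .
  qed
  then have "T1 (graph (X(edge k := True))) = T1 (graph (X(edge k := False))) + 1" by (simp add: flip_diff_def)
  then show "fst (W_vec (X(edge k := True)) - W_vec (X(edge k := False))) = fst (D1 k X, D2 k X)"
    by (simp add: W_vec_def W1_def diff_divide_distrib[symmetric])
  have "snd (W_vec (X(edge k := True)) - W_vec (X(edge k := False))) = 1 / s2 * flip_diff (edge k) W2num X"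
    by (simp only: snd_diff W2_eq flip_diff_def right_diff_distrib)
  then show "snd (W_vec (X(edge k := True)) - W_vec (X(edge k := False))) = snd (D1 k X, D2 k X)"
    by (simp only: flip_diff_W2num[OF k] snd_conv)
qed

text \<open>
  The normalisation by \<open>\<sigma>\<^sub>1\<close> and \<open>\<sigma>\<^sub>2\<close> makes the covariance matrix of \<open>W\<close> the identity; the off-diagonal entries
  vanish because the coefficients of the second component have mean zero.
\<close>

lemma covariance_identity:
  "Ex (carre U1 D1) = 1" "Ex (carre U1 D2) = 0" "Ex (carre U2 D1) = 0" "Ex (carre U2 D2) = 1"
proof -
  note ce = carre_expectation[OF arc_fields(1) arc_fields(2)] carre_expectation[OF arc_fields(1) arc_fields(4)]
    carre_expectation[OF arc_fields(3) arc_fields(2)] carre_expectation[OF arc_fields(3) arc_fields(4)]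
  have "Ex (carre U1 D1) = p * (1 - p) * (N * (N - 1)) / (2 * s1^2)"
    unfolding ce(1) by (simp add: card_arcs power2_eq_square)
  also have "\<dots> = (s1^2 * 2) / (2 * s1^2)" unfolding s1_sq by simp
  also have "\<dots> = 1" using s1_bounds(1) by simp
  finally show "Ex (carre U1 D1) = 1" .
  show "Ex (carre U1 D2) = 0" unfolding ce(2) by (simp add: C4_gradient_mean)
  show "Ex (carre U2 D1) = 0" unfolding ce(3) by (simp add: C4_decoupler_mean)
  have e: "Ex (\<lambda>X. U2 k X * D2 k X) = 1 / s2^2 * Ex (\<lambda>X. C4_decoupler k X * C4_gradient k X)" for k
    unfolding Ex_cmult[symmetric] by (simp add: power2_eq_square)
  have "Ex (carre U2 D2) = p * (1 - p) * (N * (N - 1) * (1 / s2^2 * ((N - 2) * (N - 3) * (p^3 * (1 - p) * (1 + 2 * p + (4 * N - 11) * p^2)) / 8)))"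
    unfolding ce(4) e by (simp add: C4_decoupler_gradient_expectation card_arcs)
  also have "\<dots> = (p * (1 - p) * (N * (N - 1) * ((N - 2) * (N - 3) * (p^3 * (1 - p) * (1 + 2 * p + (4 * N - 11) * p^2)) / 8))) / s2^2"
    by simp
  also have "p * (1 - p) * (N * (N - 1) * ((N - 2) * (N - 3) * (p^3 * (1 - p) * (1 + 2 * p + (4 * N - 11) * p^2)) / 8)) = s2^2"
    unfolding s2_sq by (simp add: power2_eq_square power3_eq_cube power4_eq_xxxx)
  finally have "Ex (carre U2 D2) = s2^2 / s2^2" .
  then show "Ex (carre U2 D2) = 1" using s2_bounds(1) by simp
qed

definition W_step :: "nat \<times> nat \<Rightarrow> (nat set \<Rightarrow> bool) \<Rightarrow> real \<times> real" where
  "W_step k X = (of_bool (X (edge k)) - p) *\<^sub>R (D1 k X, D2 k X)"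

text \<open>
  The factor is large enough for \<open>variance_le_rate\<close> and \<open>remainder_le_rate\<close>, both of which use \<open>1 \<le> L\<close>.
\<close>

definition rate :: real where "rate = 10000 * (L ^ 3 / sqrt N)"

lemma rate_sq: "rate^2 = 100000000 * L^6 / N"
  unfolding rate_def power_mult_distrib power_divide by (simp add: power_mult[symmetric])

lemma variance_le_rate: "2000 * \<theta>^4 * N^9 \<le> rate^2"
proof -
  have "\<theta>^4 = 10000 * L^4 / (N^8 * N^2)"
  proof -
    have "(sqrt N)^4 = N^2" using power_mult[of "sqrt N" 2 2] by simp
    then show ?thesis by (simp add: \<theta>_def power_divide power_mult_distrib power_mult[symmetric])
  qed
  then have "2000 * \<theta>^4 * N^9 = 20000000 * L^4 / N"
    using N4 by (simp add: eval_nat_numeral)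
  also have "\<dots> \<le> 100000000 * L^6 / N"
  proof (rule divide_right_mono)
    have "L^4 \<le> L^6" "0 \<le> L^6" using L_ge by (auto intro: power_increasing)
    then show "20000000 * L^4 \<le> 100000000 * L^6" by linarith
  qed simp
  finally show ?thesis unfolding rate_sq .
qed

lemma remainder_le_rate: "7000 * \<theta>^3 * N^6 * sqrt N \<le> rate^2"
proof -
  have "\<theta>^3 = 1000 * L^3 / (N^6 * (N * sqrt N))"
    by (simp add: \<theta>_def power_divide power_mult_distrib power_mult[symmetric] power3_eq_cube[of "sqrt N"])
  then have "7000 * \<theta>^3 * N^6 * sqrt N = 7000000 * L^3 / N"
    using N4 by simp
  also have "\<dots> \<le> 100000000 * L^6 / N"
  proof (rule divide_right_mono)
    have "L^3 \<le> L^6" "0 \<le> L^6" using L_ge by (auto intro: power_increasing)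
    then show "7000000 * L^3 \<le> 100000000 * L^6" by linarith
  qed simp
  finally show ?thesis unfolding rate_sq .
qed

lemma coin_le_1: "\<bar>of_bool b - p\<bar> \<le> 1"
  using p0 p1 by (cases b) auto

lemma remainder_bound:
  assumes H: "arc_field \<theta> H"
  shows "(\<Sum>k\<in>arcs n. Ex (\<lambda>X. \<bar>(of_bool (X (edge k)) - p) * H k X\<bar> * (\<bar>fst (W_step k X)\<bar> + \<bar>snd (W_step k X)\<bar>)^2)) \<le> rate^2"
proof -
  have "(\<Sum>k\<in>arcs n. Ex (\<lambda>X. \<bar>(of_bool (X (edge k)) - p) * H k X\<bar> * (\<bar>fst (W_step k X)\<bar> + \<bar>snd (W_step k X)\<bar>)^2))
    \<le> (\<Sum>k\<in>arcs n. Ex (\<lambda>X. \<bar>H k X\<bar> * (\<bar>D1 k X\<bar> + \<bar>D2 k X\<bar>)^2))"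
  proof (intro sum_mono Ex_mono)
    fix k X
    let ?y = "of_bool (X (edge k)) - p"
    have 1: "\<bar>?y * H k X\<bar> \<le> \<bar>H k X\<bar>"
      unfolding abs_mult using mult_right_mono[OF coin_le_1, of "\<bar>H k X\<bar>"] by simp
    have 2: "\<bar>fst (W_step k X)\<bar> + \<bar>snd (W_step k X)\<bar> \<le> \<bar>D1 k X\<bar> + \<bar>D2 k X\<bar>"
    proof -
      have "\<bar>?y\<bar> * \<bar>D1 k X\<bar> \<le> 1 * \<bar>D1 k X\<bar>" "\<bar>?y\<bar> * \<bar>D2 k X\<bar> \<le> 1 * \<bar>D2 k X\<bar>"
        by (intro mult_right_mono coin_le_1 abs_ge_zero)+
      then show ?thesis
        by (simp only: W_step_def fst_scaleR snd_scaleR fst_conv snd_conv real_scaleR_def abs_mult)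
    qed
    show "\<bar>?y * H k X\<bar> * (\<bar>fst (W_step k X)\<bar> + \<bar>snd (W_step k X)\<bar>)^2 \<le> \<bar>H k X\<bar> * (\<bar>D1 k X\<bar> + \<bar>D2 k X\<bar>)^2"
      by (intro mult_mono 1 power_mono 2) auto
  qed
  also have "\<dots> \<le> 7000 * \<theta>^3 * N^6 * sqrt N"
    by (rule third_moment_sum[OF H arc_fields(2) arc_fields(4) \<theta>_pos])
  finally show ?thesis using remainder_le_rate by linarith
qed

lemma carre_close:
  assumes "arc_field \<theta> H" "arc_field \<theta> H'"
  shows "Ex (\<lambda>X. (Ex (carre H H') - carre H H' X)^2) \<le> rate^2"
  using carre_variance[OF assms] variance_le_rate by (simp add: power2_commute)

lemma carre_eq:
  "(\<Sum>k\<in>arcs n. (of_bool (X (edge k)) - p) * H k X * ((of_bool (X (edge k)) - p) * H' k X)) = carre H H' X"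
  unfolding carre_def by (intro sum.cong refl) (simp add: power2_eq_square)

lemma C4_stein_coupling: "stein_coupling (bern V p) W_vec (arcs n)
    (\<lambda>k X. (of_bool (X (edge k)) - p) * U1 k X) (\<lambda>k X. (of_bool (X (edge k)) - p) * U2 k X) W_step rate"
proof
  have p: "0 \<le> p" "p \<le> 1" using p0 p1 by auto
  have \<Delta>: "W_step k X = (of_bool (X (edge k)) - p) *\<^sub>R (W_vec (X(edge k := True)) - W_vec (X(edge k := False)))" if "k \<in> arcs n" for k X
    unfolding W_step_def W_vec_difference[OF that] ..
  show "finite (set_pmf (bern V p))" by (simp add: finite_bern)
  show "finite (arcs n)" by simp
  show "0 < rate" unfolding rate_def using L_ge N4 by simp
  show "Ex (\<lambda>X. fst (W_vec X) * \<psi> (W_vec X)) = (\<Sum>k\<in>arcs n. Ex (\<lambda>X. (of_bool (X (edge k)) - p) * U1 k X * (\<psi> (W_vec X) - \<psi> (W_vec X - W_step k X))))" for \<psi>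
    by (rule coordinate_coupling[where F = "\<lambda>X. fst (W_vec X)" and \<epsilon> = edge and U = U1, OF finite_vertex_pairs p edge_in W1_decoupled _ \<Delta>]) auto
  show "Ex (\<lambda>X. snd (W_vec X) * \<psi> (W_vec X)) = (\<Sum>k\<in>arcs n. Ex (\<lambda>X. (of_bool (X (edge k)) - p) * U2 k X * (\<psi> (W_vec X) - \<psi> (W_vec X - W_step k X))))" for \<psi>
    by (rule coordinate_coupling[where F = "\<lambda>X. snd (W_vec X)" and \<epsilon> = edge and U = U2, OF finite_vertex_pairs p edge_in W2_decoupled _ \<Delta>])
       (simp_all add: arc_field_same_edge[OF arc_field_C4_decoupler])
  have T: "(\<Sum>k\<in>arcs n. (of_bool (X (edge k)) - p) * H k X * fst (W_step k X)) = carre H D1 X"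
    "(\<Sum>k\<in>arcs n. (of_bool (X (edge k)) - p) * H k X * snd (W_step k X)) = carre H D2 X" for H X
    unfolding W_step_def fst_scaleR snd_scaleR fst_conv snd_conv real_scaleR_def by (rule carre_eq)+
  show "Ex (\<lambda>X. (1 - (\<Sum>k\<in>arcs n. (of_bool (X (edge k)) - p) * U1 k X * fst (W_step k X)))^2) \<le> rate^2"
    unfolding T[of _ U1] using carre_close[OF arc_fields(1,2), unfolded covariance_identity] .
  show "Ex (\<lambda>X. (\<Sum>k\<in>arcs n. (of_bool (X (edge k)) - p) * U1 k X * snd (W_step k X))^2) \<le> rate^2"
    unfolding T[of _ U1] using carre_close[OF arc_fields(1,4), unfolded covariance_identity] by simp
  show "Ex (\<lambda>X. (\<Sum>k\<in>arcs n. (of_bool (X (edge k)) - p) * U2 k X * fst (W_step k X))^2) \<le> rate^2"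
    unfolding T[of _ U2] using carre_close[OF arc_fields(3,2), unfolded covariance_identity] by simp
  show "Ex (\<lambda>X. (1 - (\<Sum>k\<in>arcs n. (of_bool (X (edge k)) - p) * U2 k X * snd (W_step k X)))^2) \<le> rate^2"
    unfolding T[of _ U2] using carre_close[OF arc_fields(3,4), unfolded covariance_identity] .
qed (rule remainder_bound arc_fields)+

lemma convex_dist_rate:
  "convex_dist (measure_pmf (map_pmf (\<lambda>G. (W1 n p G, W2 n p G)) (erdos_renyi n p))) std_bivariate_normal
    \<le> (2 + 488 * kernel_mass^2 + 1024 * kernel_mass^4) * rate"
proof -
  have "map_pmf (\<lambda>G. (W1 n p G, W2 n p G)) (erdos_renyi n p) = map_pmf W_vec (bern V p)"
    unfolding erdos_renyi_def pmf.map_comp by (rule arg_cong2[of _ _ _ _ map_pmf]) (auto simp: W_vec_def graph_def fun_eq_iff)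
  then show ?thesis
    using convex_dist_le_gap[OF finite_bern[OF finite_vertex_pairs], of W_vec n p] stein_coupling.convex_gap_le[OF C4_stein_coupling] by simp
qed

lemma rate_eq: "rate = 10000 / (p ^ 9 * (1 - p) ^ 3 * sqrt N)"
  unfolding rate_def L_def by (simp add: power_divide power_mult_distrib power_mult[symmetric])

end

theorem theorem3p3:
  shows "\<exists>C::real. \<forall>(n::nat) (p::real). n \<ge> 4 \<longrightarrow> 0 < p \<longrightarrow> p < 1 \<longrightarrow>
    convex_dist
      (measure_pmf (map_pmf (\<lambda>G. (W1 n p G, W2 n p G)) (erdos_renyi n p)))
      std_bivariate_normal
    \<le> C / (p ^ 9 * (1 - p) ^ 3 * sqrt (real n))"
proof (intro exI allI impI)
  fix n :: nat and p :: real
  assume "n \<ge> 4" "0 < p" "p < 1"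
  then interpret gnp n p by unfold_locales
  show "convex_dist (measure_pmf (map_pmf (\<lambda>G. (W1 n p G, W2 n p G)) (erdos_renyi n p))) std_bivariate_normal
    \<le> ((2 + 488 * kernel_mass^2 + 1024 * kernel_mass^4) * 10000) / (p ^ 9 * (1 - p) ^ 3 * sqrt (real n))"
    using convex_dist_rate unfolding rate_eq by simp
qed

end
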